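(* Let $R$ be a noetherian regular local ring of dimension 2 with maximal ideal $\mathfrak{m}$, residue field $K=R/\mathfrak{m}$ and quotient field $QF(R)$. Let $z\in QF(R)$, $z\neq 0$, and let $R_v$ be a dicritical divisor of $z$, with associated valuation $v$, residue map $\mathrm{Res}_v:R_v\to K_v$, and $K'$ the relative algebraic closure of $K$ in $K_v$. Suppose that there exist a regular system of parameters $(x,y)$ of $\mathfrak{m}$ and $a_0,b_0\in\mathbb{N}$ such that $f:=zx^{a_0}y^{b_0}\in R$. (1) If $v$ is not monomial with respect to $(x,y)$, then there exists $t\in K_v$, transcendental over $K$, with $K_v=K'(t)$ and $\mathrm{Res}_v(z)\in K'[t]$. (2) If $v$ is monomial with respect to $(x,y)$, put $\alpha:=v(x)$ and $\beta:=v(y)$ (positive integers), $\gamma:=a_0\alpha+b_0\beta=v(f)$, and write $$f=\sum_{a\alpha+b\beta\geq\gamma}\lambda_{a,b}\,x^ay^b\quad\text{(a finite sum over pairs }(a,b)\in\mathbb{N}^2\text{)},\qquad \lambda_{a,b}\in R,$$ with $$B_f:=\{b\in\mathbb{N}\ |\ \text{there is } a\in\mathbb{N}\text{ with } a\alpha+b\beta=\gamma\text{ and }\lambda_{a,b}\in R\setminus\mathfrak{m}\}\neq\emptyset .$$ (a) If $\mathrm{Card}(B_f)\geq 2$, then there exists $t\in K_v$, transcendental over $K$, with $K_v=K'(t)$ and $\mathrm{Res}_v(z)\in K'[t]$ if and only if $b_0\leq\min(B_f)$ or $b_0\geq\max(B_f)$. (b) If $B_f=\{b_1\}$, then $b_0\neq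 b_1$, and there exists $t\in K_v$, transcendental over $K$, with $K_v=K'(t)$ and $\mathrm{Res}_v(z)\in K'[t]$.
   Context: $\mathbb{N}$ denotes the non-negative integers. Prime divisor: a prime divisor of $R$ is a discrete valuation ring $R_v$ with quotient field $QF(R_v)=QF(R)$ which dominates $R$ (i.e. $R\subset R_v$ and $\mathfrak{m}_v\cap R=\mathfrak{m}$, where $\mathfrak{m}_v$ is the maximal ideal of $R_v$) and whose residue field $K_v:=R_v/\mathfrak{m}_v$ has transcendence degree 1 over $K$. Here $K$ is regarded as a subfield of $K_v$ via $K=R/(R\cap\mathfrak{m}_v)$. The corresponding (normalized) valuation is $v:QF(R)\to\mathbb{Z}\cup\{\infty\}$, and $\mathrm{Res}_v:R_v\to K_v$ is the residue map. Dicritical divisor: for $z\in QF(R)$, $z\ne 0$, a dicritical divisor of $z$ is a prime divisor $R_v$ of $R$ such that $z\in R_v$ and $\mathrm{Res}_v(z)$ is transcendental over $K$. Monomial valuation: given a regular system of parameters $(x,y)$ of $\mathfrak{m}$, the valuation $v$ is monomial with respect to $(x,y)$ if for every polynomial expansion $P=\sum_{a,b}\lambda_{a,b}x^ay^b$ (finite sum) with each $\lambda_{a,b}$ either $0$ or in $R\setminus\mathfrak{m}$, one has $v(P)=\min\{a\,v(x)+b\,v(y)\ |\ \lambda_{a,b}\neq 0\}$. Known fact (Abhyankar): for a prime divisor $R_v$ of $R$, letting $K'$ be the relative algebraic closure of $K$ in $K_v$, one has $[K':K]<\infty$ and $K_v=K'(t)$ for some $t\in K_v$ transcendental over $K$;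 such a $t$ is not unique. *)

theory Defs
  imports "HOL-Algebra.Algebra" "HOL-Library.Extended_Nat" "HOL-Library.Extended"
begin

text \<open>
  A domain and its overrings inside its quotient field are represented as subsets of the carrier
  of one fixed field \<open>L\<close>; a subring \<open>S\<close> of \<open>L\<close> is turned into a ring by
  \<open>L\<lparr>carrier := S\<rparr>\<close>.
\<close>

definition quotient_field_of :: "('a, 'b) ring_scheme \<Rightarrow> 'a set \<Rightarrow> bool" where
  "quotient_field_of L S \<longleftrightarrow> field L \<and> subring S L \<and>
     (\<forall>u\<in>carrier L. \<exists>a\<in>S. \<exists>b\<in>S - {\<zero>\<^bsub>L\<^esub>}. u = a \<otimes>\<^bsub>L\<^esub> inv\<^bsub>L\<^esub> b)"

section \<open>Regular local rings\<close>

definition local_ring :: "('a, 'b) ring_scheme \<Rightarrow> bool" where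
  "local_ring R \<longleftrightarrow> cring R \<and> (\<exists>!m. maximalideal m R)"

definition max_ideal :: "('a, 'b) ring_scheme \<Rightarrow> 'a set" where
  "max_ideal R = (THE m. maximalideal m R)"

definition prime_chain :: "('a, 'b) ring_scheme \<Rightarrow> nat \<Rightarrow> (nat \<Rightarrow> 'a set) \<Rightarrow> bool" where
  "prime_chain R n P \<longleftrightarrow> (\<forall>i\<le>n. primeideal (P i) R) \<and> (\<forall>i<n. P i \<subset> P (Suc i))"

definition krull_dim :: "('a, 'b) ring_scheme \<Rightarrow> enat" where
  "krull_dim R = (SUP n\<in>{n. \<exists>P. prime_chain R n P}. enat n)"

definition regular_local_ring :: "nat \<Rightarrow> ('a, 'b) ring_scheme \<Rightarrow> bool" where
  "regular_local_ring d R \<longleftrightarrow>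
     noetherian_ring R \<and> local_ring R \<and> krull_dim R = enat d \<and>
     (\<exists>S\<subseteq>carrier R. finite S \<and> card S = d \<and> max_ideal R = Idl\<^bsub>R\<^esub> S)"

text \<open>Regular systems of parameters of a two-dimensional regular local ring.\<close>

definition regular_parameters :: "('a, 'b) ring_scheme \<Rightarrow> 'a \<Rightarrow> 'a \<Rightarrow> bool" where
  "regular_parameters R x y \<longleftrightarrow>
     x \<in> carrier R \<and> y \<in> carrier R \<and> max_ideal R = Idl\<^bsub>R\<^esub> {x, y}"

section \<open>Discrete valuation rings\<close>

definition discrete_valuation_ring :: "('a, 'b) ring_scheme \<Rightarrow> bool" where
  "discrete_valuation_ring V \<longleftrightarrow> principal_domain V \<and> local_ring V \<and> \<not> field V"

text \<open>
  Every nonzero element of \<open>L\<close> is \<open>u p\<^sup>n\<close> with \<open>u\<close> a unit of \<open>V\<close>, \<open>p\<close> a generator of the maximal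
  ideal of \<open>V\<close>, and \<open>n\<close> an integer that depends neither on \<open>u\<close> nor on \<open>p\<close>. The value \<open>Minf\<close> of
  the type \<open>int extended\<close> is never taken.
\<close>

definition valuation :: "('a, 'b) ring_scheme \<Rightarrow> 'a set \<Rightarrow> 'a \<Rightarrow> int extended" where
  "valuation L V w =
     (if w = \<zero>\<^bsub>L\<^esub> then Pinf
      else Fin (THE n::int. \<exists>p\<in>V. \<exists>u\<in>Units (L\<lparr>carrier := V\<rparr>).
        max_ideal (L\<lparr>carrier := V\<rparr>) = PIdl\<^bsub>L\<lparr>carrier := V\<rparr>\<^esub> p \<and>
        w = u \<otimes>\<^bsub>L\<^esub> (p [^]\<^bsub>L\<^esub> n)))"

definition residue_field :: "('a, 'b) ring_scheme \<Rightarrow> 'a set \<Rightarrow> 'a set ring" where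
  "residue_field L V = L\<lparr>carrier := V\<rparr> Quot max_ideal (L\<lparr>carrier := V\<rparr>)"

definition Res :: "('a, 'b) ring_scheme \<Rightarrow> 'a set \<Rightarrow> 'a \<Rightarrow> 'a set" where
  "Res L V w = max_ideal (L\<lparr>carrier := V\<rparr>) +>\<^bsub>L\<lparr>carrier := V\<rparr>\<^esub> w"

section \<open>Prime divisors and dicritical divisors\<close>

definition dominates :: "('a, 'b) ring_scheme \<Rightarrow> 'a set \<Rightarrow> 'a set \<Rightarrow> bool" where
  "dominates L R V \<longleftrightarrow>
     R \<subseteq> V \<and> max_ideal (L\<lparr>carrier := V\<rparr>) \<inter> R = max_ideal (L\<lparr>carrier := R\<rparr>)"

text \<open>
  The residue field \<open>R / (R \<inter> m\<^sub>V)\<close> of \<open>R\<close>, as a subfield of the residue field of a ring \<open>V\<close>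
  dominating \<open>R\<close>.
\<close>

definition base_field :: "('a, 'b) ring_scheme \<Rightarrow> 'a set \<Rightarrow> 'a set \<Rightarrow> 'a set set" where
  "base_field L R V = Res L V ` R"

text \<open>Some \<open>{t}\<close> is a transcendence basis of \<open>F\<close> over \<open>K\<close>.\<close>

definition transcendence_degree_one :: "('a, 'b) ring_scheme \<Rightarrow> 'a set \<Rightarrow> bool" where
  "transcendence_degree_one F K \<longleftrightarrow>
     (\<exists>t\<in>carrier F. ring.transcendental F K t \<and>
        (\<forall>u\<in>carrier F. \<not> ring.transcendental F (generate_field F (insert t K)) u))"

definition prime_divisor :: "('a, 'b) ring_scheme \<Rightarrow> 'a set \<Rightarrow> 'a set \<Rightarrow> bool" where
  "prime_divisor L R V \<longleftrightarrow>
     quotient_field_of L V \<and> discrete_valuation_ring (L\<lparr>carrier := V\<rparr>) \<and>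
     dominates L R V \<and> transcendence_degree_one (residue_field L V) (base_field L R V)"

definition dicritical_divisor :: "('a, 'b) ring_scheme \<Rightarrow> 'a set \<Rightarrow> 'a \<Rightarrow> 'a set \<Rightarrow> bool" where
  "dicritical_divisor L R z V \<longleftrightarrow>
     prime_divisor L R V \<and> z \<in> V \<and>
     ring.transcendental (residue_field L V) (base_field L R V) (Res L V z)"

definition rel_alg_closure :: "('a, 'b) ring_scheme \<Rightarrow> 'a set \<Rightarrow> 'a set" where
  "rel_alg_closure F K = {u \<in> carrier F. \<not> ring.transcendental F K u}"

text \<open>
  There is a \<open>t\<close> in the residue field \<open>K\<^sub>V\<close>, transcendental over \<open>K\<close>, with \<open>K\<^sub>V = K'(t)\<close> and
  \<open>Res z \<in> K'[t]\<close>, where \<open>K'\<close> is the relative algebraic closure of \<open>K\<close> in \<open>K\<^sub>V\<close>.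
\<close>

definition residue_polynomial :: "('a, 'b) ring_scheme \<Rightarrow> 'a set \<Rightarrow> 'a set \<Rightarrow> 'a \<Rightarrow> bool" where
  "residue_polynomial L R V z \<longleftrightarrow>
     (let F = residue_field L V; K = base_field L R V; K' = rel_alg_closure F K in
      \<exists>t\<in>carrier F. ring.transcendental F K t \<and>
        carrier F = generate_field F (insert t K') \<and>
        (\<exists>p\<in>carrier (univ_poly F K'). Res L V z = ring.eval F p t))"

section \<open>Monomial expansions and monomial valuations\<close>

text \<open>
  Finite sums \<open>\<Sum> c(a,b) x\<^sup>a y\<^sup>b\<close> are encoded by coefficient functions with finite support.
\<close>

definition xy_support :: "('a, 'b) ring_scheme \<Rightarrow> (nat \<times> nat \<Rightarrow> 'a) \<Rightarrow> (nat \<times> nat) set" where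
  "xy_support L c = {p. c p \<noteq> \<zero>\<^bsub>L\<^esub>}"

definition xy_sum :: "('a, 'b) ring_scheme \<Rightarrow> 'a \<Rightarrow> 'a \<Rightarrow> (nat \<times> nat \<Rightarrow> 'a) \<Rightarrow> 'a" where
  "xy_sum L x y c =
     (\<Oplus>\<^bsub>L\<^esub>p\<in>xy_support L c. c p \<otimes>\<^bsub>L\<^esub> (x [^]\<^bsub>L\<^esub> fst p) \<otimes>\<^bsub>L\<^esub> (y [^]\<^bsub>L\<^esub> snd p))"

text \<open>
  The empty support is left out of the monomiality condition: there both sides are infinite by
  convention.
\<close>

definition monomial_valuation ::
    "('a, 'b) ring_scheme \<Rightarrow> 'a set \<Rightarrow> 'a set \<Rightarrow> 'a \<Rightarrow> 'a \<Rightarrow> bool" where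
  "monomial_valuation L R V x y \<longleftrightarrow>
     (\<exists>\<alpha> \<beta> :: int. valuation L V x = Fin \<alpha> \<and> valuation L V y = Fin \<beta> \<and>
       (\<forall>c. finite (xy_support L c) \<and> xy_support L c \<noteq> {} \<and>
            (\<forall>p. c p = \<zero>\<^bsub>L\<^esub> \<or> c p \<in> R - max_ideal (L\<lparr>carrier := R\<rparr>)) \<longrightarrow>
          valuation L V (xy_sum L x y c) =
            Fin (Min ((\<lambda>(a, b). int a * \<alpha> + int b * \<beta>) ` xy_support L c))))"

definition weighted_expansion ::
    "('a, 'b) ring_scheme \<Rightarrow> 'a set \<Rightarrow> 'a \<Rightarrow> 'a \<Rightarrow> nat \<Rightarrow> nat \<Rightarrow> nat \<Rightarrow> 'a \<Rightarrow>
      (nat \<times> nat \<Rightarrow> 'a) \<Rightarrow> bool" where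
  "weighted_expansion L R x y \<alpha> \<beta> \<gamma> f c \<longleftrightarrow>
     finite (xy_support L c) \<and> (\<forall>p. c p \<in> R) \<and>
     (\<forall>(a, b)\<in>xy_support L c. a * \<alpha> + b * \<beta> \<ge> \<gamma>) \<and>
     f = xy_sum L x y c"

definition B_set ::
    "('a, 'b) ring_scheme \<Rightarrow> 'a set \<Rightarrow> nat \<Rightarrow> nat \<Rightarrow> nat \<Rightarrow> (nat \<times> nat \<Rightarrow> 'a) \<Rightarrow> nat set" where
  "B_set L R \<alpha> \<beta> \<gamma> c =
     {b. \<exists>a. a * \<alpha> + b * \<beta> = \<gamma> \<and> c (a, b) \<in> R - max_ideal (L\<lparr>carrier := R\<rparr>)}"

end

theory Submission
  imports Defs
begin

text \<open>
  Let \<open>v\<close> be the valuation of \<open>V\<close>, \<open>F\<close> its residue field, \<open>k\<close> the relative algebraic closure of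
  the residue field of \<open>R\<close> in \<open>F\<close>, and write \<open>res\<close> for the residue map.

  Put \<open>\<alpha> = v x\<close>, \<open>\<beta> = v y\<close>, divide both by their gcd to get \<open>\<alpha>'\<close>, \<open>\<beta>'\<close>, and let
  \<open>s = y^\<alpha>' / x^\<beta>'\<close>, a unit of \<open>V\<close>. Two monomials of the same weight differ by a power of \<open>s\<close>, so
  the monomiality of \<open>v\<close> is a statement about \<open>\<sigma> = res s\<close>: it means that \<open>\<sigma>\<close> is transcendental,
  that is, \<open>\<sigma> \<notin> k\<close>. An algebraic relation for \<open>\<sigma>\<close> turns, after homogenization, into a form in \<open>x\<close>
  and \<open>y\<close> whose value exceeds its weight (\<open>monomial_imp_transcendental\<close>). If \<open>\<sigma>\<close> is
  transcendental, then the leading form of an expansion has a nonzero residue after division by a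
  monomial (\<open>value_of_lead\<close>). In that case the valuation ideals of \<open>R\<close> are generated by monomials
  (\<open>ge_expandable\<close>), hence \<open>F = k(\<sigma>)\<close> (\<open>residue_field_generated\<close>), and the residue of
  \<open>z = f / (x^a\<^sub>0 y^b\<^sub>0)\<close> is a Laurent polynomial in \<open>\<sigma>\<close> whose exponents are \<open>(b - b\<^sub>0) / \<alpha>'\<close> for \<open>b\<close> in
  the set \<open>B\<close> of the leading terms. It is a polynomial in \<open>\<sigma>\<close> if \<open>b\<^sub>0 \<le> min B\<close> and in \<open>1/\<sigma>\<close> if
  \<open>b\<^sub>0 \<ge> max B\<close>. Otherwise it has a pole at \<open>\<sigma> = 0\<close> and another one at \<open>\<sigma> = \<infinity>\<close>. If it were a
  polynomial in a generator \<open>t\<close> of \<open>F\<close> over \<open>k\<close>, then \<open>w = 1/t\<close> would vanish at both places; but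
  \<open>\<sigma> \<in> k(w)\<close> is an integral power of \<open>w\<close> times a rational function that is a unit wherever \<open>w\<close>
  vanishes, so \<open>\<sigma>\<close> could not have a zero at one of the places and a pole at the other
  (\<open>not_polynomial_of_two_poles\<close>).

  If \<open>v\<close> is not monomial, \<open>R\<close> is replaced by a quadratic transform (\<open>quadratic_transform\<close>). Say
  \<open>v x \<le> v y\<close>. The residue of \<open>u = y/x\<close> lies in \<open>k\<close>, since otherwise \<open>v\<close> would be monomial, and
  \<open>R[u]\<close> localized at the centre of \<open>V\<close> is a local ring whose maximal ideal is generated by \<open>x\<close> and
  some \<open>h\<close>, where \<open>h = u\<close> if \<open>v x < v y\<close>. As \<open>f\<close> lies in the maximal ideal of \<open>R\<close>, it becomes
  divisible by \<open>x\<close>, so \<open>z\<close> can be written over the new ring with a monomial denominator of smaller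
  value (\<open>descent_step\<close>). The value cannot drop to zero, because then \<open>z\<close> would lie in a ring whose
  residues are algebraic. So the process reaches a pair of parameters with respect to which \<open>v\<close> is
  monomial. As \<open>v\<close> was not monomial at the start, the transition happens at a step with
  \<open>v x = v y\<close>; there \<open>u\<close> is a unit, the new denominator is a power of \<open>x\<close> alone, and this remains
  compatible with the one-sided case of the first part (\<open>polynomial_residue_descent\<close>). The
  generator \<open>t\<close> of \<open>F\<close> over \<open>k\<close> is found at the end of the descent, as the residue of a quotient
  of two monomials.
\<close>

section \<open>Inverses in fields\<close>

context field begin

lemma inv_nonzero: "a \<in> carrier R \<Longrightarrow> a \<noteq> \<zero> \<Longrightarrow> inv a \<in> carrier R \<and> inv a \<noteq> \<zero> \<and> a \<otimes> inv a = \<one> \<and> inv a \<otimes> a = \<one>"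
  using field_Units Units_inv_closed Units_r_inv Units_l_inv
  by (metis Diff_iff empty_iff insert_iff integral_iff r_null one_not_zero)

lemma inv_closed' [simp]: "a \<in> carrier R \<Longrightarrow> a \<noteq> \<zero> \<Longrightarrow> inv a \<in> carrier R"
  and inv_not_zero [simp]: "a \<in> carrier R \<Longrightarrow> a \<noteq> \<zero> \<Longrightarrow> inv a \<noteq> \<zero>"
  and r_inv' [simp]: "a \<in> carrier R \<Longrightarrow> a \<noteq> \<zero> \<Longrightarrow> a \<otimes> inv a = \<one>"
  and l_inv' [simp]: "a \<in> carrier R \<Longrightarrow> a \<noteq> \<zero> \<Longrightarrow> inv a \<otimes> a = \<one>"
  using inv_nonzero by auto

lemma pow_nonzero [simp]: "a \<in> carrier R \<Longrightarrow> a \<noteq> \<zero> \<Longrightarrow> a [^] (n::nat) \<noteq> \<zero>"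
  by (induct n) (auto simp: integral_iff)

lemma cancel_r: "a \<in> carrier R \<Longrightarrow> b \<in> carrier R \<Longrightarrow> c \<in> carrier R \<Longrightarrow> c \<noteq> \<zero> \<Longrightarrow>
    a \<otimes> c = b \<otimes> c \<longleftrightarrow> a = b"
  using m_rcancel by blast

lemma inv_unique': "a \<in> carrier R \<Longrightarrow> b \<in> carrier R \<Longrightarrow> a \<otimes> b = \<one> \<Longrightarrow> b = inv a"
  using comm_inv_char by metis

lemma mult_inv_cancel: "a \<in> carrier R \<Longrightarrow> b \<in> carrier R \<Longrightarrow> b \<noteq> \<zero> \<Longrightarrow> a \<otimes> inv b \<otimes> b = a"
  by (simp add: m_assoc)

end

section \<open>Rings of fractions\<close>

text \<open>
  Fractions with numerator in \<open>A\<close> and denominator in \<open>U\<close>, as elements of the ambient ring. The same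
  closure argument serves three rings below: the localization at the centre of a valuation, the local
  ring of \<open>k(u)\<close> at \<open>u = 0\<close>, and \<open>k(u)\<close> itself.
\<close>

definition (in ring) fractions :: "'a set \<Rightarrow> 'a set \<Rightarrow> 'a set" where
  "fractions A U = {w \<in> carrier R. \<exists>q\<in>U. w \<otimes> q \<in> A}"

lemma (in cring) fractions_incl: "A \<subseteq> carrier R \<Longrightarrow> \<one> \<in> U \<Longrightarrow> A \<subseteq> fractions A U"
proof
  fix a assume a: "A \<subseteq> carrier R" "\<one> \<in> U" "a \<in> A"
  then have "a \<otimes> \<one> \<in> A" "a \<in> carrier R" by auto
  then show "a \<in> fractions A U" unfolding fractions_def using a(2) by blast
qed

lemma (in cring) fractions_subring:
  assumes A: "subring A R" and U: "U \<subseteq> A" "\<one> \<in> U" and mult: "\<And>q q'. q \<in> U \<Longrightarrow> q' \<in> U \<Longrightarrow> q \<otimes> q' \<in> U"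
  shows "subring (fractions A U) R"
proof (rule subringI)
  have Ac: "A \<subseteq> carrier R" using subringE(1)[OF A] .
  show "fractions A U \<subseteq> carrier R" unfolding fractions_def by auto
  show "\<one> \<in> fractions A U" using fractions_incl[OF Ac U(2)] subringE(3)[OF A] by blast
  fix h assume "h \<in> fractions A U"
  then obtain q where q: "h \<in> carrier R" "q \<in> U" "h \<otimes> q \<in> A" unfolding fractions_def by blast
  have qA: "q \<in> A" "q \<in> carrier R" using q U Ac by auto
  have "\<ominus> h \<otimes> q \<in> A" using subringE(5)[OF A q(3)] q(1) qA by (simp add: l_minus)
  then show "\<ominus> h \<in> fractions A U" unfolding fractions_def using q by auto
  fix g assume "g \<in> fractions A U"
  then obtain r where r: "g \<in> carrier R" "r \<in> U" "g \<otimes> r \<in> A" unfolding fractions_def by blast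
  have rA: "r \<in> A" "r \<in> carrier R" using r U Ac by auto
  have "(h \<oplus> g) \<otimes> (q \<otimes> r) = (h \<otimes> q) \<otimes> r \<oplus> (g \<otimes> r) \<otimes> q" using qA rA q(1) r(1) by algebra
  then have "(h \<oplus> g) \<otimes> (q \<otimes> r) \<in> A" using subringE(6,7)[OF A] q r qA rA by simp
  then show "h \<oplus> g \<in> fractions A U" unfolding fractions_def using mult[OF q(2) r(2)] q r by blast
  have "(h \<otimes> g) \<otimes> (q \<otimes> r) = (h \<otimes> q) \<otimes> (g \<otimes> r)" using qA rA q(1) r(1) by algebra
  then have "(h \<otimes> g) \<otimes> (q \<otimes> r) \<in> A" using subringE(6)[OF A q(3) r(3)] by simp
  then show "h \<otimes> g \<in> fractions A U" unfolding fractions_def using mult[OF q(2) r(2)] q r by blast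
qed

section \<open>Polynomial values and transcendence\<close>

text \<open>
  The values at \<open>u\<close> of the polynomials over \<open>S\<close> of degree less than \<open>n\<close>. The filtration by degree
  makes leading coefficients accessible without passing through a polynomial ring: a polynomial
  relation of degree \<open>n\<close> for \<open>u\<close> is an equation \<open>a \<oplus> c \<otimes> u [^] n = \<zero>\<close> with \<open>a\<close> in the \<open>n\<close>-th layer.
\<close>

primrec (in ring) poly_values :: "'a set \<Rightarrow> 'a \<Rightarrow> nat \<Rightarrow> 'a set" where
  "poly_values S u 0 = {\<zero>}"
| "poly_values S u (Suc n) = {a \<oplus> r \<otimes> u [^] n | a r. a \<in> poly_values S u n \<and> r \<in> S}"

lemma (in ring) poly_values_SucI:
  "a \<in> poly_values S u n \<Longrightarrow> r \<in> S \<Longrightarrow> a \<oplus> r \<otimes> u [^] n \<in> poly_values S u (Suc n)"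
  by auto

lemma (in ring) poly_values_carrier:
  assumes "S \<subseteq> carrier R" "u \<in> carrier R"
  shows "poly_values S u n \<subseteq> carrier R"
  using assms by (induct n) (auto simp: subset_iff)

lemma (in ring) poly_values_list:
  assumes "a \<in> poly_values S u n" "u \<in> carrier R" "S \<subseteq> carrier R"
  shows "\<exists>ps. length ps = n \<and> set ps \<subseteq> S \<and> eval ps u = a"
  using assms(1)
proof (induct n arbitrary: a)
  case (Suc n)
  then obtain b r where b: "b \<in> poly_values S u n" "r \<in> S" "a = b \<oplus> r \<otimes> u [^] n" by auto
  obtain ps where ps: "length ps = n" "set ps \<subseteq> S" "eval ps u = b" using Suc(1)[OF b(1)] by auto
  have "b \<in> carrier R" using b(1) poly_values_carrier assms by blast
  then have "eval (r # ps) u = a" using ps b assms(2,3)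
    by (simp add: a_comm subset_iff)
  then show ?case using ps b by (intro exI[of _ "r # ps"]) auto
qed simp

lemma (in ring) eval_in_poly_values:
  assumes "set ps \<subseteq> S" "u \<in> carrier R" "S \<subseteq> carrier R"
  shows "eval ps u \<in> poly_values S u (length ps)"
  using assms(1)
proof (induct ps)
  case (Cons r ps)
  then have "eval ps u \<in> poly_values S u (length ps)" "r \<in> S" by auto
  moreover have "eval ps u \<in> carrier R"
    using Cons(2) assms by (intro eval_in_carrier) auto
  ultimately show ?case using assms poly_values_SucI[of "eval ps u" S u "length ps" r]
    by (simp add: a_comm subset_iff)
qed simp

locale poly_values_ring = cring +
  fixes S u assumes S: "subring S R" and u: "u \<in> carrier R"
begin

lemma S_carrier: "S \<subseteq> carrier R" using subringE(1)[OF S] .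

lemma poly_values_in_carrier: "a \<in> poly_values S u n \<Longrightarrow> a \<in> carrier R"
  using poly_values_carrier[OF S_carrier u] by blast

lemma poly_values_zero: "\<zero> \<in> poly_values S u n"
proof (induct n)
  case (Suc n)
  then show ?case using poly_values_SucI[OF Suc subringE(2)[OF S]] u by simp
qed simp

lemma poly_values_Suc_mono: "a \<in> poly_values S u n \<Longrightarrow> a \<in> poly_values S u (Suc n)"
  using poly_values_SucI[of a S u n \<zero>] subringE(2)[OF S] poly_values_in_carrier u by simp

lemma poly_values_mono: "a \<in> poly_values S u n \<Longrightarrow> n \<le> m \<Longrightarrow> a \<in> poly_values S u m"
  by (rule nat_induct_at_least[of n m]) (auto intro: poly_values_Suc_mono simp del: poly_values.simps)

lemma poly_values_monom: "r \<in> S \<Longrightarrow> n < m \<Longrightarrow> r \<otimes> u [^] n \<in> poly_values S u m"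
  using poly_values_mono[OF poly_values_SucI[OF poly_values_zero[of n]], of r m] S_carrier u
  by (auto simp: subset_iff simp del: poly_values.simps)

lemma poly_values_add: "a \<in> poly_values S u n \<Longrightarrow> b \<in> poly_values S u n \<Longrightarrow> a \<oplus> b \<in> poly_values S u n"
proof (induct n arbitrary: a b)
  case (Suc n)
  obtain a' r where a: "a' \<in> poly_values S u n" "r \<in> S" "a = a' \<oplus> r \<otimes> u [^] n" using Suc(2) by auto
  obtain b' s where b: "b' \<in> poly_values S u n" "s \<in> S" "b = b' \<oplus> s \<otimes> u [^] n" using Suc(3) by auto
  have c: "a' \<in> carrier R" "b' \<in> carrier R" "r \<in> carrier R" "s \<in> carrier R" "u [^] n \<in> carrier R"
    using a b poly_values_in_carrier S_carrier u by auto
  then have "a \<oplus> b = (a' \<oplus> b') \<oplus> (r \<oplus> s) \<otimes> u [^] n" unfolding a b by algebra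
  then show ?case using poly_values_SucI[OF Suc(1)[OF a(1) b(1)] subringE(7)[OF S a(2) b(2)]] by simp
qed simp

lemma poly_values_smult: "a \<in> poly_values S u n \<Longrightarrow> r \<in> S \<Longrightarrow> r \<otimes> a \<in> poly_values S u n"
proof (induct n arbitrary: a)
  case 0 then show ?case using S_carrier by auto
next
  case (Suc n)
  obtain b s where b: "b \<in> poly_values S u n" "s \<in> S" "a = b \<oplus> s \<otimes> u [^] n" using Suc(2) by auto
  have c: "b \<in> carrier R" "s \<in> carrier R" "r \<in> carrier R" "u [^] n \<in> carrier R"
    using b poly_values_in_carrier S_carrier u Suc by auto
  then have "r \<otimes> a = r \<otimes> b \<oplus> (r \<otimes> s) \<otimes> u [^] n" unfolding b by algebra
  then show ?case using poly_values_SucI[OF Suc(1)[OF b(1) Suc(3)] subringE(6)[OF S Suc(3) b(2)]] by simp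
qed

lemma poly_values_uminus: "a \<in> poly_values S u n \<Longrightarrow> \<ominus> a \<in> poly_values S u n"
  using poly_values_smult[of a n "\<ominus> \<one>"] subringE(3,5)[OF S] poly_values_in_carrier[of a n] by (simp add: l_minus)

lemma poly_values_shift: "a \<in> poly_values S u n \<Longrightarrow> a \<otimes> u \<in> poly_values S u (Suc n)"
proof (induct n arbitrary: a)
  case 0 then show ?case using poly_values_zero[of "Suc 0"] u by (auto simp del: poly_values.simps(2))
next
  case (Suc n)
  obtain b s where b: "b \<in> poly_values S u n" "s \<in> S" "a = b \<oplus> s \<otimes> u [^] n" using Suc(2) by auto
  have c: "b \<in> carrier R" "s \<in> carrier R" "u [^] n \<in> carrier R"
    using b poly_values_in_carrier S_carrier u by auto
  have "a \<otimes> u = b \<otimes> u \<oplus> s \<otimes> u [^] Suc n"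
    unfolding b using c u by (simp add: l_distr m_assoc)
  then show ?case using poly_values_SucI[OF Suc(1)[OF b(1)] b(2)] by simp
qed

lemma poly_values_shift_pow: "a \<in> poly_values S u n \<Longrightarrow> a \<otimes> u [^] k \<in> poly_values S u (n + k)"
proof (induct k)
  case 0 then show ?case using poly_values_in_carrier by simp
next
  case (Suc k)
  have "a \<otimes> u [^] Suc k = (a \<otimes> u [^] k) \<otimes> u" using poly_values_in_carrier[OF Suc(2)] u by (simp add: m_assoc)
  then show ?case using poly_values_shift[OF Suc(1)[OF Suc(2)]] by simp
qed

lemma simple_extension_eq_poly_values: "simple_extension S u = (\<Union>n. poly_values S u n)"
proof
  show "simple_extension S u \<subseteq> (\<Union>n. poly_values S u n)"
  proof
    fix a assume "a \<in> simple_extension S u"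
    then show "a \<in> (\<Union>n. poly_values S u n)"
    proof (induct rule: simple_extension.induct)
      case zero then show ?case by (auto intro: exI[of _ "0::nat"])
    next
      case (lin a r)
      then obtain n where n: "a \<in> poly_values S u n" by auto
      have "r \<otimes> u [^] (0::nat) \<in> poly_values S u (Suc n)" by (rule poly_values_monom) (use lin in auto)
      then have "r \<in> poly_values S u (Suc n)" using lin S_carrier by (auto simp del: poly_values.simps)
      then show ?case using poly_values_add[OF poly_values_shift[OF n]] by blast
    qed
  qed
  have "poly_values S u n \<subseteq> simple_extension S u" for n
  proof (induct n)
    case (Suc n)
    show ?case
    proof
      fix a assume "a \<in> poly_values S u (Suc n)"
      then obtain ps where "length ps = Suc n" "set ps \<subseteq> S" "eval ps u = a"
        using poly_values_list u S_carrier by blast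
      moreover have "eval ps u \<in> simple_extension S u" if "set ps \<subseteq> S" for ps
      proof -
        have "eval (normalize ps) u = eval ps u"
          using eval_normalize[OF _ u] that S_carrier by (metis subset_trans)
        moreover have "normalize ps \<in> carrier (univ_poly R S)"
          using normalize_gives_polynomial[OF that] unfolding univ_poly_def by auto
        ultimately show ?thesis unfolding simple_extension_as_eval_img[OF S_carrier u] by (metis imageI)
      qed
      ultimately show "a \<in> simple_extension S u" by blast
    qed
  qed auto
  then show "(\<Union>n. poly_values S u n) \<subseteq> simple_extension S u" by blast
qed

end

lemma (in domain) transcendental_no_relation:
  assumes K: "subring K R" and u: "u \<in> carrier R" and tr: "transcendental K u"
    and a: "a \<in> poly_values K u n" and c: "c \<in> K" and rel: "a \<oplus> c \<otimes> u [^] n = \<zero>"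
  shows "c = \<zero>"
proof (rule ccontr)
  assume c0: "c \<noteq> \<zero>"
  have KR: "K \<subseteq> carrier R" using subringE(1)[OF K] .
  obtain ps where ps: "length ps = n" "set ps \<subseteq> K" "eval ps u = a"
    using poly_values_list[OF a u KR] by blast
  have "c # ps \<in> carrier (univ_poly R K)"
    using c0 c ps unfolding univ_poly_def polynomial_def by auto
  moreover have "a \<in> carrier R" using a poly_values_carrier[OF KR u] by blast
  then have "eval (c # ps) u = \<zero>" using ps rel KR c u by (simp add: a_comm subset_iff)
  ultimately show False using eval_transcendental[of K u "c # ps"] tr unfolding over_def by auto
qed

lemma (in field) algebraic_monic_relation:
  assumes K: "subfield K R" and u: "u \<in> carrier R" and alg: "\<not> transcendental K u"
  shows "\<exists>n. \<exists>a \<in> poly_values K u n. a \<oplus> u [^] n = \<zero>"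
proof -
  have KR: "K \<subseteq> carrier R" and sub: "subring K R" using subfieldE[OF K] by auto
  interpret poly_values_ring R K u
    by (rule poly_values_ring.intro[OF is_cring poly_values_ring_axioms.intro[OF sub u]])
  obtain p where p: "p \<in> carrier (univ_poly R K)" "p \<noteq> []" "eval p u = \<zero>"
    using algebraicE[OF sub u] alg unfolding over_def by blast
  then obtain c ps where cp: "p = c # ps" by (cases p) auto
  then have c: "c \<in> K" "c \<noteq> \<zero>" "set ps \<subseteq> K"
    using p unfolding univ_poly_def polynomial_def by auto
  have a: "eval ps u \<in> poly_values K u (length ps)" using eval_in_poly_values[OF c(3) u KR] .
  have ic: "inv c \<in> K" "inv c \<otimes> c = \<one>" using subfield_m_inv[OF K, of c] c by auto
  have cc: "eval ps u \<in> carrier R" "c \<in> carrier R" "inv c \<in> carrier R" "u [^] length ps \<in> carrier R"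
    using poly_values_in_carrier[OF a] c ic KR u by auto
  have "c \<otimes> u [^] length ps \<oplus> eval ps u = \<zero>" using p cp by simp
  then have "inv c \<otimes> (c \<otimes> u [^] length ps \<oplus> eval ps u) = \<zero>" using cc by simp
  moreover have "inv c \<otimes> (c \<otimes> u [^] length ps \<oplus> eval ps u)
      = inv c \<otimes> eval ps u \<oplus> (inv c \<otimes> c) \<otimes> u [^] length ps"
    using cc by algebra
  ultimately have "inv c \<otimes> eval ps u \<oplus> u [^] length ps = \<zero>" using ic cc by simp
  then show ?thesis using poly_values_smult[OF a ic(1)] by blast
qed

text \<open>
  Transitivity of algebraicity: adjoining to \<open>K\<close> the finitely many coefficients of a polynomial
  relation over \<open>K'\<close> gives a finite extension of \<open>K\<close>, and a further finite extension contains \<open>u\<close>.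
\<close>

lemma (in domain) algebraic_trans:
  assumes K: "subfield K R" and u: "u \<in> carrier R"
    and K': "K' = {a \<in> carrier R. \<not> transcendental K a}" "subring K' R"
    and alg: "\<not> transcendental K' u"
  shows "\<not> transcendental K u"
proof -
  obtain p where p: "p \<in> carrier (univ_poly R K')" "p \<noteq> []" "eval p u = \<zero>"
    using algebraicE[OF K'(2) u] alg unfolding over_def by blast
  have pc: "set p \<subseteq> carrier R" and pa: "\<And>a. a \<in> set p \<Longrightarrow> (algebraic over K) a"
    using p K' unfolding univ_poly_def polynomial_def over_def by auto
  define E where "E = finite_extension K p"
  have E: "subfield E R" unfolding E_def
    using finite_extension_is_subfield[OF K pc] pa by auto
  have dE: "finite_dimension K E" unfolding E_def
    using finite_extension_finite_dimension(1)[OF K pc] pa by auto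
  have "set p \<subseteq> E" unfolding E_def using finite_extension_mem[OF subfieldE(1)[OF K] pc] .
  then have "p \<in> carrier (univ_poly R E)"
    using p unfolding univ_poly_def polynomial_def by auto
  then have aE: "(algebraic over E) u" using algebraicI p by blast
  have "finite_dimension E (simple_extension E u)"
    using finite_dimension_simple_extension[OF E u] aE by blast
  then have "finite_dimension K (simple_extension E u)"
    using telescopic_base_dim(1)[OF K E dE] by blast
  then have "(algebraic over K) u"
    using finite_dimension_imp_algebraic[OF K simple_extension_is_subring[OF subfieldE(1)[OF E] u]]
      simple_extension_mem[OF subfieldE(1)[OF E] u] by blast
  then show ?thesis unfolding over_def .
qed

section \<open>Valued fields with a residue map\<close>

text \<open>
  A discretely valued field together with its valuation ring and residue map, with the value of zero
  left unspecified. The strong triangle inequality is a consequence of the closure of \<open>V\<close> under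
  addition.
\<close>

locale residue_valuation = field L + F: field F
  for L :: "('a, 'b) ring_scheme" (structure) and F :: "('c, 'd) ring_scheme" +
  fixes V :: "'a set" and \<rho> :: "'a \<Rightarrow> 'c" and v :: "'a \<Rightarrow> int"
  assumes V: "subring V L"
    and v_mult: "\<And>a b. a \<in> carrier L \<Longrightarrow> a \<noteq> \<zero> \<Longrightarrow> b \<in> carrier L \<Longrightarrow> b \<noteq> \<zero> \<Longrightarrow> v (a \<otimes> b) = v a + v b"
    and V_iff: "\<And>a. a \<in> carrier L \<Longrightarrow> a \<noteq> \<zero> \<Longrightarrow> a \<in> V \<longleftrightarrow> 0 \<le> v a"
    and \<rho>: "\<rho> \<in> ring_hom (L\<lparr>carrier := V\<rparr>) F"
    and \<rho>_surj: "\<rho> ` V = carrier F"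
    and \<rho>_zero_iff: "\<And>a. a \<in> V \<Longrightarrow> \<rho> a = \<zero>\<^bsub>F\<^esub> \<longleftrightarrow> a = \<zero> \<or> 0 < v a"
begin

text \<open>
  Membership in the \<open>n\<close>-th valuation ideal. The predicate absorbs the case of the zero element, whose
  value carries no information.
\<close>

definition ge :: "int \<Rightarrow> 'a \<Rightarrow> bool" where
  "ge n a \<longleftrightarrow> a \<in> carrier L \<and> (a = \<zero> \<or> n \<le> v a)"

lemma V_carrier: "a \<in> V \<Longrightarrow> a \<in> carrier L" using subringE(1)[OF V] by blast
lemma V_one [simp]: "\<one> \<in> V" and V_zero [simp]: "\<zero> \<in> V"
  and V_add: "a \<in> V \<Longrightarrow> b \<in> V \<Longrightarrow> a \<oplus> b \<in> V"
  and V_mult: "a \<in> V \<Longrightarrow> b \<in> V \<Longrightarrow> a \<otimes> b \<in> V"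
  and V_uminus: "a \<in> V \<Longrightarrow> \<ominus> a \<in> V"
  using subringE[OF V] by auto

lemma V_pow: "a \<in> V \<Longrightarrow> a [^] (n::nat) \<in> V"
  by (induct n) (auto intro: V_mult)

lemma ge0_iff: "ge 0 a \<longleftrightarrow> a \<in> V"
  unfolding ge_def using V_iff V_carrier V_zero by blast

lemma ge_carrier: "ge n a \<Longrightarrow> a \<in> carrier L" unfolding ge_def by simp
lemma ge_zero [simp]: "ge n \<zero>" unfolding ge_def by simp
lemma ge_mono: "ge n a \<Longrightarrow> m \<le> n \<Longrightarrow> ge m a" unfolding ge_def by auto
lemma ge1_V: "ge 1 a \<Longrightarrow> a \<in> V" using ge_mono[of 1 a 0] ge0_iff by simp

lemma v_one [simp]: "v \<one> = 0"
  using v_mult[of \<one> \<one>] by simp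

lemma v_inv: "a \<in> carrier L \<Longrightarrow> a \<noteq> \<zero> \<Longrightarrow> v (inv a) = - v a"
  using v_mult[of a "inv a"] by simp

lemma v_pow: "a \<in> carrier L \<Longrightarrow> a \<noteq> \<zero> \<Longrightarrow> v (a [^] (n::nat)) = int n * v a"
  by (induct n) (simp_all add: v_mult algebra_simps)

lemma ge_mult: "ge n a \<Longrightarrow> ge m b \<Longrightarrow> ge (n + m) (a \<otimes> b)"
  unfolding ge_def using v_mult[of a b] by (cases "a = \<zero> \<or> b = \<zero>") auto

lemma ge_mult_V: "ge n a \<Longrightarrow> b \<in> V \<Longrightarrow> ge n (b \<otimes> a)"
  using ge_mult[of 0 b n a] ge0_iff by simp

lemma ge_self: "a \<in> carrier L \<Longrightarrow> ge (v a) a" unfolding ge_def by simp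

lemma ge_iff_quotient:
  assumes "a \<in> carrier L" "b \<in> carrier L" "b \<noteq> \<zero>"
  shows "ge (v b) a \<longleftrightarrow> a \<otimes> inv b \<in> V"
proof
  assume "ge (v b) a"
  then have "ge (v b + v (inv b)) (a \<otimes> inv b)" using ge_mult ge_self assms by simp
  then show "a \<otimes> inv b \<in> V" using assms v_inv ge0_iff by simp
next
  assume "a \<otimes> inv b \<in> V"
  then have "ge (0 + v b) (a \<otimes> inv b \<otimes> b)" using ge_mult[of 0 _ "v b" b] ge0_iff ge_self assms by simp
  then show "ge (v b) a" using mult_inv_cancel assms by simp
qed

lemma ge_add:
  assumes "ge n a" "ge n b" shows "ge n (a \<oplus> b)"
proof -
  have *: "ge n (a \<oplus> b)" if "ge n a" "b \<in> carrier L" "a \<noteq> \<zero>" "ge (v a) b" for a b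
  proof -
    have a: "a \<in> carrier L" using that ge_carrier by blast
    have "b \<otimes> inv a \<in> V" using ge_iff_quotient that a by blast
    then have "\<one> \<oplus> b \<otimes> inv a \<in> V" by (simp add: V_add)
    then have "ge n ((\<one> \<oplus> b \<otimes> inv a) \<otimes> a)" using ge_mult[of 0 _ n a] that ge0_iff by simp
    moreover have "(\<one> \<oplus> b \<otimes> inv a) \<otimes> a = a \<oplus> b"
      using a that by (simp add: l_distr mult_inv_cancel)
    ultimately show ?thesis by simp
  qed
  show ?thesis
  proof (cases "a = \<zero> \<or> b = \<zero>")
    case True then show ?thesis using assms ge_carrier by auto
  next
    case False
    then show ?thesis using *[of a b] *[of b a] assms a_comm[of a b] unfolding ge_def
      by (metis linear)
  qed
qed

lemma ge_uminus: "ge n a \<Longrightarrow> ge n (\<ominus> a)"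
  using ge_mult_V[of n a "\<ominus> \<one>"] V_uminus[OF V_one] ge_carrier[of n a] by (simp add: l_minus)

lemma res_closed: "a \<in> V \<Longrightarrow> \<rho> a \<in> carrier F" using \<rho>_surj by blast
lemma res_add: "a \<in> V \<Longrightarrow> b \<in> V \<Longrightarrow> \<rho> (a \<oplus> b) = \<rho> a \<oplus>\<^bsub>F\<^esub> \<rho> b"
  and res_mult: "a \<in> V \<Longrightarrow> b \<in> V \<Longrightarrow> \<rho> (a \<otimes> b) = \<rho> a \<otimes>\<^bsub>F\<^esub> \<rho> b"
  and res_one [simp]: "\<rho> \<one> = \<one>\<^bsub>F\<^esub>"
  using ring_hom_memE(2-4)[OF \<rho>] by auto
lemma res_zero [simp]: "\<rho> \<zero> = \<zero>\<^bsub>F\<^esub>" using \<rho>_zero_iff[OF V_zero] by simp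
lemma res_uminus: "a \<in> V \<Longrightarrow> \<rho> (\<ominus> a) = \<ominus>\<^bsub>F\<^esub> \<rho> a"
  using res_add[of "\<ominus> a" a] V_uminus[of a] V_carrier[of a] res_closed
  by (metis F.minus_equality l_neg res_zero)
lemma res_pow: "a \<in> V \<Longrightarrow> \<rho> (a [^] (n::nat)) = \<rho> a [^]\<^bsub>F\<^esub> n"
  by (induct n) (auto simp: res_mult V_pow)

lemma res_eq_zero: "a \<in> V \<Longrightarrow> \<rho> a = \<zero>\<^bsub>F\<^esub> \<longleftrightarrow> ge 1 a"
  using \<rho>_zero_iff V_carrier unfolding ge_def by auto

lemma res_nonzero: "a \<in> V \<Longrightarrow> \<rho> a \<noteq> \<zero>\<^bsub>F\<^esub> \<longleftrightarrow> a \<noteq> \<zero> \<and> v a = 0"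
  using \<rho>_zero_iff V_iff V_carrier by (metis less_le linorder_not_less)

lemma res_inv: "a \<in> V \<Longrightarrow> a \<noteq> \<zero> \<Longrightarrow> v a = 0 \<Longrightarrow> inv a \<in> V \<and> \<rho> (inv a) = inv\<^bsub>F\<^esub> (\<rho> a)"
proof -
  assume a: "a \<in> V" "a \<noteq> \<zero>" "v a = 0"
  then have i: "inv a \<in> V" using V_iff[of "inv a"] v_inv V_carrier by simp
  have "\<rho> a \<otimes>\<^bsub>F\<^esub> \<rho> (inv a) = \<one>\<^bsub>F\<^esub>" using res_mult[OF a(1) i] a V_carrier by simp
  then show ?thesis using i F.inv_unique' res_closed a by blast
qed

lemma res_finsum: "finite B \<Longrightarrow> (\<And>b. b \<in> B \<Longrightarrow> g b \<in> V) \<Longrightarrow>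
    \<rho> (finsum L g B) = finsum F (\<lambda>b. \<rho> (g b)) B \<and> finsum L g B \<in> V"
proof (induct B rule: finite_induct)
  case (insert b B)
  have "finsum L g (insert b B) = g b \<oplus> finsum L g B"
    using insert V_carrier by (intro finsum_insert) auto
  moreover have "finsum F (\<lambda>b. \<rho> (g b)) (insert b B) = \<rho> (g b) \<oplus>\<^bsub>F\<^esub> finsum F (\<lambda>b. \<rho> (g b)) B"
    using insert res_closed by (intro F.finsum_insert) auto
  ultimately show ?case using insert by (simp add: res_add V_add)
qed simp

lemma res_poly_values_lift:
  assumes "R \<subseteq> V" "u \<in> V" "a' \<in> F.poly_values (\<rho> ` R) (\<rho> u) n"
  shows "\<exists>a \<in> poly_values R u n. a \<in> V \<and> \<rho> a = a'"
  using assms(3)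
proof (induct n arbitrary: a')
  case (Suc n)
  then obtain b' r where b': "b' \<in> F.poly_values (\<rho> ` R) (\<rho> u) n" "r \<in> R"
     "a' = b' \<oplus>\<^bsub>F\<^esub> \<rho> r \<otimes>\<^bsub>F\<^esub> \<rho> u [^]\<^bsub>F\<^esub> n" by auto
  obtain b where b: "b \<in> poly_values R u n" "b \<in> V" "\<rho> b = b'" using Suc(1)[OF b'(1)] by auto
  have r: "r \<in> V" using b' assms by auto
  have "\<rho> (b \<oplus> r \<otimes> u [^] n) = a'"
    using b b' r assms by (simp add: res_add res_mult res_pow V_pow V_mult)
  moreover have "b \<oplus> r \<otimes> u [^] n \<in> V" using b r assms by (simp add: V_pow V_mult V_add)
  ultimately show ?case using poly_values_SucI[OF b(1) b'(2)] by blast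
qed auto

lemma res_simple_extension:
  assumes "a \<in> simple_extension R u" "R \<subseteq> V" "u \<in> V" "subring k F" "\<rho> ` R \<subseteq> k" "\<rho> u \<in> k"
  shows "a \<in> V \<and> \<rho> a \<in> k"
  using assms(1)
proof (induct rule: simple_extension.induct)
  case zero then show ?case using subringE(2)[OF assms(4)] by simp
next
  case (lin a r)
  then have "r \<in> V" using assms by auto
  then show ?case using lin assms subringE(6,7)[OF assms(4)]
    by (auto simp: res_add res_mult V_mult V_add subset_iff)
qed

section \<open>Quadratic transforms\<close>

text \<open>
  The centre of \<open>V\<close> on \<open>R\<close> is generated by \<open>x\<close> and \<open>y\<close>, and every other element of \<open>R\<close> is a unit.
  Every ring in a sequence of quadratic transforms has this property, for suitable generators, one of
  which may be zero.
\<close>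

definition local_at :: "'a set \<Rightarrow> 'a \<Rightarrow> 'a \<Rightarrow> bool" where
  "local_at R x y \<longleftrightarrow> subring R L \<and> R \<subseteq> V \<and> x \<in> R \<and> y \<in> R \<and> ge 1 x \<and> ge 1 y \<and>
     (\<forall>r\<in>R. ge 1 r \<longrightarrow> (\<exists>p\<in>R. \<exists>q\<in>R. r = p \<otimes> x \<oplus> q \<otimes> y)) \<and>
     (\<forall>r\<in>R. \<not> ge 1 r \<longrightarrow> inv r \<in> R)"

lemma not_ge1: "r \<in> V \<Longrightarrow> \<not> ge 1 r \<longleftrightarrow> r \<noteq> \<zero> \<and> v r = 0"
  using res_eq_zero res_nonzero by blast

lemma local_at_swap: "local_at R x y \<Longrightarrow> local_at R y x"
  unfolding local_at_def
proof (intro conjI ballI impI; (elim conjE)?)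
  fix r assume a: "subring R L" "x \<in> R" "y \<in> R" "r \<in> R" "ge 1 r"
    and *: "\<forall>r\<in>R. ge 1 r \<longrightarrow> (\<exists>p\<in>R. \<exists>q\<in>R. r = p \<otimes> x \<oplus> q \<otimes> y)"
  obtain p q where pq: "p \<in> R" "q \<in> R" "r = p \<otimes> x \<oplus> q \<otimes> y" using a * by blast
  have "r = q \<otimes> y \<oplus> p \<otimes> x" unfolding pq(3)
    using a pq subringE(1)[OF a(1)] by (intro a_comm) auto
  then show "\<exists>p\<in>R. \<exists>q\<in>R. r = p \<otimes> y \<oplus> q \<otimes> x" using pq by blast
qed auto

text \<open>
  The localization of \<open>A\<close> at the centre of \<open>V\<close>.
\<close>

definition localization :: "'a set \<Rightarrow> 'a set" where
  "localization A = fractions A {b \<in> A. b \<noteq> \<zero> \<and> v b = 0}"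

lemma localization_iff:
  "r \<in> localization A \<longleftrightarrow> r \<in> carrier L \<and> (\<exists>b\<in>A. b \<noteq> \<zero> \<and> v b = 0 \<and> r \<otimes> b \<in> A)"
  unfolding localization_def fractions_def by blast

lemma localization_incl: "subring A L \<Longrightarrow> A \<subseteq> localization A"
  unfolding localization_def using subringE(1,3)[of A L] by (intro fractions_incl) auto

lemma localization_subset_V:
  assumes "A \<subseteq> V" shows "localization A \<subseteq> V"
proof
  fix r assume "r \<in> localization A"
  then obtain b where b: "r \<in> carrier L" "b \<in> A" "b \<noteq> \<zero>" "v b = 0" "r \<otimes> b \<in> A"
    unfolding localization_iff by blast
  then have "v (r \<otimes> b) = v r" if "r \<noteq> \<zero>" using v_mult[of r b] that V_carrier assms by auto
  moreover have "r \<otimes> b \<noteq> \<zero>" if "r \<noteq> \<zero>" using b that V_carrier assms by (simp add: integral_iff subset_iff)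
  ultimately show "r \<in> V" using V_iff[of r] V_iff[of "r \<otimes> b"] b assms V_carrier
    by (metis V_zero subset_iff)
qed

lemma localization_subring:
  assumes A: "subring A L" shows "subring (localization A) L"
  unfolding localization_def
proof (rule fractions_subring[OF A])
  show "\<one> \<in> {b \<in> A. b \<noteq> \<zero> \<and> v b = 0}" using subringE(3)[OF A] by simp
  fix b d assume bd: "b \<in> {b \<in> A. b \<noteq> \<zero> \<and> v b = 0}" "d \<in> {b \<in> A. b \<noteq> \<zero> \<and> v b = 0}"
  then have "b \<in> carrier L" "d \<in> carrier L" using subringE(1)[OF A] by auto
  then show "b \<otimes> d \<in> {b \<in> A. b \<noteq> \<zero> \<and> v b = 0}"
    using bd subringE(6)[OF A] v_mult[of b d] by (simp add: integral_iff)
qed blast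

lemma localization_res:
  assumes "A \<subseteq> V" "subfield k F" "\<And>a. a \<in> A \<Longrightarrow> \<rho> a \<in> k" "r \<in> localization A"
  shows "\<rho> r \<in> k"
proof -
  obtain b where b: "r \<in> carrier L" "b \<in> A" "b \<noteq> \<zero>" "v b = 0" "r \<otimes> b \<in> A"
    using assms(4) unfolding localization_iff by blast
  have V: "r \<in> V" "b \<in> V" using assms localization_subset_V b by blast+
  have "\<rho> b \<noteq> \<zero>\<^bsub>F\<^esub>" using res_nonzero V b by blast
  then have "\<rho> b \<in> k - {\<zero>\<^bsub>F\<^esub>}" using assms b by blast
  moreover have "\<rho> b \<otimes>\<^bsub>F\<^esub> \<rho> r \<in> k" using assms(3)[OF b(5)] V res_mult res_closed F.m_comm by metis
  ultimately show ?thesis using F.subfield_m_inv_simprule[OF assms(2)] res_closed V by blast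
qed

lemma localization_local_at:
  assumes A: "subring A L" "A \<subseteq> V" and x: "x \<in> A" "y \<in> A" "ge 1 x" "ge 1 y"
    and gen: "\<And>r. r \<in> A \<Longrightarrow> ge 1 r \<Longrightarrow> \<exists>p\<in>A. \<exists>q\<in>A. r = p \<otimes> x \<oplus> q \<otimes> y"
  shows "local_at (localization A) x y"
  unfolding local_at_def
proof (intro conjI ballI impI)
  have c: "A \<subseteq> carrier L" using subringE(1)[OF A(1)] .
  show "subring (localization A) L" "localization A \<subseteq> V" "x \<in> localization A" "y \<in> localization A"
    using localization_subring[OF A(1)] localization_subset_V[OF A(2)] localization_incl[OF A(1)] x by blast+
  show "ge 1 x" "ge 1 y" by fact+
  fix r assume r: "r \<in> localization A"
  then obtain b where b: "r \<in> carrier L" "b \<in> A" "b \<noteq> \<zero>" "v b = 0" "r \<otimes> b \<in> A"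
    unfolding localization_iff by blast
  have bc: "b \<in> carrier L" using b c by auto
  have ib: "inv b \<in> localization A"
    unfolding localization_iff using bc b subringE(3)[OF A(1)] by auto
  {
    assume "ge 1 r"
    then have "ge 1 (r \<otimes> b)" using ge_mult_V[of 1 r b] A b bc m_comm by auto
    then obtain p q where pq: "p \<in> A" "q \<in> A" "r \<otimes> b = p \<otimes> x \<oplus> q \<otimes> y" using gen b by blast
    have cc: "p \<in> carrier L" "q \<in> carrier L" "x \<in> carrier L" "y \<in> carrier L" "inv b \<in> carrier L"
      using pq x c bc b by auto
    have "r = r \<otimes> b \<otimes> inv b" using b bc by (simp add: m_assoc)
    also have "\<dots> = (p \<otimes> inv b) \<otimes> x \<oplus> (q \<otimes> inv b) \<otimes> y" unfolding pq(3) using cc by algebra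
    finally show "\<exists>p\<in>localization A. \<exists>q\<in>localization A. r = p \<otimes> x \<oplus> q \<otimes> y"
      using subringE(6)[OF localization_subring[OF A(1)] _ ib] localization_incl[OF A(1)] pq by blast
  next
    assume "\<not> ge 1 r"
    then have r0: "r \<noteq> \<zero>" "v r = 0" using not_ge1 r localization_subset_V A by blast+
    have "v (r \<otimes> b) = 0" "r \<otimes> b \<noteq> \<zero>" using v_mult r0 b bc by (auto simp: integral_iff)
    moreover have "inv r \<otimes> (r \<otimes> b) = b" using r0 b bc by (simp flip: m_assoc)
    ultimately show "inv r \<in> localization A" unfolding localization_iff using b r0 by auto
  }
qed

text \<open>
  Over \<open>R[u]\<close> the maximal ideal of \<open>R\<close> is generated by \<open>x\<close>, because \<open>y = u x\<close>. Modulo \<open>x\<close>, the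
  ring \<open>R[u]\<close> is therefore generated by \<open>u\<close> over the residue field of \<open>R\<close>, and its centre is
  generated by a lift \<open>h\<close> of the minimal polynomial of the residue of \<open>u\<close>. Here \<open>h\<close> is described as
  a monic expression of least degree \<open>n\<close> in the centre: division by \<open>h\<close> leaves a remainder of degree
  less than \<open>n\<close>, and minimality forces the coefficients of that remainder into the maximal ideal
  of \<open>R\<close>.
\<close>

lemma quadratic_transform_aux:
  assumes R: "local_at R x y" and x0: "x \<noteq> \<zero>" and u: "u \<in> V" "u \<otimes> x = y"
    and a: "a \<in> poly_values R u n" and h: "h = a \<oplus> u [^] n" "ge 1 h"
    and min: "\<And>m b. m < n \<Longrightarrow> b \<in> poly_values R u m \<Longrightarrow> \<not> ge 1 (b \<oplus> u [^] m)"
  shows "local_at (localization (simple_extension R u)) x h"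
proof -
  have R': "subring R L" "R \<subseteq> V" "x \<in> R" "y \<in> R" "ge 1 x" "ge 1 y"
    "\<And>r. r \<in> R \<Longrightarrow> ge 1 r \<Longrightarrow> \<exists>p\<in>R. \<exists>q\<in>R. r = p \<otimes> x \<oplus> q \<otimes> y"
    "\<And>r. r \<in> R \<Longrightarrow> \<not> ge 1 r \<Longrightarrow> inv r \<in> R"
    using R unfolding local_at_def by auto
  have uc: "u \<in> carrier L" using u V_carrier by simp
  interpret P: poly_values_ring L R u
    by (rule poly_values_ring.intro[OF is_cring poly_values_ring_axioms.intro[OF R'(1) uc]])
  define A where "A = simple_extension R u"
  have A: "subring A L" unfolding A_def using simple_extension_is_subring[OF R'(1) uc] .
  have AV: "A \<subseteq> V" unfolding A_def using simple_extension_subring_incl[OF V R'(2) u(1)] .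
  have Ac: "A \<subseteq> carrier L" using subringE(1)[OF A] .
  have RA: "R \<subseteq> A" unfolding A_def using simple_extension_incl[OF P.S_carrier uc] .
  have uA: "u \<in> A" unfolding A_def using simple_extension_mem[OF R'(1) uc] .
  have PA: "b \<in> A" if "b \<in> poly_values R u j" for b j
    unfolding A_def P.simple_extension_eq_poly_values using that by blast
  have powA: "u [^] (j::nat) \<in> A" for j
    by (induct j) (auto intro: subringE(3,6)[OF A] uA)
  have xc: "x \<in> carrier L" using R'(5) ge_carrier by blast
  have hA: "h \<in> A" unfolding h using subringE(7)[OF A PA[OF a] powA] .
  have hc: "h \<in> carrier L" using hA Ac by blast
  have ac: "a \<in> carrier L" using P.poly_values_in_carrier[OF a] .
  \<comment> \<open>the maximal ideal of \<open>R\<close> becomes divisible by \<open>x\<close>\<close>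
  have mx: "\<exists>q\<in>A. r = q \<otimes> x" if r: "r \<in> R" "ge 1 r" for r
  proof -
    obtain p q where pq: "p \<in> R" "q \<in> R" "r = p \<otimes> x \<oplus> q \<otimes> y"
      using R'(7)[OF r] by (elim bexE)
    have c: "p \<in> carrier L" "q \<in> carrier L" using pq P.S_carrier by auto
    have "r = (p \<oplus> q \<otimes> u) \<otimes> x" unfolding pq(3) u(2)[symmetric] using c xc uc by algebra
    moreover have "p \<oplus> q \<otimes> u \<in> A" using pq RA uA subringE(6,7)[OF A] by blast
    ultimately show ?thesis by blast
  qed
  \<comment> \<open>division by the monic \<open>h\<close>\<close>
  have red: "\<exists>q\<in>A. \<exists>r\<in>poly_values R u n. b = q \<otimes> h \<oplus> r" if "b \<in> poly_values R u j" for b j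
    using that
  proof (induct j arbitrary: b)
    case 0
    then have "b = \<zero> \<otimes> h \<oplus> \<zero>" using hc by simp
    then show ?case using subringE(2)[OF A] P.poly_values_zero by blast
  next
    case (Suc j)
    show ?case
    proof (cases "j < n")
      case True
      then have "b \<in> poly_values R u n" using Suc(2) P.poly_values_mono[of b "Suc j" n] by simp
      moreover have "b = \<zero> \<otimes> h \<oplus> b" using hc P.poly_values_in_carrier[OF Suc(2)] by simp
      ultimately show ?thesis using subringE(2)[OF A] by blast
    next
      case False
      obtain d s where d: "d \<in> poly_values R u j" "s \<in> R" "b = d \<oplus> s \<otimes> u [^] j" using Suc(2) by auto
      have dc: "d \<in> carrier L" "s \<in> carrier L" using P.poly_values_in_carrier[OF d(1)] d P.S_carrier by auto
      \<comment> \<open>what remains of the leading term after substituting \<open>u [^] n = h \<ominus> a\<close>\<close>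
      define e where "e = \<ominus> (s \<otimes> (a \<otimes> u [^] (j - n)))"
      have e: "e \<in> poly_values R u j" unfolding e_def
        using P.poly_values_uminus[OF P.poly_values_smult[OF P.poly_values_shift_pow[OF a] d(2)], of "j - n"] False by simp
      obtain q r where qr: "q \<in> A" "r \<in> poly_values R u n" "d \<oplus> e = q \<otimes> h \<oplus> r"
        using Suc(1)[OF P.poly_values_add[OF d(1) e]] by blast
      have pj: "u [^] j = u [^] n \<otimes> u [^] (j - n)" using False nat_pow_mult[OF uc, of n "j - n"] by simp
      have cc: "q \<in> carrier L" "r \<in> carrier L" "u [^] n \<in> carrier L" "u [^] (j - n) \<in> carrier L"
        using qr Ac P.poly_values_in_carrier uc by auto
      have ec: "e \<in> carrier L" using P.poly_values_in_carrier[OF e] .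
      have "b = (d \<oplus> e) \<oplus> (s \<otimes> u [^] (j - n)) \<otimes> h"
        unfolding d(3) h(1) pj e_def using dc cc ac by algebra
      also have "\<dots> = (q \<oplus> s \<otimes> u [^] (j - n)) \<otimes> h \<oplus> r"
        unfolding qr(3) using cc dc hc by algebra
      finally show ?thesis using qr d RA powA subringE(6,7)[OF A] by blast
    qed
  qed
  \<comment> \<open>by minimality of \<open>n\<close>, a remainder in the centre has all its coefficients in the centre\<close>
  have small: "\<exists>q\<in>A. r = q \<otimes> x" if "j \<le> n" "r \<in> poly_values R u j" "ge 1 r" for r j
    using that
  proof (induct j arbitrary: r)
    case 0
    then have "r = \<zero> \<otimes> x" using xc by simp
    then show ?case using subringE(2)[OF A] by blast
  next
    case (Suc j)
    obtain d s where d: "d \<in> poly_values R u j" "s \<in> R" "r = d \<oplus> s \<otimes> u [^] j" using Suc(3) by auto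
    have dc: "d \<in> carrier L" "s \<in> carrier L" "u [^] j \<in> carrier L"
      using P.poly_values_in_carrier[OF d(1)] d P.S_carrier uc by auto
    have s1: "ge 1 s"
    proof (rule ccontr)
      assume n: "\<not> ge 1 s"
      then have s0: "s \<noteq> \<zero>" "inv s \<in> R" using R'(8) d by auto
      have "inv s \<otimes> r = inv s \<otimes> d \<oplus> (inv s \<otimes> s) \<otimes> u [^] j"
        unfolding d(3) using dc s0 inv_closed'[OF dc(2)] by algebra
      then have "inv s \<otimes> r = inv s \<otimes> d \<oplus> u [^] j" using dc s0 by simp
      moreover have "ge 1 (inv s \<otimes> r)" using ge_mult_V[OF Suc(4), of "inv s"] s0 R'(2) by blast
      ultimately show False using min[of j "inv s \<otimes> d"] P.poly_values_smult[OF d(1) s0(2)] Suc(2) by simp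
    qed
    then obtain q where q: "q \<in> A" "s = q \<otimes> x" using mx d by blast
    have "ge 1 (s \<otimes> u [^] j)" using ge_mult_V[OF s1, of "u [^] j"] V_pow[OF u(1)] dc m_comm by simp
    moreover have "d = r \<oplus> \<ominus> (s \<otimes> u [^] j)" unfolding d(3) using dc by algebra
    ultimately have "ge 1 d" using ge_add[OF Suc(4) ge_uminus] by simp
    then obtain q' where q': "q' \<in> A" "d = q' \<otimes> x" using Suc(1)[OF _ d(1)] Suc(2) by auto
    have "r = (q' \<oplus> q \<otimes> u [^] j) \<otimes> x"
      unfolding d(3) q(2) q'(2) using subsetD[OF Ac q(1)] subsetD[OF Ac q'(1)] xc dc(3) by algebra
    then show ?case using q q' powA subringE(6,7)[OF A] by blast
  qed
  show ?thesis unfolding A_def[symmetric]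
  proof (rule localization_local_at[OF A AV _ hA R'(5) h(2)])
    show "x \<in> A" using R' RA by blast
    fix r assume r: "r \<in> A" "ge 1 r"
    then obtain j where "r \<in> poly_values R u j" unfolding A_def P.simple_extension_eq_poly_values by blast
    then obtain q s where qs: "q \<in> A" "s \<in> poly_values R u n" "r = q \<otimes> h \<oplus> s" using red by blast
    have c: "q \<in> carrier L" "s \<in> carrier L" using qs Ac P.poly_values_in_carrier by auto
    have "s = r \<oplus> \<ominus> (q \<otimes> h)" unfolding qs(3) using c hc by algebra
    moreover have "ge 1 (q \<otimes> h)" using ge_mult_V[OF h(2)] qs AV by blast
    ultimately have "ge 1 s" using ge_add[OF r(2) ge_uminus] by simp
    then obtain q' where q': "q' \<in> A" "s = q' \<otimes> x" using small[OF order_refl qs(2)] by blast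
    have "r = q' \<otimes> x \<oplus> q \<otimes> h" unfolding qs(3) q' using c hc q' Ac xc by (simp add: a_comm subset_iff)
    then show "\<exists>p\<in>A. \<exists>q\<in>A. r = p \<otimes> x \<oplus> q \<otimes> h" using qs q' by blast
  qed
qed

text \<open>
  If the residue of \<open>u\<close> is zero, the monic expression of least degree in the centre is \<open>u\<close> itself.
\<close>

lemma quadratic_transform:
  assumes R: "local_at R x y" and x0: "x \<noteq> \<zero>" and u: "u \<in> V" "u \<otimes> x = y"
    and alg: "\<exists>n. \<exists>a \<in> F.poly_values (\<rho> ` R) (\<rho> u) n. a \<oplus>\<^bsub>F\<^esub> \<rho> u [^]\<^bsub>F\<^esub> n = \<zero>\<^bsub>F\<^esub>"
    and k: "subfield k F" "\<rho> ` R \<subseteq> k" "\<rho> u \<in> k"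
  shows "\<exists>R' h. local_at R' x h \<and> R \<subseteq> R' \<and> u \<in> R' \<and> \<rho> ` R' \<subseteq> k \<and> (ge 1 u \<longrightarrow> h = u)
    \<and> (\<forall>r\<in>R. ge 1 r \<longrightarrow> r \<otimes> inv x \<in> R')"
proof -
  have R': "subring R L" "R \<subseteq> V" using R unfolding local_at_def by auto
  have uc: "u \<in> carrier L" using u V_carrier by simp
  define Q where "Q n = (\<exists>a \<in> poly_values R u n. ge 1 (a \<oplus> u [^] n))" for n
  obtain n a' where a': "a' \<in> F.poly_values (\<rho> ` R) (\<rho> u) n" "a' \<oplus>\<^bsub>F\<^esub> \<rho> u [^]\<^bsub>F\<^esub> n = \<zero>\<^bsub>F\<^esub>"
    using alg by blast
  obtain a where a: "a \<in> poly_values R u n" "a \<in> V" "\<rho> a = a'"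
    using res_poly_values_lift[OF R'(2) u(1) a'(1)] by blast
  have "ge 1 (a \<oplus> u [^] n)" using a a' u res_eq_zero[of "a \<oplus> u [^] n"] by (simp add: res_add res_pow V_add V_pow)
  then have "Q n" unfolding Q_def using a by blast
  \<comment> \<open>degree zero is excluded because \<open>\<one>\<close> is a unit\<close>
  define N where "N = (LEAST n. Q n)"
  have QN: "Q N" unfolding N_def using \<open>Q n\<close> by (rule LeastI)
  have minN: "\<not> Q m" if "m < N" for m using that unfolding N_def by (rule not_less_Least)
  have Q0: "\<not> Q 0" unfolding Q_def using not_ge1[OF V_one] by simp
  obtain a h where ah: "a \<in> poly_values R u N" "h = a \<oplus> u [^] N" "ge 1 h" "ge 1 u \<longrightarrow> h = u"
  proof (cases "ge 1 u")
    case True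
    have z: "\<zero> \<in> poly_values R u 1" using subringE(1,2)[OF R'(1)] uc
      by (auto intro!: exI[of _ \<zero>])
    then have "Q 1" unfolding Q_def using True uc by force
    then have "N = 1" using minN[of 1] Q0 QN by (metis less_one linorder_neqE_nat)
    then show thesis using that[of \<zero> u] z uc True by simp
  next
    case False then show thesis using that QN unfolding Q_def by blast
  qed
  have loc: "local_at (localization (simple_extension R u)) x h"
    using quadratic_transform_aux[OF R x0 u ah(1-3)] minN unfolding Q_def by blast
  define A where "A = simple_extension R u"
  have A: "subring A L" unfolding A_def using simple_extension_is_subring[OF R'(1) uc] .
  have AV: "A \<subseteq> V" unfolding A_def using simple_extension_subring_incl[OF V R'(2) u(1)] .
  have RA: "R \<subseteq> A" unfolding A_def using simple_extension_incl[OF subringE(1)[OF R'(1)] uc] .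
  have uA: "u \<in> A" unfolding A_def using simple_extension_mem[OF R'(1) uc] .
  note incl = localization_incl[OF A]
  have "\<rho> ` localization A \<subseteq> k"
    using localization_res[OF AV k(1)] res_simple_extension[OF _ R'(2) u(1) subfieldE(1)[OF k(1)] k(2,3)]
    unfolding A_def by blast
  moreover have "r \<otimes> inv x \<in> A" if r: "r \<in> R" "ge 1 r" for r
  proof -
    obtain p q where pq: "p \<in> R" "q \<in> R" "r = p \<otimes> x \<oplus> q \<otimes> y" using R r unfolding local_at_def by blast
    have c: "p \<in> carrier L" "q \<in> carrier L" "x \<in> carrier L" using pq subringE(1)[OF R'(1)] R ge_carrier
      unfolding local_at_def by auto
    have "r \<otimes> inv x = (p \<oplus> q \<otimes> u) \<otimes> (x \<otimes> inv x)"
      unfolding pq(3) u(2)[symmetric] using c inv_closed'[OF c(3) x0] uc by algebra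
    then have "r \<otimes> inv x = p \<oplus> q \<otimes> u" using c x0 uc by simp
    then show ?thesis using subringE(7)[OF A _ subringE(6)[OF A _ uA]] pq(1,2) RA by (metis subsetD)
  qed
  ultimately show ?thesis using loc ah(4) incl RA uA unfolding A_def by blast
qed

end

section \<open>The places of a rational function field at zero and infinity\<close>

text \<open>
  Relative algebraic closedness, stated through leading coefficients: repeated use strips off all
  coefficients of a relation from the top.
\<close>

locale relatively_closed_subfield = field +
  fixes k
  assumes k: "subfield k R"
    and free: "\<And>u n a c. u \<in> carrier R \<Longrightarrow> u \<notin> k \<Longrightarrow> a \<in> poly_values k u n \<Longrightarrow> c \<in> k \<Longrightarrow>
      a \<oplus> c \<otimes> u [^] n = \<zero> \<Longrightarrow> c = \<zero>"
begin

lemma k_sub: "subring k R" and k_carrier: "a \<in> k \<Longrightarrow> a \<in> carrier R"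
  using subfieldE[OF k] by auto

lemma k_closed: "\<one> \<in> k" "\<zero> \<in> k" "a \<in> k \<Longrightarrow> b \<in> k \<Longrightarrow> a \<otimes> b \<in> k"
  "a \<in> k \<Longrightarrow> b \<in> k \<Longrightarrow> a \<oplus> b \<in> k" "a \<in> k \<Longrightarrow> \<ominus> a \<in> k" "a \<in> k \<Longrightarrow> a \<noteq> \<zero> \<Longrightarrow> inv a \<in> k"
  using subringE[OF k_sub] subfield_m_inv(1)[OF k, of a] by auto

lemma poly_values_ring_k: "u \<in> carrier R \<Longrightarrow> poly_values_ring R k u"
  by (rule poly_values_ring.intro[OF is_cring poly_values_ring_axioms.intro[OF k_sub]])

lemma inv_notin: "u \<in> carrier R \<Longrightarrow> u \<notin> k \<Longrightarrow> u \<noteq> \<zero> \<and> inv u \<in> carrier R \<and> inv u \<notin> k \<and> inv (inv u) = u"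
proof -
  assume u: "u \<in> carrier R" "u \<notin> k"
  then have u0: "u \<noteq> \<zero>" using k_closed by auto
  note i = inv_nonzero[OF u(1) u0]
  have ii: "inv (inv u) = u" using i u comm_inv_char[of "inv u" u] by auto
  then show ?thesis using u0 i u k_closed(6)[of "inv u"] by auto
qed

lemma generate_inverse:
  assumes u: "u \<in> carrier R" "u \<notin> k"
  shows "generate_field R (insert (inv u) k) = generate_field R (insert u k)"
proof -
  have sub: "generate_field R (insert u k) \<subseteq> generate_field R (insert (inv u) k)"
    if u: "u \<in> carrier R" "u \<notin> k" for u
  proof -
    note i = inv_notin[OF u]
    have s: "insert (inv u) k \<subseteq> carrier R" using i k_carrier by auto
    have "inv u \<in> generate_field R (insert (inv u) k)" by (rule generate_field.incl) simp
    then have "inv (inv u) \<in> generate_field R (insert (inv u) k)"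
      by (rule generate_field.m_inv) (use i k_closed in auto)
    then have "insert u k \<subseteq> generate_field R (insert (inv u) k)"
      using i by (auto intro: generate_field.incl)
    then show ?thesis
      using generate_field_min_subfield1[OF _ generate_field_is_subfield[OF s], of "insert u k"] u k_carrier
      by blast
  qed
  show ?thesis using sub[OF u] sub[of "inv u"] inv_notin[OF u] by auto
qed

abbreviation (input) "P u \<equiv> simple_extension k u"

text \<open>
  The polynomials in \<open>u\<close> with nonzero constant term, that is, those without a zero at \<open>u = 0\<close>.
\<close>

definition nonvanishing :: "'a \<Rightarrow> 'a set" where
  "nonvanishing u = {c \<oplus> a \<otimes> u | c a. c \<in> k \<and> c \<noteq> \<zero> \<and> a \<in> P u}"

lemma P_sub: "u \<in> carrier R \<Longrightarrow> subring (P u) R"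
  by (rule simple_extension_is_subring[OF k_sub])

lemma P_carrier: "u \<in> carrier R \<Longrightarrow> a \<in> P u \<Longrightarrow> a \<in> carrier R"
  using subringE(1)[OF P_sub] by blast

lemma P_closed: assumes "u \<in> carrier R"
  shows "\<one> \<in> P u" "\<zero> \<in> P u" "a \<in> P u \<Longrightarrow> b \<in> P u \<Longrightarrow> a \<otimes> b \<in> P u"
  "a \<in> P u \<Longrightarrow> b \<in> P u \<Longrightarrow> a \<oplus> b \<in> P u" "a \<in> P u \<Longrightarrow> \<ominus> a \<in> P u" "u \<in> P u" "c \<in> k \<Longrightarrow> c \<in> P u"
  using subringE[OF P_sub[OF assms]] simple_extension_mem[OF k_sub assms]
    simple_extension_incl[OF subringE(1)[OF k_sub] assms] by auto

lemma P_pow: "u \<in> carrier R \<Longrightarrow> a \<in> P u \<Longrightarrow> a [^] (n::nat) \<in> P u"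
  by (induct n) (auto simp: P_closed)

text \<open>
  Freeness is formulated with leading coefficients, but the local study at \<open>u = 0\<close> is about constant
  terms; the top coefficients of \<open>a\<close> are peeled off one by one.
\<close>

lemma constant_term_zero:
  assumes uu: "u \<in> carrier R" "u \<notin> k" and a: "a \<in> P u" and c: "c \<in> k" and rel: "c \<oplus> a \<otimes> u = \<zero>"
  shows "c = \<zero>"
proof -
  interpret poly_values_ring R k u by (rule poly_values_ring_k[OF uu(1)])
  obtain n where "a \<in> poly_values k u n" using a unfolding simple_extension_eq_poly_values by blast
  then show ?thesis using rel
  proof (induct n arbitrary: a)
    case 0 then show ?case using c k_carrier u by auto
  next
    case (Suc n)
    obtain a' r where a': "a' \<in> poly_values k u n" "r \<in> k" "a = a' \<oplus> r \<otimes> u [^] n" using Suc(2) by auto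
    have cc: "a' \<in> carrier R" "r \<in> carrier R" "c \<in> carrier R" "u [^] n \<in> carrier R"
      using poly_values_in_carrier[OF a'(1)] a' c k_carrier u by auto
    have "c \<otimes> u [^] (0::nat) \<in> poly_values k u (Suc n)" by (rule poly_values_monom) (use c in auto)
    then have "c \<oplus> a' \<otimes> u \<in> poly_values k u (Suc n)" using poly_values_add[OF _ poly_values_shift[OF a'(1)]] cc by simp
    moreover have "(c \<oplus> a' \<otimes> u) \<oplus> r \<otimes> u [^] Suc n = \<zero>"
      using Suc(3) unfolding a'(3) using cc u by (simp add: l_distr m_assoc a_assoc)
    ultimately have "r = \<zero>" using free[OF uu _ a'(2)] by blast
    then have "a = a'" using a' cc by simp
    then show ?case using Suc(1)[OF a'(1)] Suc(3) by simp
  qed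
qed

lemma nonvanishing_subset: "u \<in> carrier R \<Longrightarrow> e \<in> nonvanishing u \<Longrightarrow> e \<in> P u"
  unfolding nonvanishing_def by (auto simp: P_closed)

lemma nonvanishing_nonzero: "u \<in> carrier R \<Longrightarrow> u \<notin> k \<Longrightarrow> e \<in> nonvanishing u \<Longrightarrow> e \<noteq> \<zero>"
  unfolding nonvanishing_def using constant_term_zero by auto

lemma nonvanishing_const: "u \<in> carrier R \<Longrightarrow> c \<in> k \<Longrightarrow> c \<noteq> \<zero> \<Longrightarrow> c \<in> nonvanishing u"
  unfolding nonvanishing_def using P_closed(2)[of u] k_carrier[of c] by force

lemma nonvanishing_mult:
  assumes u: "u \<in> carrier R" and e: "e \<in> nonvanishing u" "e' \<in> nonvanishing u"
  shows "e \<otimes> e' \<in> nonvanishing u"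
proof -
  obtain c a c' a' where *: "e = c \<oplus> a \<otimes> u" "c \<in> k" "c \<noteq> \<zero>" "a \<in> P u"
    "e' = c' \<oplus> a' \<otimes> u" "c' \<in> k" "c' \<noteq> \<zero>" "a' \<in> P u"
    using e unfolding nonvanishing_def by blast
  have cc: "c \<in> carrier R" "c' \<in> carrier R" "a \<in> carrier R" "a' \<in> carrier R"
    using * k_carrier P_carrier[OF u] by auto
  have "e \<otimes> e' = c \<otimes> c' \<oplus> (c \<otimes> a' \<oplus> a \<otimes> c' \<oplus> a \<otimes> a' \<otimes> u) \<otimes> u"
    unfolding *(1,5) using cc u by algebra
  moreover have "c \<otimes> c' \<in> k" "c \<otimes> c' \<noteq> \<zero>" using * cc k_closed by (auto simp: integral_iff)
  moreover have "c \<otimes> a' \<oplus> a \<otimes> c' \<oplus> a \<otimes> a' \<otimes> u \<in> P u" using * by (simp add: P_closed[OF u])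
  ultimately show ?thesis unfolding nonvanishing_def by blast
qed

lemma factor_power:
  assumes u: "u \<in> carrier R" and p: "p \<in> P u" "p \<noteq> \<zero>"
  shows "\<exists>i::nat. \<exists>e\<in>nonvanishing u. p = u [^] i \<otimes> e"
  using p
proof (induct rule: simple_extension.induct)
  case (lin a c)
  have cc: "a \<in> carrier R" "c \<in> carrier R" using lin P_carrier[OF u] k_carrier by auto
  show ?case
  proof (cases "c = \<zero>")
    case True
    then have "a \<noteq> \<zero>" using lin u by auto
    then obtain i e where ie: "e \<in> nonvanishing u" "a = u [^] (i::nat) \<otimes> e" using lin by blast
    have "e \<in> carrier R" using nonvanishing_subset[OF u ie(1)] P_carrier[OF u] by blast
    then have "a \<otimes> u \<oplus> c = u [^] Suc i \<otimes> e" using True ie u by (simp add: m_ac)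
    then show ?thesis using ie by blast
  next
    case False
    then have "a \<otimes> u \<oplus> c \<in> nonvanishing u"
      unfolding nonvanishing_def using lin cc u a_comm[of "a \<otimes> u" c] by blast
    then show ?thesis using cc u by (intro exI[of _ 0] bexI[of _ "a \<otimes> u \<oplus> c"]) auto
  qed
qed simp

lemma generated_fractions:
  assumes u: "u \<in> carrier R"
  shows "generate_field R (insert u k) \<subseteq> fractions (P u) (P u - {\<zero>})"
proof
  fix w assume "w \<in> generate_field R (insert u k)"
  let ?Q = "fractions (P u) (P u - {\<zero>})"
  have sub: "subring ?Q R"
    using P_closed[OF u] P_carrier[OF u] by (intro fractions_subring P_sub[OF u]) (auto simp: integral_iff)
  have incl: "P u \<subseteq> ?Q"
    using P_closed[OF u] P_carrier[OF u] by (intro fractions_incl) auto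
  show "w \<in> ?Q"
    using \<open>w \<in> generate_field R (insert u k)\<close>
  proof (induct rule: generate_field.induct)
    case (incl h)
    then have "h \<in> P u" using P_closed(6,7)[OF u] by auto
    then show ?case using \<open>P u \<subseteq> ?Q\<close> by blast
  next
    case (m_inv h)
    then obtain q where q: "h \<in> carrier R" "q \<in> P u" "q \<noteq> \<zero>" "h \<otimes> q \<in> P u" unfolding fractions_def by blast
    have qc: "q \<in> carrier R" using q P_carrier[OF u] by blast
    have "h \<otimes> q \<noteq> \<zero>" using m_inv q qc by (auto simp: integral_iff)
    moreover have "inv h \<otimes> (h \<otimes> q) = (inv h \<otimes> h) \<otimes> q"
      using m_inv q qc by (simp add: m_assoc del: l_inv')
    then have "inv h \<otimes> (h \<otimes> q) \<in> P u" using m_inv q qc by simp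
    moreover have "inv h \<in> carrier R" using m_inv q by simp
    ultimately show ?case unfolding fractions_def using q(4)
      by (intro CollectI conjI bexI[of _ "h \<otimes> q"]) simp_all
  qed (use subringE(3,5-7)[OF sub] in auto)
qed

lemma generated_quotient:
  assumes u: "u \<in> carrier R" and w: "w \<in> generate_field R (insert u k)"
  shows "w \<in> carrier R \<and> (\<exists>p\<in>P u. \<exists>q\<in>P u. q \<noteq> \<zero> \<and> w \<otimes> q = p)"
  using generated_fractions[OF u] w unfolding fractions_def by blast

text \<open>
  The local ring of the \<open>u\<close>-line at \<open>u = 0\<close>.
\<close>

definition regular_at :: "'a \<Rightarrow> 'a set" where
  "regular_at u = fractions (P u) (nonvanishing u)"

text \<open>
  The maximal ideal of \<open>regular_at u\<close>: the rational functions that vanish at \<open>u = 0\<close>.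
\<close>

definition zero_at :: "'a \<Rightarrow> 'a set" where
  "zero_at u = {w \<in> carrier R. \<exists>p\<in>P u. \<exists>q\<in>nonvanishing u. w \<otimes> q = p \<otimes> u}"

context
  fixes u assumes u: "u \<in> carrier R" "u \<notin> k"
begin

lemma nv_carrier: "q \<in> nonvanishing u \<Longrightarrow> q \<in> carrier R"
  using nonvanishing_subset[OF u(1)] P_carrier[OF u(1)] by blast

lemma regular_P: "p \<in> P u \<Longrightarrow> p \<in> regular_at u"
  unfolding regular_at_def
  using fractions_incl[OF subringE(1)[OF P_sub[OF u(1)]] nonvanishing_const[OF u(1) k_closed(1)]] by auto

lemma regular_at_subring: "subring (regular_at u) R"
  unfolding regular_at_def
  using nonvanishing_subset[OF u(1)] nonvanishing_const[OF u(1) k_closed(1)] nonvanishing_mult[OF u(1)]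
  by (intro fractions_subring P_sub[OF u(1)]) auto

lemma regular_k: "c \<in> k \<Longrightarrow> c \<in> regular_at u"
  using regular_P P_closed(7)[OF u(1)] by blast

lemma zero_at_self: "u \<in> zero_at u"
  unfolding zero_at_def using u P_closed[OF u(1)] nonvanishing_const[OF u(1) k_closed(1)]
  by (auto intro!: bexI[of _ \<one>])

lemma zero_at_subset: "zero_at u \<subseteq> regular_at u"
proof
  fix w assume "w \<in> zero_at u"
  then obtain p q where "w \<in> carrier R" "p \<in> P u" "q \<in> nonvanishing u" "w \<otimes> q = p \<otimes> u"
    unfolding zero_at_def by blast
  moreover from this have "w \<otimes> q \<in> P u" using P_closed(3,6)[OF u(1)] by simp
  ultimately show "w \<in> regular_at u" unfolding regular_at_def fractions_def by blast
qed

lemma zero_at_mult: assumes "h \<in> regular_at u" "g \<in> zero_at u" shows "h \<otimes> g \<in> zero_at u"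
proof -
  obtain p q where pq: "h \<in> carrier R" "p \<in> P u" "q \<in> nonvanishing u" "h \<otimes> q = p"
    using assms unfolding regular_at_def fractions_def by blast
  obtain p' q' where pq': "g \<in> carrier R" "p' \<in> P u" "q' \<in> nonvanishing u" "g \<otimes> q' = p' \<otimes> u"
    using assms unfolding zero_at_def by blast
  have c: "q \<in> carrier R" "q' \<in> carrier R" "p \<in> carrier R" "p' \<in> carrier R"
    using pq pq' nv_carrier P_carrier[OF u(1)] by auto
  have n: "q \<otimes> q' \<in> nonvanishing u" using nonvanishing_mult[OF u(1)] pq pq' by blast
  have "(h \<otimes> g) \<otimes> (q \<otimes> q') = (h \<otimes> q) \<otimes> (g \<otimes> q')" using c pq(1) pq'(1) by algebra
  also have "\<dots> = (p \<otimes> p') \<otimes> u" unfolding pq(4) pq'(4) using c u by (simp add: m_assoc)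
  finally show ?thesis unfolding zero_at_def using n pq(1) pq'(1) P_closed(3)[OF u(1) pq(2) pq'(2)] by blast
qed

lemma zero_at_minus: assumes "h \<in> zero_at u" "g \<in> zero_at u" shows "h \<oplus> \<ominus> g \<in> zero_at u"
proof -
  obtain p q where pq: "h \<in> carrier R" "p \<in> P u" "q \<in> nonvanishing u" "h \<otimes> q = p \<otimes> u"
    using assms unfolding zero_at_def by blast
  obtain p' q' where pq': "g \<in> carrier R" "p' \<in> P u" "q' \<in> nonvanishing u" "g \<otimes> q' = p' \<otimes> u"
    using assms unfolding zero_at_def by blast
  have c: "q \<in> carrier R" "q' \<in> carrier R" "p \<in> carrier R" "p' \<in> carrier R"
    using pq pq' nv_carrier P_carrier[OF u(1)] by auto
  have n: "q \<otimes> q' \<in> nonvanishing u" using nonvanishing_mult[OF u(1)] pq pq' by blast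
  have "(h \<oplus> \<ominus> g) \<otimes> (q \<otimes> q') = (h \<otimes> q) \<otimes> q' \<oplus> \<ominus> ((g \<otimes> q') \<otimes> q)" using c pq(1) pq'(1) by algebra
  also have "\<dots> = (p \<otimes> q' \<oplus> \<ominus> (p' \<otimes> q)) \<otimes> u" unfolding pq(4) pq'(4) using c u by algebra
  finally have "(h \<oplus> \<ominus> g) \<otimes> (q \<otimes> q') = (p \<otimes> q' \<oplus> \<ominus> (p' \<otimes> q)) \<otimes> u" .
  moreover have "p \<otimes> q' \<oplus> \<ominus> (p' \<otimes> q) \<in> P u"
    using pq pq' nonvanishing_subset[OF u(1)] by (simp add: P_closed[OF u(1)])
  ultimately show ?thesis unfolding zero_at_def using n pq(1) pq'(1) by blast
qed

lemma nonvanishing_not_zero_at: "e \<in> nonvanishing u \<Longrightarrow> e \<notin> zero_at u"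
proof
  assume e: "e \<in> nonvanishing u" "e \<in> zero_at u"
  then obtain p q where pq: "p \<in> P u" "q \<in> nonvanishing u" "e \<otimes> q = p \<otimes> u"
    unfolding zero_at_def by blast
  obtain c a where ca: "e \<otimes> q = c \<oplus> a \<otimes> u" "c \<in> k" "c \<noteq> \<zero>" "a \<in> P u"
    using nonvanishing_mult[OF u(1) e(1) pq(2)] unfolding nonvanishing_def by blast
  have cc: "c \<in> carrier R" "a \<in> carrier R" "p \<in> carrier R" using ca pq k_carrier P_carrier[OF u(1)] by auto
  have "c \<oplus> (a \<oplus> \<ominus> p) \<otimes> u = (c \<oplus> a \<otimes> u) \<oplus> \<ominus> (p \<otimes> u)" using cc u by algebra
  also have "\<dots> = \<zero>" using ca(1) pq(3) cc u by (simp add: r_neg)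
  finally show False using constant_term_zero[OF u _ ca(2), of "a \<oplus> \<ominus> p"] ca(3,4) pq(1)
    by (simp add: P_closed[OF u(1)])
qed

lemma k_zero_at: "c \<in> k \<Longrightarrow> c \<in> zero_at u \<Longrightarrow> c = \<zero>"
  using nonvanishing_not_zero_at nonvanishing_const[OF u(1)] by blast

text \<open>
  Valuation ring property, read off from the orders \<open>i\<close> and \<open>j\<close> at \<open>u = 0\<close> of numerator and
  denominator.
\<close>

lemma pole_inverse_zero:
  assumes w: "w \<in> generate_field R (insert u k)" "w \<notin> regular_at u"
  shows "w \<noteq> \<zero> \<and> inv w \<in> zero_at u"
proof -
  obtain p q where pq: "w \<in> carrier R" "p \<in> P u" "q \<in> P u" "q \<noteq> \<zero>" "w \<otimes> q = p"
    using generated_quotient[OF u(1) w(1)] by blast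
  have w0: "w \<noteq> \<zero>" using w(2) regular_P[OF P_closed(2)[OF u(1)]] by blast
  have qc: "q \<in> carrier R" using pq P_carrier[OF u(1)] by blast
  have p0: "p \<noteq> \<zero>" using pq w0 qc by (auto simp: integral_iff)
  obtain i e j d where ij: "e \<in> nonvanishing u" "p = u [^] (i::nat) \<otimes> e"
    "d \<in> nonvanishing u" "q = u [^] (j::nat) \<otimes> d"
    using factor_power[OF u(1) pq(2) p0] factor_power[OF u(1) pq(3,4)] by blast
  have c: "e \<in> carrier R" "d \<in> carrier R" using ij nv_carrier by auto
  have u0: "u \<noteq> \<zero>" using inv_notin[OF u] by blast
  have up: "u [^] (n::nat) \<noteq> \<zero>" for n by (induct n) (use u u0 in \<open>auto simp: integral_iff\<close>)
  have rel: "w \<otimes> (u [^] j \<otimes> d) = u [^] i \<otimes> e" using pq ij by simp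
  have "i < j"
  proof (rule ccontr)
    assume "\<not> i < j"
    then have "u [^] i = u [^] j \<otimes> u [^] (i - j)" using nat_pow_mult[OF u(1), of j "i - j"] by simp
    then have "u [^] j \<otimes> (w \<otimes> d) = u [^] j \<otimes> (u [^] (i - j) \<otimes> e)"
      using rel c pq u by (simp add: m_ac)
    then have "w \<otimes> d = u [^] (i - j) \<otimes> e" using m_lcancel[OF up] c pq u by simp
    moreover have "u [^] (i - j) \<otimes> e \<in> P u"
      using ij nonvanishing_subset[OF u(1)] by (simp add: P_closed[OF u(1)] P_pow[OF u(1)])
    ultimately have "w \<otimes> d \<in> P u" by simp
    then show False using w(2) pq(1) ij(3) unfolding regular_at_def fractions_def by blast
  qed
  then have "u [^] j = u [^] i \<otimes> (u [^] (j - i - 1) \<otimes> u)"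
    using nat_pow_mult[OF u(1), of i "Suc (j - i - 1)"] by simp
  then have "u [^] i \<otimes> (w \<otimes> (u [^] (j - i - 1) \<otimes> u \<otimes> d)) = u [^] i \<otimes> e"
    using rel c pq u by (simp add: m_ac)
  then have *: "w \<otimes> (u [^] (j - i - 1) \<otimes> u \<otimes> d) = e" using m_lcancel[OF up] c pq u by simp
  note iw = inv_nonzero[OF pq(1) w0]
  have "inv w \<otimes> e = (inv w \<otimes> w) \<otimes> (u [^] (j - i - 1) \<otimes> d \<otimes> u)"
    unfolding *[symmetric] using iw[THEN conjunct1] c pq(1) u nat_pow_closed[OF u(1), of "j - i - 1"] by algebra
  then have "inv w \<otimes> e = u [^] (j - i - 1) \<otimes> d \<otimes> u" using iw c u by simp
  moreover have "u [^] (j - i - 1) \<otimes> d \<in> P u"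
    using ij nonvanishing_subset[OF u(1)] by (simp add: P_closed[OF u(1)] P_pow[OF u(1)])
  ultimately show ?thesis using w0 iw ij(1) unfolding zero_at_def by blast
qed

lemma pole_not_regular:
  assumes Z: "Z \<in> carrier R" "Z \<otimes> u [^] (n::nat) \<in> nonvanishing u" "n > 0"
  shows "Z \<notin> regular_at u"
proof
  assume "Z \<in> regular_at u"
  moreover have "u [^] n = u [^] (n - 1) \<otimes> u" using Z(3) by (cases n) auto
  then have "u [^] n \<in> zero_at u"
    using zero_at_mult[OF regular_P[OF P_pow[OF u(1) P_closed(6)[OF u(1)]]] zero_at_self] by simp
  ultimately have "Z \<otimes> u [^] n \<in> zero_at u" using zero_at_mult by blast
  then show False using nonvanishing_not_zero_at Z by blast
qed

end

text \<open>
  If \<open>w\<close> vanishes at the place \<open>u = 0\<close>, a polynomial in \<open>w\<close> with nonzero constant term is a unit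
  there, because it is congruent to that constant.
\<close>

lemma nonvanishing_unit:
  assumes u: "u \<in> carrier R" "u \<notin> k" and w: "w \<in> zero_at u" and e: "e \<in> nonvanishing w"
  shows "e \<in> regular_at u" "e \<notin> zero_at u"
proof -
  note sub = regular_at_subring[OF u]
  have wr: "w \<in> regular_at u" using w zero_at_subset[OF u] by blast
  have wc: "w \<in> carrier R" using w unfolding zero_at_def by blast
  have Pw: "p \<in> regular_at u" if "p \<in> P w" for p
    using simple_extension_subring_incl[OF sub _ wr] regular_k[OF u] that by blast
  obtain c a where ca: "e = c \<oplus> a \<otimes> w" "c \<in> k" "c \<noteq> \<zero>" "a \<in> P w"
    using e unfolding nonvanishing_def by blast
  show "e \<in> regular_at u" using Pw nonvanishing_subset[OF wc e] by blast
  have aw: "a \<otimes> w \<in> zero_at u" using zero_at_mult[OF u Pw[OF ca(4)] w] .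
  have cc: "c \<in> carrier R" "a \<in> carrier R" using ca k_carrier P_carrier[OF wc] by auto
  show "e \<notin> zero_at u"
  proof
    assume "e \<in> zero_at u"
    then have "e \<oplus> \<ominus> (a \<otimes> w) \<in> zero_at u" using zero_at_minus[OF u _ aw] by blast
    moreover have "e \<oplus> \<ominus> (a \<otimes> w) = c" unfolding ca(1) using cc wc by algebra
    ultimately show False using k_zero_at[OF u ca(2)] ca(3) by simp
  qed
qed

text \<open>
  A polynomial in \<open>t\<close> can only have a pole where \<open>t\<close> has one, so \<open>w = inv t\<close> vanishes at \<open>u = 0\<close> and
  at \<open>u = \<infinity>\<close>. As \<open>u\<close> lies in \<open>k(w)\<close>, it is \<open>w\<close> to the power \<open>i - j\<close> times a unit at both places.
  If \<open>i \<le> j\<close> this contradicts the zero of \<open>u\<close> at the first place, and if \<open>j < i\<close> it contradicts the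
  zero of \<open>inv u\<close> at the second one.
\<close>

theorem not_polynomial_of_two_poles:
  assumes u: "u \<in> carrier R" "u \<notin> k" and gu: "generate_field R (insert u k) = carrier R"
    and Z: "Z \<in> carrier R"
    and pole: "Z \<otimes> u [^] (n::nat) \<in> nonvanishing u" "n > 0"
    and pole': "Z \<otimes> inv u [^] (m::nat) \<in> nonvanishing (inv u)" "m > 0"
    and t: "t \<in> carrier R" "generate_field R (insert t k) = carrier R"
  shows "Z \<notin> simple_extension k t"
proof
  assume Zt: "Z \<in> simple_extension k t"
  have u': "u \<noteq> \<zero>" "inv u \<in> carrier R" "inv u \<notin> k" "inv (inv u) = u" using inv_notin[OF u] by auto
  have gu': "generate_field R (insert (inv u) k) = carrier R" using generate_inverse[OF u] gu by simp
  have nt: "t \<notin> regular_at r" if r: "r \<in> carrier R" "r \<notin> k" "Z \<notin> regular_at r" for r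
    using simple_extension_subring_incl[OF regular_at_subring[OF r(1,2)], of k t] regular_k[OF r(1,2)]
      Zt r(3) by blast
  have t1: "t \<notin> regular_at u" "t \<notin> regular_at (inv u)"
    using nt u u' pole_not_regular[OF u Z pole] pole_not_regular[OF u'(2,3) Z pole'] by auto
  define w where "w = inv t"
  have w: "w \<in> zero_at u" "w \<in> zero_at (inv u)" "t \<noteq> \<zero>"
    using pole_inverse_zero[OF u _ t1(1)] pole_inverse_zero[OF u'(2,3) _ t1(2)] t gu gu' unfolding w_def by auto
  have "t \<notin> k" using t1 regular_k[OF u] by blast
  then have w': "w \<in> carrier R" "w \<notin> k" "inv w = t" using inv_notin[OF t(1)] unfolding w_def by auto
  have wr: "w \<in> regular_at u" "w \<in> regular_at (inv u)"
    using w zero_at_subset[OF u] zero_at_subset[OF u'(2,3)] by auto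
  have "u \<in> generate_field R (insert w k)"
    using generate_inverse[OF t(1) \<open>t \<notin> k\<close>] t(2) u(1) unfolding w_def by simp
  then obtain p q where pq: "p \<in> P w" "q \<in> P w" "q \<noteq> \<zero>" "u \<otimes> q = p"
    using generated_quotient[OF w'(1)] by blast
  have qc: "q \<in> carrier R" using pq P_carrier[OF w'(1)] by blast
  have p0: "p \<noteq> \<zero>" using pq u u' qc by (auto simp: integral_iff)
  obtain i e j d where ij: "e \<in> nonvanishing w" "p = w [^] (i::nat) \<otimes> e"
    "d \<in> nonvanishing w" "q = w [^] (j::nat) \<otimes> d"
    using factor_power[OF w'(1) pq(1) p0] factor_power[OF w'(1) pq(2,3)] by blast
  have c: "e \<in> carrier R" "d \<in> carrier R" using ij nonvanishing_subset[OF w'(1)] P_carrier[OF w'(1)] by auto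
  have w0: "w \<noteq> \<zero>" using w' k_closed by auto
  have up: "w [^] (n::nat) \<noteq> \<zero>" for n by (induct n) (use w' w0 in \<open>auto simp: integral_iff\<close>)
  have rel: "u \<otimes> (w [^] j \<otimes> d) = w [^] i \<otimes> e" using pq ij by simp
  have wp: "w [^] (n::nat) \<in> regular_at u" "w [^] (n::nat) \<in> regular_at (inv u)" for n
    by (induct n) (auto simp: wr subringE(3,6)[OF regular_at_subring] u u')
  show False
  proof (cases "i \<le> j")
    case True
    then have "w [^] j = w [^] i \<otimes> w [^] (j - i)" using nat_pow_mult[OF w'(1), of i "j - i"] by simp
    then have "w [^] i \<otimes> ((w [^] (j - i) \<otimes> d) \<otimes> u) = w [^] i \<otimes> e" using rel c w' u by (simp add: m_ac)
    then have "(w [^] (j - i) \<otimes> d) \<otimes> u = e" using m_lcancel[OF up] c w' u by simp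
    moreover have "(w [^] (j - i) \<otimes> d) \<otimes> u \<in> zero_at u"
      using zero_at_mult[OF u _ zero_at_self[OF u]] subringE(6)[OF regular_at_subring[OF u]] wp
        nonvanishing_unit[OF u w(1) ij(3)] by blast
    ultimately show False using nonvanishing_unit[OF u w(1) ij(1)] by simp
  next
    case False
    then have "w [^] i = w [^] j \<otimes> w [^] (i - j)" using nat_pow_mult[OF w'(1), of j "i - j"] by simp
    then have "w [^] j \<otimes> (u \<otimes> d) = w [^] j \<otimes> (w [^] (i - j) \<otimes> e)" using rel c w' u by (simp add: m_ac)
    then have ud: "u \<otimes> d = w [^] (i - j) \<otimes> e" using m_lcancel[OF up] c w' u by simp
    have "(w [^] (i - j) \<otimes> e) \<otimes> inv u = (u \<otimes> inv u) \<otimes> d" unfolding ud[symmetric] using c u u' by algebra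
    then have "(w [^] (i - j) \<otimes> e) \<otimes> inv u = d" using inv_nonzero[OF u(1) u'(1)] c by simp
    moreover have "(w [^] (i - j) \<otimes> e) \<otimes> inv u \<in> zero_at (inv u)"
      using zero_at_mult[OF u'(2,3) _ zero_at_self[OF u'(2,3)]] subringE(6)[OF regular_at_subring[OF u'(2,3)]] wp
        nonvanishing_unit[OF u'(2,3) w(2) ij(1)] by blast
    ultimately show False using nonvanishing_unit[OF u'(2,3) w(2) ij(3)] by simp
  qed
qed

end

lemma (in ring) finsum_in_subring:
  assumes S: "subring S R" and "finite B" "\<And>b. b \<in> B \<Longrightarrow> g b \<in> S"
  shows "finsum R g B \<in> S"
  using assms(2,3)
proof (induct B rule: finite_induct)
  case empty then show ?case using subringE(2)[OF S] by simp
next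
  case (insert b B)
  have "finsum R g (insert b B) = g b \<oplus> finsum R g B"
    using insert subringE(1)[OF S] by (intro finsum_insert) auto
  then show ?case using insert subringE(7)[OF S] by simp
qed

text \<open>
  The element \<open>m\<close> of the index set carries the constant term.
\<close>

lemma (in relatively_closed_subfield) finsum_nonvanishing:
  assumes u: "u \<in> carrier R" and B: "finite B" "m \<in> B" and c: "\<And>b. b \<in> B \<Longrightarrow> c b \<in> k" "c m \<noteq> \<zero>"
    and e: "e m = 0" "\<And>b. b \<in> B \<Longrightarrow> b \<noteq> m \<Longrightarrow> 0 < e b"
  shows "(\<Oplus>b\<in>B. c b \<otimes> u [^] (e b :: nat)) \<in> nonvanishing u"
proof -
  have cc: "c b \<in> carrier R" if "b \<in> B" for b using c k_carrier that by blast
  define a where "a = (\<Oplus>b\<in>B - {m}. c b \<otimes> u [^] (e b - 1))"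
  have a: "a \<in> P u" unfolding a_def
    using finsum_in_subring[OF P_sub[OF u], of "B - {m}"] B c(1) P_closed(3,6,7)[OF u] P_pow[OF u] by auto
  have "(\<Oplus>b\<in>B. c b \<otimes> u [^] e b) = (\<Oplus>b\<in>insert m (B - {m}). c b \<otimes> u [^] e b)"
    using B by (simp add: insert_absorb)
  also have "\<dots> = c m \<otimes> u [^] e m \<oplus> (\<Oplus>b\<in>B - {m}. c b \<otimes> u [^] e b)"
    using B cc u by (intro finsum_insert) auto
  also have "(\<Oplus>b\<in>B - {m}. c b \<otimes> u [^] e b) = (\<Oplus>b\<in>B - {m}. (c b \<otimes> u [^] (e b - 1)) \<otimes> u)"
  proof (rule finsum_cong')
    fix b assume b: "b \<in> B - {m}"
    then have "u [^] e b = u [^] (e b - 1) \<otimes> u" using e(2)[of b] nat_pow_Suc[of u "e b - 1"] by simp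
    then show "c b \<otimes> u [^] e b = (c b \<otimes> u [^] (e b - 1)) \<otimes> u" using b cc u by (simp add: m_assoc)
  qed (use cc u in auto)
  also have "\<dots> = a \<otimes> u" unfolding a_def using B cc u by (intro finsum_ldistr[symmetric]) auto
  finally show ?thesis unfolding nonvanishing_def using c B e a cc by auto
qed

text \<open>
  By coprimality, two solutions of the weight equation differ by a multiple of \<open>(-b, a)\<close>.
\<close>

lemma equal_weights:
  fixes a b g :: nat
  assumes g: "0 < g" and ab: "coprime a b" "0 < a"
    and eq: "i * (g * a) + j * (g * b) = i' * (g * a) + j' * (g * b)" and le: "j' \<le> j"
  shows "\<exists>e. j = j' + a * e \<and> i' = i + b * e"
proof -
  define d where "d = j - j'"
  have d: "j = j' + d" unfolding d_def using le by simp
  have "g * (i * a + j * b) = g * (i' * a + j' * b)" using eq by (simp add: algebra_simps)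
  then have "i * a + j * b = i' * a + j' * b" using g by (simp del: distrib_left)
  then have eq: "i * a + d * b = i' * a" using d by (simp add: algebra_simps)
  then have "a dvd d * b" by (metis dvd_add_right_iff dvd_triv_right)
  then have "a dvd d" using ab(1) by (simp add: coprime_dvd_mult_left_iff)
  then obtain e where e: "d = a * e" by blast
  then have "(i + b * e) * a = i' * a" using eq by (simp add: algebra_simps)
  then have "i + b * e = i'" using ab(2) by simp
  then show ?thesis using d e by (intro exI[of _ e]) simp
qed

section \<open>Monomial charts\<close>

text \<open>
  Residue fields change along a sequence of quadratic transforms, but they all lie between \<open>K\<^sub>0\<close>, the
  residue field of the first ring, and \<open>k\<close>, the relative algebraic closure of \<open>K\<^sub>0\<close>. Fixing both
  makes the claims independent of the position in the sequence.
\<close>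

locale residue_closure = residue_valuation L F V \<rho> v + K: relatively_closed_subfield F k
  for L :: "('a, 'b) ring_scheme" (structure) and F :: "('c, 'd) ring_scheme" and V \<rho> v k +
  fixes K\<^sub>0
  assumes algebraic: "\<And>\<tau>. \<tau> \<in> k \<Longrightarrow>
    \<exists>n. \<exists>a \<in> F.poly_values K\<^sub>0 \<tau> n. a \<oplus>\<^bsub>F\<^esub> \<tau> [^]\<^bsub>F\<^esub> n = \<zero>\<^bsub>F\<^esub>"

locale weighted_chart = residue_closure +
  fixes R x y and \<alpha> \<beta> :: nat
  assumes R: "local_at R x y" and Rk: "\<rho> ` R \<subseteq> k" and K0R: "K\<^sub>0 \<subseteq> \<rho> ` R"
    and x0: "x \<noteq> \<zero>" and y0: "y \<noteq> \<zero>" and vx: "v x = int \<alpha>" and vy: "v y = int \<beta>"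
begin

lemma R_sub: "subring R L" and RV: "a \<in> R \<Longrightarrow> a \<in> V" and xR: "x \<in> R" and yR: "y \<in> R"
  and x1: "ge 1 x" and y1: "ge 1 y"
  and R_gen: "r \<in> R \<Longrightarrow> ge 1 r \<Longrightarrow> \<exists>p\<in>R. \<exists>q\<in>R. r = p \<otimes> x \<oplus> q \<otimes> y"
  using R unfolding local_at_def by auto

lemma R_carrier: "a \<in> R \<Longrightarrow> a \<in> carrier L" using RV V_carrier by blast
lemma xc: "x \<in> carrier L" and yc: "y \<in> carrier L" using R_carrier xR yR by auto
lemma R_closed: "\<one> \<in> R" "\<zero> \<in> R" "a \<in> R \<Longrightarrow> b \<in> R \<Longrightarrow> a \<otimes> b \<in> R"
  "a \<in> R \<Longrightarrow> b \<in> R \<Longrightarrow> a \<oplus> b \<in> R" "a \<in> R \<Longrightarrow> \<ominus> a \<in> R"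
  using subringE[OF R_sub] by auto

lemma \<alpha>_pos: "0 < \<alpha>" and \<beta>_pos: "0 < \<beta>"
  using x1 y1 x0 y0 vx vy unfolding ge_def by auto

definition mon :: "nat \<times> nat \<Rightarrow> 'a" where "mon p = x [^] fst p \<otimes> y [^] snd p"
definition wt :: "nat \<times> nat \<Rightarrow> nat" where "wt p = fst p * \<alpha> + snd p * \<beta>"

definition \<alpha>' where "\<alpha>' = \<alpha> div gcd \<alpha> \<beta>"
definition \<beta>' where "\<beta>' = \<beta> div gcd \<alpha> \<beta>"
definition s where "s = y [^] \<alpha>' \<otimes> inv (x [^] \<beta>')"

lemma mon_carrier: "mon p \<in> carrier L" unfolding mon_def using xc yc by simp
lemma mon_nonzero: "mon p \<noteq> \<zero>" unfolding mon_def using xc yc x0 y0 by (simp add: integral_iff)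
lemma v_mon: "v (mon p) = int (wt p)"
  unfolding mon_def wt_def using xc yc x0 y0 by (simp add: v_mult v_pow vx vy)

lemma \<alpha>\<beta>': "\<alpha> = gcd \<alpha> \<beta> * \<alpha>'" "\<beta> = gcd \<alpha> \<beta> * \<beta>'" "coprime \<alpha>' \<beta>'" "0 < \<alpha>'" "0 < \<beta>'"
proof -
  show a: "\<alpha> = gcd \<alpha> \<beta> * \<alpha>'" "\<beta> = gcd \<alpha> \<beta> * \<beta>'" unfolding \<alpha>'_def \<beta>'_def by simp_all
  show "coprime \<alpha>' \<beta>'" unfolding \<alpha>'_def \<beta>'_def using \<alpha>_pos by (intro div_gcd_coprime) simp
  show "0 < \<alpha>'" "0 < \<beta>'" using a \<alpha>_pos \<beta>_pos by (metis mult_0_right neq0_conv)+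
qed

lemma s_props: "s \<in> carrier L" "s \<noteq> \<zero>" "v s = 0" "s \<in> V" "s \<otimes> x [^] \<beta>' = y [^] \<alpha>'"
proof -
  have c: "inv (x [^] \<beta>') \<in> carrier L" "inv (x [^] \<beta>') \<noteq> \<zero>" using xc x0 by simp_all
  show s_residue: "s \<in> carrier L" "s \<noteq> \<zero>" unfolding s_def using c yc y0 by (simp_all add: integral_iff)
  have "v s = int \<alpha>' * int \<beta> - int \<beta>' * int \<alpha>"
    unfolding s_def using c xc x0 yc y0 by (simp add: v_mult v_pow v_inv vx vy)
  also have "\<dots> = 0"
  proof -
    have *: "int a' * int b - int b' * int a = 0" if "a = g * a'" "b = g * b'" for a b g a' b' :: nat
      using that by simp
    show ?thesis by (rule *[OF \<alpha>\<beta>'(1,2)])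
  qed
  finally show "v s = 0" .
  then show "s \<in> V" using V_iff s_residue by simp
  show "s \<otimes> x [^] \<beta>' = y [^] \<alpha>'" unfolding s_def using mult_inv_cancel xc x0 yc by simp
qed

lemma weight_eq:
  assumes "wt p = wt q" "snd q \<le> snd p"
  shows "\<exists>e. snd p = snd q + \<alpha>' * e \<and> fst q = fst p + \<beta>' * e"
proof (rule equal_weights[OF _ \<alpha>\<beta>'(3,4) _ assms(2)])
  show "0 < gcd \<alpha> \<beta>" using \<alpha>_pos by simp
  show "fst p * (gcd \<alpha> \<beta> * \<alpha>') + snd p * (gcd \<alpha> \<beta> * \<beta>')
      = fst q * (gcd \<alpha> \<beta> * \<alpha>') + snd q * (gcd \<alpha> \<beta> * \<beta>')"
    using assms(1) unfolding \<alpha>\<beta>'(1,2)[symmetric] wt_def .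
qed

definition s_exponent :: "nat \<times> nat \<Rightarrow> nat \<times> nat \<Rightarrow> nat" where "s_exponent q p = (snd p - snd q) div \<alpha>'"

text \<open>
  By \<open>equal_weights\<close>, the exponents of two monomials of the same weight differ by a multiple of
  \<open>(-\<beta>', \<alpha>')\<close>, which is the pair of exponents of \<open>s\<close>.
\<close>

lemma monomial_ratio:
  assumes "wt p = wt q" "snd q \<le> snd p"
  shows "mon p = s [^] s_exponent q p \<otimes> mon q" "mon p \<otimes> inv (mon q) = s [^] s_exponent q p"
    "mon q \<otimes> inv (mon p) = inv s [^] s_exponent q p" "p \<noteq> q \<Longrightarrow> 0 < s_exponent q p"
proof -
  obtain e where e: "snd p = snd q + \<alpha>' * e" "fst q = fst p + \<beta>' * e" using weight_eq assms by blast
  have s_exponent: "s_exponent q p = e" unfolding s_exponent_def using e \<alpha>\<beta>' by simp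
  have "mon p = x [^] fst p \<otimes> (y [^] snd q \<otimes> (y [^] \<alpha>') [^] e)"
    unfolding mon_def e(1) using yc by (simp add: nat_pow_mult nat_pow_pow)
  also have "(y [^] \<alpha>') [^] e = s [^] e \<otimes> x [^] (\<beta>' * e)"
    unfolding s_props(5)[symmetric] using s_props(1) xc by (simp add: nat_pow_distrib nat_pow_pow)
  also have "x [^] fst p \<otimes> (y [^] snd q \<otimes> (s [^] e \<otimes> x [^] (\<beta>' * e)))
      = s [^] e \<otimes> ((x [^] fst p \<otimes> x [^] (\<beta>' * e)) \<otimes> y [^] snd q)"
    using xc yc s_props by (simp add: m_ac)
  also have "\<dots> = s [^] e \<otimes> mon q"
    unfolding mon_def e(2) using xc by (simp add: nat_pow_mult)
  finally show m: "mon p = s [^] s_exponent q p \<otimes> mon q" unfolding s_exponent .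
  then show "mon p \<otimes> inv (mon q) = s [^] s_exponent q p"
    using mon_carrier mon_nonzero s_props by (simp add: m_assoc)
  have "mon q = (inv s \<otimes> s) [^] s_exponent q p \<otimes> mon q" using mon_carrier s_props by simp
  also have "\<dots> = inv s [^] s_exponent q p \<otimes> mon p"
    unfolding m using s_props mon_carrier by (simp add: nat_pow_distrib m_assoc del: l_inv')
  finally have "mon q \<otimes> inv (mon p) = (inv s [^] s_exponent q p \<otimes> mon p) \<otimes> inv (mon p)" by simp
  also have "\<dots> = inv s [^] s_exponent q p" using s_props mon_carrier mon_nonzero by (simp add: m_assoc)
  finally show "mon q \<otimes> inv (mon p) = inv s [^] s_exponent q p" .
  show "0 < s_exponent q p" if "p \<noteq> q"
  proof (rule ccontr)
    assume "\<not> 0 < s_exponent q p"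
    then have "snd p = snd q" "fst q = fst p" using e s_exponent by auto
    then show False using that by (simp add: prod_eq_iff)
  qed
qed

subsection \<open>Weighted expansions\<close>

abbreviation expansion where "expansion \<gamma> f c \<equiv> weighted_expansion L R x y \<alpha> \<beta> \<gamma> f c"

lemma xy_sum_superset:
  assumes T: "finite T" "xy_support L c \<subseteq> T" and c: "\<And>p. c p \<in> R"
  shows "xy_sum L x y c = (\<Oplus>p\<in>T. c p \<otimes> mon p)"
proof -
  have "xy_sum L x y c = (\<Oplus>p\<in>xy_support L c. c p \<otimes> mon p)"
    unfolding xy_sum_def using R_carrier[OF c] xc yc mon_carrier
    by (intro finsum_cong') (auto simp: mon_def m_assoc)
  also have "\<dots> = (\<Oplus>p\<in>T. c p \<otimes> mon p)"
    by (rule add.finprod_mono_neutral_cong_left[OF T(1,2)])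
      (use R_carrier[OF c] mon_carrier in \<open>auto simp: xy_support_def\<close>)
  finally show ?thesis .
qed

lemma expansion_iff:
  "expansion \<gamma> f c \<longleftrightarrow> finite (xy_support L c) \<and> (\<forall>p. c p \<in> R) \<and>
     (\<forall>p\<in>xy_support L c. \<gamma> \<le> wt p) \<and> f = (\<Oplus>p\<in>xy_support L c. c p \<otimes> mon p)"
proof -
  have 1: "(\<forall>(a, b)\<in>xy_support L c. \<gamma> \<le> a * \<alpha> + b * \<beta>) \<longleftrightarrow> (\<forall>p\<in>xy_support L c. \<gamma> \<le> wt p)"
    unfolding wt_def by (auto simp: case_prod_beta)
  have 2: "xy_sum L x y c = (\<Oplus>p\<in>xy_support L c. c p \<otimes> mon p)"
    if "finite (xy_support L c)" "\<forall>p. c p \<in> R" using xy_sum_superset that by blast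
  show ?thesis unfolding weighted_expansion_def 1
    by (cases "finite (xy_support L c) \<and> (\<forall>p. c p \<in> R)") (auto simp: 2)
qed

definition expandable :: "nat \<Rightarrow> 'a set" where "expandable \<gamma> = {f. \<exists>c. expansion \<gamma> f c}"

lemma expandable_zero: "\<zero> \<in> expandable \<gamma>"
  unfolding expandable_def expansion_iff using R_closed(2)
  by (intro CollectI exI[of _ "\<lambda>_. \<zero>"]) (simp add: xy_support_def)

lemma expandable_add_monomial:
  assumes f: "f \<in> expandable \<gamma>" and r: "r \<in> R" and q: "\<gamma> \<le> wt q"
  shows "f \<oplus> r \<otimes> mon q \<in> expandable \<gamma>"
proof -
  obtain c where c: "finite (xy_support L c)" "\<And>p. c p \<in> R" "\<And>p. p \<in> xy_support L c \<Longrightarrow> \<gamma> \<le> wt p"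
    "f = (\<Oplus>p\<in>xy_support L c. c p \<otimes> mon p)" using f unfolding expandable_def expansion_iff by blast
  have f': "f = xy_sum L x y c" using xy_sum_superset[OF c(1) order_refl c(2)] c(4) by simp
  define T where "T = xy_support L c - {q}"
  have T: "finite T" "q \<notin> T" "xy_support L c \<subseteq> insert q T" using c(1) unfolding T_def by auto
  define d where "d = c(q := c q \<oplus> r)"
  have dR: "d p \<in> R" for p unfolding d_def using c(2) r R_closed by simp
  have dT: "xy_support L d \<subseteq> insert q T" unfolding d_def T_def xy_support_def by auto
  have cc: "c p \<in> carrier L" "d p \<in> carrier L" for p using R_carrier c(2) dR by auto
  have S: "(\<Oplus>p\<in>T. d p \<otimes> mon p) = (\<Oplus>p\<in>T. c p \<otimes> mon p)"
    using T cc mon_carrier by (intro finsum_cong') (auto simp: d_def)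
  define U where "U = (\<Oplus>p\<in>T. c p \<otimes> mon p)"
  have Uc: "U \<in> carrier L" unfolding U_def using cc mon_carrier by (intro finsum_closed) auto
  have "xy_sum L x y d = (\<Oplus>p\<in>insert q T. d p \<otimes> mon p)"
    using xy_sum_superset[of "insert q T" d] T dT dR by simp
  also have "\<dots> = d q \<otimes> mon q \<oplus> U"
    unfolding U_def S[symmetric] using T cc mon_carrier by (intro finsum_insert) auto
  also have "\<dots> = (c q \<otimes> mon q \<oplus> U) \<oplus> r \<otimes> mon q"
    unfolding d_def using cc(1)[of q] R_carrier[OF r] mon_carrier[of q] Uc by (simp add: l_distr a_ac)
  also have "c q \<otimes> mon q \<oplus> U = (\<Oplus>p\<in>insert q T. c p \<otimes> mon p)"
    unfolding U_def using T cc mon_carrier by (intro finsum_insert[symmetric]) auto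
  also have "\<dots> = f" unfolding f' using xy_sum_superset[of "insert q T" c] T c(2) by simp
  finally have "f \<oplus> r \<otimes> mon q = xy_sum L x y d" ..
  moreover have fd: "finite (xy_support L d)" using dT T finite_subset by blast
  moreover have "\<gamma> \<le> wt p" if "p \<in> xy_support L d" for p
    using that c(3)[of p] q unfolding d_def xy_support_def by (auto split: if_splits)
  ultimately have "expansion \<gamma> (f \<oplus> r \<otimes> mon q) d"
    unfolding expansion_iff using xy_sum_superset[OF fd order_refl dR] dR by auto
  then show ?thesis unfolding expandable_def by blast
qed

lemma expandable_carrier: "f \<in> expandable \<gamma> \<Longrightarrow> f \<in> carrier L"
  unfolding expandable_def expansion_iff using R_carrier mon_carrier by (auto intro!: finsum_closed)

text \<open>
  The leading terms are those of the lowest admissible weight \<open>\<gamma>\<close> with a unit coefficient. Terms of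
  weight \<open>\<gamma>\<close> with a coefficient in the maximal ideal have a value greater than \<open>\<gamma>\<close>.
\<close>

definition lead :: "nat \<Rightarrow> (nat \<times> nat \<Rightarrow> 'a) \<Rightarrow> (nat \<times> nat) set" where
  "lead \<gamma> c = {p. wt p = \<gamma> \<and> \<not> ge 1 (c p)}"

lemma lead_support: "lead \<gamma> c \<subseteq> xy_support L c"
  unfolding lead_def xy_support_def by auto

lemma mon_shift: "x \<otimes> mon p = mon (Suc (fst p), snd p)" "y \<otimes> mon p = mon (fst p, Suc (snd p))"
  unfolding mon_def using xc yc by (simp_all add: m_ac)

text \<open>
  A coefficient in the maximal ideal is a combination of \<open>x\<close> and \<open>y\<close>, so its term can be rewritten
  with monomials of larger weight.
\<close>

lemma expandable_Suc:
  assumes c: "expansion \<gamma> f c" and l: "lead \<gamma> c = {}"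
  shows "f \<in> expandable (Suc \<gamma>)"
proof -
  have c': "finite (xy_support L c)" "\<And>p. c p \<in> R" "\<And>p. p \<in> xy_support L c \<Longrightarrow> \<gamma> \<le> wt p"
    "f = (\<Oplus>p\<in>xy_support L c. c p \<otimes> mon p)" using c unfolding expansion_iff by blast+
  have "(\<Oplus>p\<in>T. c p \<otimes> mon p) \<in> expandable (Suc \<gamma>)" if "finite T" "T \<subseteq> xy_support L c" for T
    using that
  proof (induct T rule: finite_induct)
    case empty then show ?case using expandable_zero by simp
  next
    case (insert p T)
    define S where "S = (\<Oplus>p\<in>T. c p \<otimes> mon p)"
    have S: "S \<in> expandable (Suc \<gamma>)" using insert unfolding S_def by blast
    have Sc: "S \<in> carrier L" using expandable_carrier[OF S] .
    have "(\<Oplus>p\<in>insert p T. c p \<otimes> mon p) = c p \<otimes> mon p \<oplus> S" unfolding S_def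
      using insert R_carrier[OF c'(2)] mon_carrier by (intro finsum_insert) auto
    also have "\<dots> = S \<oplus> c p \<otimes> mon p" using Sc R_carrier[OF c'(2)] mon_carrier by (simp add: a_comm)
    also have "\<dots> \<in> expandable (Suc \<gamma>)"
    proof (cases "wt p = \<gamma>")
      case False
      then show ?thesis using expandable_add_monomial[OF S c'(2)] c'(3)[of p] insert by simp
    next
      case True
      then have "ge 1 (c p)" using l unfolding lead_def by blast
      then obtain a b where ab: "a \<in> R" "b \<in> R" "c p = a \<otimes> x \<oplus> b \<otimes> y" using R_gen c'(2) by blast
      have cc: "a \<in> carrier L" "b \<in> carrier L" using ab R_carrier by auto
      have "S \<oplus> c p \<otimes> mon p = (S \<oplus> a \<otimes> (x \<otimes> mon p)) \<oplus> b \<otimes> (y \<otimes> mon p)"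
        unfolding ab(3) using cc Sc mon_carrier[of p] xc yc by algebra
      moreover have "Suc \<gamma> \<le> wt (Suc (fst p), snd p)" "Suc \<gamma> \<le> wt (fst p, Suc (snd p))"
        using True \<alpha>_pos \<beta>_pos unfolding wt_def by auto
      ultimately show ?thesis unfolding mon_shift
        using expandable_add_monomial[OF expandable_add_monomial[OF S ab(1)] ab(2)] by simp
    qed
    finally show ?case .
  qed
  then show ?thesis using c' by blast
qed

lemma expandable_0: "r \<in> R \<Longrightarrow> r \<in> expandable 0"
proof -
  assume r: "r \<in> R"
  have "mon (0, 0) = \<one>" unfolding mon_def by simp
  then show ?thesis using expandable_add_monomial[OF expandable_zero[of 0] r, of "(0, 0)"] R_carrier[OF r] by simp
qed

text \<open>
  All terms outside the lead have a value greater than \<open>\<gamma>\<close> and vanish in the residue field.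
\<close>

lemma lead_residue:
  assumes c: "expansion \<gamma> f c" and M: "M \<in> carrier L" "M \<noteq> \<zero>" "v M = int \<gamma>"
  shows "f \<otimes> inv M \<in> V"
    "\<rho> (f \<otimes> inv M) = (\<Oplus>\<^bsub>F\<^esub>p\<in>lead \<gamma> c. \<rho> (c p) \<otimes>\<^bsub>F\<^esub> \<rho> (mon p \<otimes> inv M))"
proof -
  have c': "finite (xy_support L c)" "\<And>p. c p \<in> R" "\<And>p. p \<in> xy_support L c \<Longrightarrow> \<gamma> \<le> wt p"
    "f = (\<Oplus>p\<in>xy_support L c. c p \<otimes> mon p)" using c unfolding expansion_iff by blast+
  have iM: "inv M \<in> carrier L" using M by simp
  have cc: "c p \<in> carrier L" for p using R_carrier c'(2) by blast
  define t where "t p = c p \<otimes> (mon p \<otimes> inv M)" for p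
  have mV: "mon p \<otimes> inv M \<in> V" if "\<gamma> \<le> wt p" for p
    using ge_iff_quotient[OF mon_carrier[of p] M(1,2)] v_mon[of p] that M
    by (auto simp: ge_def mon_carrier)
  have tV: "t p \<in> V" if "p \<in> xy_support L c" for p
    unfolding t_def using mV c'(3)[OF that] RV[OF c'(2)] by (simp add: V_mult)
  have eq: "f \<otimes> inv M = (\<Oplus>p\<in>xy_support L c. t p)"
  proof -
    have "f \<otimes> inv M = (\<Oplus>p\<in>xy_support L c. (c p \<otimes> mon p) \<otimes> inv M)"
      unfolding c'(4) using c'(1) iM cc mon_carrier by (intro finsum_ldistr) auto
    also have "\<dots> = (\<Oplus>p\<in>xy_support L c. t p)" unfolding t_def
      using cc mon_carrier iM by (intro finsum_cong') (auto simp: m_assoc)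
    finally show ?thesis .
  qed
  note rs = res_finsum[of "xy_support L c" t, OF c'(1) tV]
  show "f \<otimes> inv M \<in> V" unfolding eq using rs by blast
  have "\<rho> (f \<otimes> inv M) = (\<Oplus>\<^bsub>F\<^esub>p\<in>xy_support L c. \<rho> (t p))" unfolding eq using rs by blast
  also have "\<dots> = (\<Oplus>\<^bsub>F\<^esub>p\<in>lead \<gamma> c. \<rho> (c p) \<otimes>\<^bsub>F\<^esub> \<rho> (mon p \<otimes> inv M))"
  proof (rule F.add.finprod_mono_neutral_cong_right[OF c'(1) lead_support])
    show "\<rho> (t p) = \<zero>\<^bsub>F\<^esub>" if p: "p \<in> xy_support L c - lead \<gamma> c" for p
    proof -
      have "ge 1 (t p)"
      proof (cases "wt p = \<gamma>")
        case True
        then have "ge 1 (c p)" using p unfolding lead_def by blast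
        then have "ge 1 ((mon p \<otimes> inv M) \<otimes> c p)" using ge_mult_V mV True by simp
        then show ?thesis unfolding t_def using cc mon_carrier iM m_comm by simp
      next
        case False
        then have "\<gamma> < wt p" using c'(3)[of p] p by auto
        then have "ge 1 (mon p \<otimes> inv M)" unfolding ge_def
          using mon_carrier iM mon_nonzero v_mult v_inv M v_mon by auto
        then show ?thesis unfolding t_def using ge_mult_V RV[OF c'(2)] by simp
      qed
      then show "\<rho> (t p) = \<zero>\<^bsub>F\<^esub>" using res_eq_zero ge1_V by blast
    qed
    show "\<rho> (t p) = \<rho> (c p) \<otimes>\<^bsub>F\<^esub> \<rho> (mon p \<otimes> inv M)" if "p \<in> lead \<gamma> c" for p
      unfolding t_def using res_mult RV[OF c'(2)] mV that unfolding lead_def by simp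
    show "(\<lambda>p. \<rho> (t p)) \<in> xy_support L c \<rightarrow> carrier F" using tV res_closed by auto
  qed
  finally show "\<rho> (f \<otimes> inv M) = (\<Oplus>\<^bsub>F\<^esub>p\<in>lead \<gamma> c. \<rho> (c p) \<otimes>\<^bsub>F\<^esub> \<rho> (mon p \<otimes> inv M))" .
qed

lemma lead_coeff:
  assumes c: "expansion \<gamma> f c" and p: "p \<in> lead \<gamma> c"
  shows "\<rho> (c p) \<in> k" "\<rho> (c p) \<noteq> \<zero>\<^bsub>F\<^esub>" "wt p = \<gamma>" "v (mon p) = int \<gamma>"
proof -
  have cR: "c p \<in> R" using c unfolding expansion_iff by blast
  show "\<rho> (c p) \<in> k" using cR Rk by blast
  show "\<rho> (c p) \<noteq> \<zero>\<^bsub>F\<^esub>" using res_eq_zero[OF RV[OF cR]] p unfolding lead_def by blast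
  show "wt p = \<gamma>" "v (mon p) = int \<gamma>" using p v_mon unfolding lead_def by auto
qed

lemma lead_finite: "expansion \<gamma> f c \<Longrightarrow> finite (lead \<gamma> c)"
  using lead_support finite_subset unfolding expansion_iff by metis

lemma lead_snd_inj: "inj_on snd (lead \<gamma> c)"
proof (rule inj_onI)
  fix p q assume "p \<in> lead \<gamma> c" "q \<in> lead \<gamma> c" "snd p = snd q"
  then have "wt p = wt q" "snd p = snd q" unfolding lead_def by auto
  then show "p = q" using \<alpha>_pos unfolding wt_def by (simp add: prod_eq_iff)
qed

lemma lead_nonempty:
  assumes c: "expansion \<gamma> f c" and f: "f \<noteq> \<zero>" "v f = int \<gamma>"
  shows "lead \<gamma> c \<noteq> {}"
proof
  assume "lead \<gamma> c = {}"
  moreover have fc: "f \<in> carrier L" using expandable_carrier c unfolding expandable_def by blast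
  ultimately have "\<rho> (f \<otimes> inv f) = \<zero>\<^bsub>F\<^esub>" using lead_residue[OF c fc f] by simp
  then show False using fc f F.one_not_zero by simp
qed

lemma s_residue: "inv s \<in> V" "\<rho> s \<in> carrier F" "\<rho> (inv s) \<in> carrier F" "\<rho> (inv s) = inv\<^bsub>F\<^esub> \<rho> s"
  using res_inv[OF s_props(4,2,3)] s_props res_closed[of s] res_closed[of "inv s"] by auto

text \<open>
  A monomial whose exponent of \<open>y\<close> is at most that of every leading term gives a polynomial in the
  residue of \<open>s\<close>; a monomial on the other side gives a polynomial in the residue of \<open>inv s\<close>. Taking
  for this monomial the lowest or the highest leading term makes the constant term nonzero.
\<close>

lemma residue_below:
  assumes c: "expansion \<gamma> f c" and q: "wt q = \<gamma>" and le: "\<And>p. p \<in> lead \<gamma> c \<Longrightarrow> snd q \<le> snd p"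
  shows "f \<otimes> inv (mon q) \<in> V"
    "\<rho> (f \<otimes> inv (mon q)) = (\<Oplus>\<^bsub>F\<^esub>p\<in>lead \<gamma> c. \<rho> (c p) \<otimes>\<^bsub>F\<^esub> \<rho> s [^]\<^bsub>F\<^esub> s_exponent q p)"
proof -
  have vq: "v (mon q) = int \<gamma>" using v_mon q by simp
  show "f \<otimes> inv (mon q) \<in> V" using lead_residue(1)[OF c mon_carrier mon_nonzero vq] .
  have "\<rho> (mon p \<otimes> inv (mon q)) = \<rho> s [^]\<^bsub>F\<^esub> s_exponent q p" if "p \<in> lead \<gamma> c" for p
    using monomial_ratio(2)[of p q] le[OF that] lead_coeff(3)[OF c that] q res_pow s_props by simp
  then show "\<rho> (f \<otimes> inv (mon q)) = (\<Oplus>\<^bsub>F\<^esub>p\<in>lead \<gamma> c. \<rho> (c p) \<otimes>\<^bsub>F\<^esub> \<rho> s [^]\<^bsub>F\<^esub> s_exponent q p)"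
    unfolding lead_residue(2)[OF c mon_carrier mon_nonzero vq]
    using lead_coeff(1)[OF c] K.k_carrier s_residue by (intro F.finsum_cong') auto
qed

lemma residue_above:
  assumes c: "expansion \<gamma> f c" and q: "wt q = \<gamma>" and le: "\<And>p. p \<in> lead \<gamma> c \<Longrightarrow> snd p \<le> snd q"
  shows "\<rho> (f \<otimes> inv (mon q)) = (\<Oplus>\<^bsub>F\<^esub>p\<in>lead \<gamma> c. \<rho> (c p) \<otimes>\<^bsub>F\<^esub> \<rho> (inv s) [^]\<^bsub>F\<^esub> s_exponent p q)"
proof -
  have vq: "v (mon q) = int \<gamma>" using v_mon q by simp
  have "\<rho> (mon p \<otimes> inv (mon q)) = \<rho> (inv s) [^]\<^bsub>F\<^esub> s_exponent p q" if "p \<in> lead \<gamma> c" for p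
    using monomial_ratio(3)[of q p] le[OF that] lead_coeff(3)[OF c that] q res_pow s_residue by simp
  then show "\<rho> (f \<otimes> inv (mon q)) = (\<Oplus>\<^bsub>F\<^esub>p\<in>lead \<gamma> c. \<rho> (c p) \<otimes>\<^bsub>F\<^esub> \<rho> (inv s) [^]\<^bsub>F\<^esub> s_exponent p q)"
    unfolding lead_residue(2)[OF c mon_carrier mon_nonzero vq]
    using lead_coeff(1)[OF c] K.k_carrier s_residue by (intro F.finsum_cong') auto
qed

lemma residue_lowest:
  assumes c: "expansion \<gamma> f c" and q: "q \<in> lead \<gamma> c" and le: "\<And>p. p \<in> lead \<gamma> c \<Longrightarrow> snd q \<le> snd p"
  shows "\<rho> (f \<otimes> inv (mon q)) \<in> K.nonvanishing (\<rho> s)"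
proof -
  have eq: "\<rho> (f \<otimes> inv (mon q)) = (\<Oplus>\<^bsub>F\<^esub>p\<in>lead \<gamma> c. \<rho> (c p) \<otimes>\<^bsub>F\<^esub> \<rho> s [^]\<^bsub>F\<^esub> s_exponent q p)"
    using residue_below(2)[OF c lead_coeff(3)[OF c q]] le by blast
  show ?thesis unfolding eq
  proof (rule K.finsum_nonvanishing[where c = "\<lambda>p. \<rho> (c p)" and e = "\<lambda>p. s_exponent q p", OF s_residue(2) lead_finite[OF c] q lead_coeff(1)[OF c] lead_coeff(2)[OF c q]])
    show "s_exponent q q = 0" unfolding s_exponent_def by simp
    show "0 < s_exponent q p" if "p \<in> lead \<gamma> c" "p \<noteq> q" for p
      using monomial_ratio(4)[of p q] le lead_coeff(3)[OF c] that q by simp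
  qed
qed

lemma residue_highest:
  assumes c: "expansion \<gamma> f c" and q: "q \<in> lead \<gamma> c" and le: "\<And>p. p \<in> lead \<gamma> c \<Longrightarrow> snd p \<le> snd q"
  shows "\<rho> (f \<otimes> inv (mon q)) \<in> K.nonvanishing (\<rho> (inv s))"
proof -
  have eq: "\<rho> (f \<otimes> inv (mon q)) = (\<Oplus>\<^bsub>F\<^esub>p\<in>lead \<gamma> c. \<rho> (c p) \<otimes>\<^bsub>F\<^esub> \<rho> (inv s) [^]\<^bsub>F\<^esub> s_exponent p q)"
    using residue_above[OF c lead_coeff(3)[OF c q]] le by blast
  show ?thesis unfolding eq
  proof (rule K.finsum_nonvanishing[where c = "\<lambda>p. \<rho> (c p)" and e = "\<lambda>p. s_exponent p q", OF s_residue(3) lead_finite[OF c] q lead_coeff(1)[OF c] lead_coeff(2)[OF c q]])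
    show "s_exponent q q = 0" unfolding s_exponent_def by simp
    show "0 < s_exponent p q" if "p \<in> lead \<gamma> c" "p \<noteq> q" for p
      using monomial_ratio(4)[of q p] le lead_coeff(3)[OF c] that q by auto
  qed
qed

text \<open>
  A polynomial over the residue field is lifted coefficientwise; zero is chosen as the lift of zero, so
  that the lifted coefficients are zero or units.
\<close>

lemma lift_poly_value:
  assumes "a' \<in> F.poly_values K\<^sub>0 (\<rho> s) n"
  shows "\<exists>r :: nat \<Rightarrow> 'a. (\<forall>i. r i \<in> R \<and> (r i = \<zero> \<or> \<not> ge 1 (r i))) \<and> \<rho> (\<Oplus>i\<in>{..<n}. r i \<otimes> s [^] i) = a'"
  using assms
proof (induct n arbitrary: a')
  case 0
  then show ?case using R_closed(2) by (intro exI[of _ "\<lambda>_. \<zero>"]) simp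
next
  case (Suc n)
  obtain b' \<kappa> where b': "b' \<in> F.poly_values K\<^sub>0 (\<rho> s) n" "\<kappa> \<in> K\<^sub>0" "a' = b' \<oplus>\<^bsub>F\<^esub> \<kappa> \<otimes>\<^bsub>F\<^esub> \<rho> s [^]\<^bsub>F\<^esub> n"
    using Suc(2) by auto
  obtain r where "(\<forall>i. r i \<in> R \<and> (r i = \<zero> \<or> \<not> ge 1 (r i))) \<and> \<rho> (\<Oplus>i\<in>{..<n}. r i \<otimes> s [^] i) = b'"
    using Suc(1)[OF b'(1)] by (elim exE)
  then have r: "\<And>i. r i \<in> R" "\<And>i. r i = \<zero> \<or> \<not> ge 1 (r i)" "\<rho> (\<Oplus>i\<in>{..<n}. r i \<otimes> s [^] i) = b'"
    by auto
  obtain l where l: "l \<in> R" "\<rho> l = \<kappa>" using b'(2) K0R by blast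
  define m where "m = (if ge 1 l then \<zero> else l)"
  have m: "m \<in> R" "m = \<zero> \<or> \<not> ge 1 m" "\<rho> m = \<kappa>"
    using l R_closed(2) res_eq_zero[OF RV[OF l(1)]] unfolding m_def by auto
  define r' where "r' = r(n := m)"
  have r'c: "r' i \<in> carrier L" "r i \<in> carrier L" for i unfolding r'_def using r m R_carrier by auto
  have tV: "r i \<otimes> s [^] (i::nat) \<in> V" for i using RV r(1) s_props V_pow V_mult by blast
  have SV: "(\<Oplus>i\<in>{..<n}. r i \<otimes> s [^] i) \<in> V" using res_finsum[of "{..<n}" "\<lambda>i. r i \<otimes> s [^] i"] tV by blast
  have "(\<Oplus>i\<in>{..<Suc n}. r' i \<otimes> s [^] i) = r' n \<otimes> s [^] n \<oplus> (\<Oplus>i\<in>{..<n}. r' i \<otimes> s [^] i)"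
    unfolding lessThan_Suc using r'c s_props by (intro finsum_insert) auto
  also have "(\<Oplus>i\<in>{..<n}. r' i \<otimes> s [^] i) = (\<Oplus>i\<in>{..<n}. r i \<otimes> s [^] i)"
    using r'c s_props by (intro finsum_cong') (auto simp: r'_def)
  also have "r' n = m" unfolding r'_def by simp
  finally have "\<rho> (\<Oplus>i\<in>{..<Suc n}. r' i \<otimes> s [^] i) = \<kappa> \<otimes>\<^bsub>F\<^esub> \<rho> s [^]\<^bsub>F\<^esub> n \<oplus>\<^bsub>F\<^esub> b'"
    using SV m RV[OF m(1)] s_props r(3) by (simp add: res_add res_mult res_pow V_mult V_pow)
  also have "\<dots> = a'" unfolding b'(3) using res_closed[OF SV] r(3) l(2) res_closed[OF RV[OF l(1)]] s_residue
    by (auto intro: F.a_comm)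
  finally show ?case unfolding r'_def using r m by (intro exI[of _ "r(n := m)"]) (auto simp: r'_def)
qed

text \<open>
  Suppose that the residue of \<open>s\<close> satisfies a monic relation of degree \<open>n\<close>. Lift its coefficients to
  \<open>R\<close> and multiply by the power of \<open>x\<close> that clears the denominators. This is a combination of
  monomials of the same weight with zero or unit coefficients, and its value exceeds that weight.
\<close>

lemma monomial_imp_transcendental:
  assumes H: "\<And>c. finite (xy_support L c) \<Longrightarrow> xy_support L c \<noteq> {} \<Longrightarrow>
      (\<And>p. c p = \<zero> \<or> c p \<in> R \<and> \<not> ge 1 (c p)) \<Longrightarrow>
      xy_sum L x y c \<noteq> \<zero> \<and> v (xy_sum L x y c) = Min ((\<lambda>p. int (wt p)) ` xy_support L c)"
  shows "\<rho> s \<notin> k"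
proof
  assume "\<rho> s \<in> k"
  then obtain n a' where a': "a' \<in> F.poly_values K\<^sub>0 (\<rho> s) n" "a' \<oplus>\<^bsub>F\<^esub> \<rho> s [^]\<^bsub>F\<^esub> n = \<zero>\<^bsub>F\<^esub>"
    using algebraic by blast
  obtain r0 where "(\<forall>i. r0 i \<in> R \<and> (r0 i = \<zero> \<or> \<not> ge 1 (r0 i))) \<and> \<rho> (\<Oplus>i\<in>{..<n}. r0 i \<otimes> s [^] i) = a'"
    using lift_poly_value[OF a'(1)] by (elim exE)
  then have r0: "\<And>i. r0 i \<in> R" "\<And>i. r0 i = \<zero> \<or> \<not> ge 1 (r0 i)" "\<rho> (\<Oplus>i\<in>{..<n}. r0 i \<otimes> s [^] i) = a'"
    by auto
  \<comment> \<open>the coefficients of the lifted monic polynomial\<close>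
  define r where "r = r0(n := \<one>)"
  have r: "r i \<in> R" "r i = \<zero> \<or> \<not> ge 1 (r i)" "r n = \<one>" for i
    unfolding r_def using r0 R_closed(1) not_ge1[OF V_one] by auto
  have rc: "r i \<in> carrier L" "r0 i \<in> carrier L" for i using r r0 R_carrier by auto
  define h where "h = (\<Oplus>i\<in>{..<n}. r0 i \<otimes> s [^] i)"
  have hV: "h \<in> V" unfolding h_def
    using res_finsum[of "{..<n}" "\<lambda>i. r0 i \<otimes> s [^] i"] RV r0(1) s_props V_pow V_mult by blast
  define g where "g = (\<Oplus>i\<in>{..n}. r i \<otimes> s [^] i)"
  have "g = r n \<otimes> s [^] n \<oplus> (\<Oplus>i\<in>{..<n}. r i \<otimes> s [^] i)"
    unfolding g_def lessThan_Suc_atMost[symmetric] lessThan_Suc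
    using rc s_props by (intro finsum_insert) auto
  also have "(\<Oplus>i\<in>{..<n}. r i \<otimes> s [^] i) = h" unfolding h_def
    using rc s_props by (intro finsum_cong') (auto simp: r_def)
  finally have g: "g = s [^] n \<oplus> h" using r(3) s_props by simp
  have gV: "g \<in> V" unfolding g using hV s_props V_pow V_add by blast
  have "\<rho> g = \<rho> s [^]\<^bsub>F\<^esub> n \<oplus>\<^bsub>F\<^esub> a'"
    unfolding g using hV s_props r0(3) h_def by (simp add: res_add res_pow V_pow)
  also have "\<dots> = \<zero>\<^bsub>F\<^esub>" using a'(2) r0(3) h_def res_closed[OF hV] s_residue by (metis F.a_comm F.nat_pow_closed)
  finally have g1: "ge 1 g" using res_eq_zero[OF gV] by blast
  \<comment> \<open>the exponents of \<open>x^(\<beta>' n) s^i\<close>, which all have the same weight\<close>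
  define pt where "pt i = (\<beta>' * (n - i), \<alpha>' * i)" for i
  have wpt: "wt (pt i) = wt (pt 0)" if "i \<le> n" for i
  proof -
    have *: "b * (n - i) * A + a * i * B = b * n * A" if "A = G * a" "B = G * b" for A B G a b :: nat
      using that \<open>i \<le> n\<close> by (simp add: algebra_simps diff_mult_distrib2)
    show ?thesis unfolding wt_def pt_def using *[OF \<alpha>\<beta>'(1,2)] by simp
  qed
  have mpt: "mon (pt i) = s [^] i \<otimes> mon (pt 0)" if "i \<le> n" for i
  proof -
    have "s_exponent (pt 0) (pt i) = i" unfolding s_exponent_def pt_def using \<alpha>\<beta>'(4) by simp
    then show ?thesis using monomial_ratio(1)[OF wpt[OF that]] by (simp add: pt_def)
  qed
  define c where "c p = (if p \<in> pt ` {..n} then r (snd p div \<alpha>') else \<zero>)" for p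
  have cpt: "c (pt i) = r i" if "i \<le> n" for i
    unfolding c_def using that \<alpha>\<beta>'(4) by (auto simp: pt_def)
  have cR: "c p \<in> R" for p unfolding c_def using r R_closed(2) by auto
  have supp: "xy_support L c \<subseteq> pt ` {..n}" unfolding xy_support_def c_def by auto
  have ptn: "pt n \<in> xy_support L c" unfolding xy_support_def using cpt[of n] r(3) by simp
  have inj: "inj_on pt {..n}" using \<alpha>\<beta>'(4) by (auto simp: inj_on_def pt_def)
  have fin: "finite (xy_support L c)" using supp finite_subset by blast
  have "xy_sum L x y c = (\<Oplus>p\<in>pt ` {..n}. c p \<otimes> mon p)" using xy_sum_superset[OF _ supp cR] by simp
  also have "\<dots> = (\<Oplus>i\<in>{..n}. c (pt i) \<otimes> mon (pt i))"
    using R_carrier[OF cR] mon_carrier by (intro finsum_reindex[OF _ inj]) auto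
  also have "\<dots> = (\<Oplus>i\<in>{..n}. (r i \<otimes> s [^] i) \<otimes> mon (pt 0))"
  proof (rule finsum_cong')
    fix i assume "i \<in> {..n}"
    then have i: "i \<le> n" by simp
    show "c (pt i) \<otimes> mon (pt i) = (r i \<otimes> s [^] i) \<otimes> mon (pt 0)"
      unfolding cpt[OF i] mpt[OF i] using rc s_props mon_carrier by (simp add: m_assoc)
  qed (use rc s_props mon_carrier in auto)
  also have "\<dots> = g \<otimes> mon (pt 0)" unfolding g_def
    using rc s_props mon_carrier by (intro finsum_ldistr[symmetric]) auto
  finally have f: "xy_sum L x y c = g \<otimes> mon (pt 0)" .
  have H': "xy_sum L x y c \<noteq> \<zero> \<and> v (xy_sum L x y c) = Min ((\<lambda>p. int (wt p)) ` xy_support L c)"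
    by (rule H[OF fin]) (use ptn r R_closed(2) in \<open>auto simp: c_def\<close>)
  have "(\<lambda>p. int (wt p)) ` xy_support L c = {int (wt (pt 0))}"
  proof
    show "(\<lambda>p. int (wt p)) ` xy_support L c \<subseteq> {int (wt (pt 0))}"
    proof
      fix w assume "w \<in> (\<lambda>p. int (wt p)) ` xy_support L c"
      then obtain i where i: "i \<le> n" "w = int (wt (pt i))" using supp by blast
      show "w \<in> {int (wt (pt 0))}" unfolding i(2) wpt[OF i(1)] by simp
    qed
    show "{int (wt (pt 0))} \<subseteq> (\<lambda>p. int (wt p)) ` xy_support L c"
      using ptn wpt[OF order_refl] by (metis empty_subsetI image_eqI insert_subset)
  qed
  then have "v (g \<otimes> mon (pt 0)) = int (wt (pt 0))" using H' f by simp
  moreover have g0: "g \<noteq> \<zero>" using H' f mon_carrier[of "pt 0"] by auto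
  moreover have "v (g \<otimes> mon (pt 0)) = v g + int (wt (pt 0))"
    using v_mult[OF ge_carrier[OF g1] g0 mon_carrier mon_nonzero] v_mon by simp
  ultimately show False using g1 unfolding ge_def by simp
qed

end

locale transcendental_chart = weighted_chart +
  assumes s_notin: "\<rho> s \<notin> k"
begin

text \<open>
  After division by its lowest leading monomial, \<open>f\<close> has a residue with nonzero constant term, which
  is not zero because the residue of \<open>s\<close> is transcendental.
\<close>

lemma value_of_lead:
  assumes c: "expansion \<gamma> f c" and l: "lead \<gamma> c \<noteq> {}"
  shows "f \<noteq> \<zero>" "v f = int \<gamma>"
proof -
  obtain q where q: "q \<in> lead \<gamma> c" "\<And>p. p \<in> lead \<gamma> c \<Longrightarrow> snd q \<le> snd p"
    using l arg_min_nat_lemma[of "\<lambda>p. p \<in> lead \<gamma> c" _ snd] by blast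
  have fV: "f \<otimes> inv (mon q) \<in> V" using residue_below(1)[OF c lead_coeff(3)[OF c q(1)] q(2)] .
  have fc: "f \<in> carrier L" using expandable_carrier c unfolding expandable_def by blast
  have "\<rho> (f \<otimes> inv (mon q)) \<noteq> \<zero>\<^bsub>F\<^esub>"
    using K.nonvanishing_nonzero[OF s_residue(2) s_notin residue_lowest[OF c q]] by blast
  then have *: "f \<otimes> inv (mon q) \<noteq> \<zero>" "v (f \<otimes> inv (mon q)) = 0" using res_nonzero[OF fV] by auto
  have im: "inv (mon q) \<in> carrier L" using mon_carrier mon_nonzero by simp
  then show f0: "f \<noteq> \<zero>" using *(1) by auto
  show "v f = int \<gamma>" using *(2) v_mult[OF fc f0] v_inv mon_carrier[of q] mon_nonzero[of q] lead_coeff(4)[OF c q(1)]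
    by simp
qed

text \<open>
  The valuation ideals of \<open>R\<close> are generated by monomials. In the induction step, an expansion of
  weight \<open>n\<close> of an element of value greater than \<open>n\<close> has no leading terms, by \<open>value_of_lead\<close>, and
  can be improved by \<open>expandable_Suc\<close>.
\<close>

lemma ge_expandable: "f \<in> R \<Longrightarrow> ge (int n) f \<Longrightarrow> f \<in> expandable n"
proof (induct n)
  case 0 then show ?case using expandable_0 by blast
next
  case (Suc n)
  then have "f \<in> expandable n" using ge_mono[of "int (Suc n)" f "int n"] by simp
  then obtain c where c: "expansion n f c" unfolding expandable_def by blast
  have "lead n c = {}"
  proof (rule ccontr)
    assume "lead n c \<noteq> {}"
    then have "f \<noteq> \<zero>" "v f = int n" using value_of_lead[OF c] by auto
    then show False using Suc(3) unfolding ge_def by simp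
  qed
  then show ?case using expandable_Suc c by blast
qed

lemma transcendental_imp_monomial:
  assumes fin: "finite (xy_support L c)" and ne: "xy_support L c \<noteq> {}"
    and c: "\<And>p. c p = \<zero> \<or> c p \<in> R \<and> \<not> ge 1 (c p)"
  shows "xy_sum L x y c \<noteq> \<zero> \<and> v (xy_sum L x y c) = Min ((\<lambda>p. int (wt p)) ` xy_support L c)"
proof -
  define \<gamma> where "\<gamma> = Min (wt ` xy_support L c)"
  have cR: "c p \<in> R" for p using c R_closed(2) by metis
  have e: "expansion \<gamma> (xy_sum L x y c) c"
    unfolding expansion_iff using fin cR xy_sum_superset[OF fin order_refl cR] by (simp add: \<gamma>_def)
  have "\<gamma> \<in> wt ` xy_support L c" unfolding \<gamma>_def using fin ne by (intro Min_in) auto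
  then have "lead \<gamma> c \<noteq> {}" unfolding lead_def using c by (auto simp: xy_support_def)
  moreover have "Min ((\<lambda>p. int (wt p)) ` xy_support L c) = int \<gamma>"
    unfolding \<gamma>_def using mono_Min_commute[of int "wt ` xy_support L c"] fin ne
    by (simp add: mono_def image_image)
  ultimately show ?thesis using value_of_lead[OF e] by simp
qed

lemma inv_s_notin: "\<rho> (inv s) \<notin> k"
  using K.inv_notin[OF s_residue(2) s_notin] s_residue(4) by simp

lemma residue_generated:
  assumes c: "expansion \<gamma> f c" and q: "wt q = \<gamma>"
  shows "\<rho> (f \<otimes> inv (mon q)) \<in> generate_field F (insert (\<rho> s) k)"
proof -
  have vq: "v (mon q) = int \<gamma>" using v_mon q by simp
  let ?G = "generate_field F (insert (\<rho> s) k)"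
  have sub: "subfield ?G F" using F.generate_field_is_subfield s_residue K.k_carrier by blast
  have in_G: "k \<subseteq> ?G" "\<rho> s \<in> ?G" by (auto intro: generate_field.incl)
  have iG: "\<rho> (inv s) \<in> ?G" unfolding s_residue(4)
    using in_G K.inv_notin[OF s_residue(2) s_notin] by (intro generate_field.m_inv) auto
  have pow: "a [^]\<^bsub>F\<^esub> (n::nat) \<in> ?G" if "a \<in> ?G" for a n
    by (induct n) (auto intro: generate_field.one generate_field.eng_mult that)
  have r: "\<rho> (mon p \<otimes> inv (mon q)) \<in> ?G" if p: "p \<in> lead \<gamma> c" for p
  proof (cases "snd q \<le> snd p")
    case True
    then show ?thesis using monomial_ratio(2)[of p q] lead_coeff(3)[OF c p] q res_pow s_props pow in_G by simp
  next
    case False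
    then show ?thesis using monomial_ratio(3)[of q p] lead_coeff(3)[OF c p] q res_pow s_residue(1) pow iG by simp
  qed
  show ?thesis unfolding lead_residue(2)[OF c mon_carrier mon_nonzero vq]
    by (rule F.finsum_in_subring[OF subfieldE(1)[OF sub] lead_finite[OF c]])
      (use r lead_coeff(1)[OF c] in_G in \<open>blast intro: generate_field.eng_mult\<close>)
qed

text \<open>
  A unit of \<open>V\<close> is a quotient of two elements of \<open>R\<close> of the same value. Dividing both by one
  monomial of that value turns their residues into Laurent polynomials in the residue of \<open>s\<close>.
\<close>

lemma residue_field_generated:
  assumes Q: "\<And>w. w \<in> carrier L \<Longrightarrow> \<exists>a\<in>R. \<exists>b\<in>R - {\<zero>}. w = a \<otimes> inv b"
  shows "generate_field F (insert (\<rho> s) k) = carrier F" "generate_field F (insert (\<rho> (inv s)) k) = carrier F"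
proof -
  let ?G = "generate_field F (insert (\<rho> s) k)" and ?H = "generate_field F (insert (\<rho> (inv s)) k)"
  have i: "insert (\<rho> s) k \<subseteq> carrier F" using s_residue K.k_carrier by auto
  have sub: "subfield ?G F" using F.generate_field_is_subfield[OF i] .
  have "\<tau> \<in> ?G" if "\<tau> \<in> carrier F" for \<tau>
  proof (cases "\<tau> = \<zero>\<^bsub>F\<^esub>")
    case True then show ?thesis using F.zero_in_generate by simp
  next
    case False
    obtain w where w: "w \<in> V" "\<tau> = \<rho> w" using \<open>\<tau> \<in> carrier F\<close> \<rho>_surj by auto
    have w0: "w \<noteq> \<zero>" "v w = 0" using res_nonzero[OF w(1)] False w(2) by auto
    obtain f g where fg: "f \<in> R" "g \<in> R" "g \<noteq> \<zero>" "w = f \<otimes> inv g" using Q[OF V_carrier[OF w(1)]] by blast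
    have cc: "f \<in> carrier L" "g \<in> carrier L" using fg R_carrier by auto
    have wg: "w \<otimes> g = f" unfolding fg(4) using mult_inv_cancel cc fg by simp
    have f0: "f \<noteq> \<zero>" using wg w0 fg cc V_carrier[OF w(1)] by (auto simp: integral_iff)
    have vf: "v f = v g" using v_mult[of w g] wg w0 fg cc V_carrier[OF w(1)] by simp
    define \<gamma> where "\<gamma> = nat (v g)"
    have \<gamma>: "v g = int \<gamma>" "v f = int \<gamma>" using V_iff[OF cc(2) fg(3)] RV[OF fg(2)] vf unfolding \<gamma>_def by auto
    obtain c where c: "expansion \<gamma> f c"
      using ge_expandable[OF fg(1), of \<gamma>] ge_self[OF cc(1)] \<gamma> unfolding expandable_def by auto
    obtain d where d: "expansion \<gamma> g d"
      using ge_expandable[OF fg(2), of \<gamma>] ge_self[OF cc(2)] \<gamma> unfolding expandable_def by auto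
    obtain q where q: "q \<in> lead \<gamma> d" using lead_nonempty[OF d fg(3) \<gamma>(1)] by blast
    note wq = lead_coeff(3,4)[OF d q]
    have 1: "\<rho> (f \<otimes> inv (mon q)) \<in> ?G" "\<rho> (g \<otimes> inv (mon q)) \<in> ?G"
      using residue_generated[OF c wq(1)] residue_generated[OF d wq(1)] by auto
    have im: "inv (mon q) \<in> carrier L" "inv (mon q) \<noteq> \<zero>" using mon_carrier mon_nonzero by auto
    have gV: "g \<otimes> inv (mon q) \<in> V" using lead_residue(1)[OF d mon_carrier mon_nonzero wq(2)] .
    have "f \<otimes> inv (mon q) = (g \<otimes> inv (mon q)) \<otimes> w"
      unfolding wg[symmetric] using cc im V_carrier[OF w(1)] by (simp add: m_ac)
    then have 2: "\<rho> (f \<otimes> inv (mon q)) = \<rho> (g \<otimes> inv (mon q)) \<otimes>\<^bsub>F\<^esub> \<tau>" using res_mult[OF gV w(1)] w(2) by simp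
    have "v (g \<otimes> inv (mon q)) = 0" "g \<otimes> inv (mon q) \<noteq> \<zero>"
      using v_mult[of g] im cc fg \<gamma> v_inv mon_carrier mon_nonzero wq by (auto simp: integral_iff)
    then have "\<rho> (g \<otimes> inv (mon q)) \<noteq> \<zero>\<^bsub>F\<^esub>" using res_nonzero[OF gV] by blast
    then show ?thesis
      using F.subfield_m_inv_simprule[OF sub, of "\<rho> (g \<otimes> inv (mon q))" \<tau>] 1 2 that by auto
  qed
  then show "?G = carrier F" using F.generate_field_incl[OF i] by blast
  then show "?H = carrier F" using K.generate_inverse[OF s_residue(2) s_notin] s_residue(4) by simp
qed

end

section \<open>Residues in the monomial case\<close>

text \<open>
  The property to be proved, with \<open>t \<notin> k\<close> in place of transcendence and the polynomial ring \<open>k[t]\<close>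
  in place of the evaluation of polynomials.
\<close>

definition (in residue_closure) polynomial_residue :: "'c \<Rightarrow> bool" where
  "polynomial_residue \<zeta> \<longleftrightarrow> (\<exists>t\<in>carrier F. t \<notin> k \<and> generate_field F (insert t k) = carrier F \<and>
     \<zeta> \<in> F.simple_extension k t)"

context transcendental_chart
begin

context
  fixes z q f c
  assumes Q: "\<And>w. w \<in> carrier L \<Longrightarrow> \<exists>a\<in>R. \<exists>b\<in>R - {\<zero>}. w = a \<otimes> inv b"
    and z: "z \<in> V" "\<rho> z \<notin> k" and f: "f = z \<otimes> mon q"
    and c: "expansion (wt q) f c"
begin

lemma z_unit: "z \<in> carrier L" "z \<noteq> \<zero>" "v z = 0"
  using z V_carrier K.k_closed(2) res_nonzero[OF z(1)] by auto

lemma v_f: "f \<noteq> \<zero>" "v f = int (wt q)" "f \<in> carrier L"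
  unfolding f using z_unit mon_carrier[of q] mon_nonzero[of q] v_mon by (auto simp: v_mult integral_iff)

lemma lead_ne: "lead (wt q) c \<noteq> {}"
  using lead_nonempty[OF c v_f(1,2)] .

lemma z_quotient: "z = f \<otimes> inv (mon q)"
  unfolding f using z_unit mon_carrier[of q] mon_nonzero[of q] by (simp add: m_assoc)

theorem polynomial_residue_one_sided:
  assumes "(\<forall>p\<in>lead (wt q) c. snd q \<le> snd p) \<or> (\<forall>p\<in>lead (wt q) c. snd p \<le> snd q)"
  shows "polynomial_residue (\<rho> z)"
proof -
  have sums: "(\<Oplus>\<^bsub>F\<^esub>p\<in>lead (wt q) c. \<rho> (c p) \<otimes>\<^bsub>F\<^esub> \<sigma> [^]\<^bsub>F\<^esub> (e p :: nat)) \<in> F.simple_extension k \<sigma>"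
    if "\<sigma> \<in> carrier F" for \<sigma> and e :: "nat \<times> nat \<Rightarrow> nat"
  proof (rule F.finsum_in_subring[OF K.P_sub[OF that] lead_finite[OF c]])
    fix p assume p: "p \<in> lead (wt q) c"
    show "\<rho> (c p) \<otimes>\<^bsub>F\<^esub> \<sigma> [^]\<^bsub>F\<^esub> e p \<in> F.simple_extension k \<sigma>"
      using K.P_closed(3)[OF that K.P_closed(7)[OF that lead_coeff(1)[OF c p]] K.P_pow[OF that K.P_closed(6)[OF that]]] .
  qed
  from assms show ?thesis
  proof
    assume le: "\<forall>p\<in>lead (wt q) c. snd q \<le> snd p"
    have "\<rho> z \<in> F.simple_extension k (\<rho> s)"
      using sums[OF s_residue(2)] residue_below(2)[OF c refl] le z_quotient by simp
    then show ?thesis unfolding polynomial_residue_def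
      using s_residue(2) s_notin residue_field_generated(1)[OF Q] by blast
  next
    assume le: "\<forall>p\<in>lead (wt q) c. snd p \<le> snd q"
    have "\<rho> z \<in> F.simple_extension k (\<rho> (inv s))"
      using sums[OF s_residue(3)] residue_above[OF c refl] le z_quotient by simp
    then show ?thesis unfolding polynomial_residue_def
      using s_residue(3) inv_s_notin residue_field_generated(2)[OF Q] by blast
  qed
qed

text \<open>
  Multiplying the residue of \<open>z\<close> by a positive power of \<open>\<sigma> = \<rho> s\<close> gives a polynomial in \<open>\<sigma>\<close> with
  nonzero constant term, so there is a pole at \<open>\<sigma> = 0\<close>; the highest leading term gives in the same
  way a pole at \<open>\<sigma> = \<infinity>\<close>.
\<close>

theorem not_polynomial_residue_two_sided:
  assumes p: "p \<in> lead (wt q) c" "\<And>r. r \<in> lead (wt q) c \<Longrightarrow> snd p \<le> snd r" "snd p < snd q"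
    and p': "p' \<in> lead (wt q) c" "\<And>r. r \<in> lead (wt q) c \<Longrightarrow> snd r \<le> snd p'" "snd q < snd p'"
  shows "\<not> polynomial_residue (\<rho> z)"
proof
  assume "polynomial_residue (\<rho> z)"
  then obtain t where t: "t \<in> carrier F" "generate_field F (insert t k) = carrier F" "\<rho> z \<in> F.simple_extension k t"
    unfolding polynomial_residue_def by blast
  have zc: "\<rho> z \<in> carrier F" using res_closed z by blast
  note w = lead_coeff(3)[OF c p(1)] lead_coeff(3)[OF c p'(1)]
  have "f \<otimes> inv (mon p) = z \<otimes> s [^] s_exponent p q"
    unfolding f using monomial_ratio(2)[of q p] w p(3) z_unit mon_carrier mon_nonzero by (simp add: m_assoc)
  then have "\<rho> (f \<otimes> inv (mon p)) = \<rho> z \<otimes>\<^bsub>F\<^esub> \<rho> s [^]\<^bsub>F\<^esub> s_exponent p q"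
    using z s_props by (simp add: res_mult res_pow V_pow)
  then have 1: "\<rho> z \<otimes>\<^bsub>F\<^esub> \<rho> s [^]\<^bsub>F\<^esub> s_exponent p q \<in> K.nonvanishing (\<rho> s)"
    using residue_lowest[OF c p(1,2)] by simp
  have "f \<otimes> inv (mon p') = z \<otimes> inv s [^] s_exponent q p'"
    unfolding f using monomial_ratio(3)[of p' q] w p'(3) z_unit mon_carrier mon_nonzero by (simp add: m_assoc)
  then have "\<rho> (f \<otimes> inv (mon p')) = \<rho> z \<otimes>\<^bsub>F\<^esub> \<rho> (inv s) [^]\<^bsub>F\<^esub> s_exponent q p'"
    using z s_residue by (simp add: res_mult res_pow V_pow)
  then have 2: "\<rho> z \<otimes>\<^bsub>F\<^esub> (inv\<^bsub>F\<^esub> \<rho> s) [^]\<^bsub>F\<^esub> s_exponent q p' \<in> K.nonvanishing (inv\<^bsub>F\<^esub> \<rho> s)"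
    using residue_highest[OF c p'(1,2)] s_residue(4) by simp
  have pos: "0 < s_exponent p q" "0 < s_exponent q p'"
    using monomial_ratio(4)[of q p] monomial_ratio(4)[of p' q] w p(3) p'(3) by auto
  show False
    using K.not_polynomial_of_two_poles[OF s_residue(2) s_notin residue_field_generated(1)[OF Q] zc 1 pos(1) 2 pos(2) t(1,2)] t(3)
    by blast
qed

theorem lead_singleton:
  assumes "lead (wt q) c = {p}"
  shows "snd q \<noteq> snd p" "polynomial_residue (\<rho> z)"
proof -
  have w: "wt p = wt q" using assms lead_coeff(3)[OF c, of p] by simp
  show "snd q \<noteq> snd p"
  proof
    assume "snd q = snd p"
    then have "\<rho> z = \<rho> (c p) \<otimes>\<^bsub>F\<^esub> \<rho> s [^]\<^bsub>F\<^esub> s_exponent q p"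
      using residue_below(2)[OF c refl] z_quotient assms lead_coeff(1)[OF c, of p] K.k_carrier s_residue by simp
    moreover have "s_exponent q p = 0" unfolding s_exponent_def using \<open>snd q = snd p\<close> by simp
    ultimately have "\<rho> z = \<rho> (c p)" using lead_coeff(1)[OF c, of p] K.k_carrier assms by simp
    then show False using lead_coeff(1)[OF c, of p] assms z(2) by simp
  qed
  show "polynomial_residue (\<rho> z)"
    by (rule polynomial_residue_one_sided) (use assms in auto)
qed

end

end

section \<open>Descent along quadratic transforms\<close>

context residue_closure
begin

text \<open>
  A criterion for monomiality that mentions neither the ring \<open>R\<close> nor the gcd of the values. This
  makes its behaviour under \<open>(x, y) \<mapsto> (x, y/x)\<close> immediate.
\<close>

definition transcendental_monomials :: "'a \<Rightarrow> 'a \<Rightarrow> bool" where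
  "transcendental_monomials x y \<longleftrightarrow> x \<noteq> \<zero> \<and> y \<noteq> \<zero> \<and>
     (\<exists>(i::nat) (j::nat). 0 < i \<and> 0 < j \<and> v (x [^] i) = v (y [^] j) \<and> \<rho> (y [^] j \<otimes> inv (x [^] i)) \<notin> k)"

lemma transcendental_monomials_swap:
  assumes c: "x \<in> carrier L" "y \<in> carrier L" and t: "transcendental_monomials x y"
  shows "transcendental_monomials y x"
proof -
  obtain i j :: nat where ij: "x \<noteq> \<zero>" "y \<noteq> \<zero>" "0 < i" "0 < j" "v (x [^] i) = v (y [^] j)"
    "\<rho> (y [^] j \<otimes> inv (x [^] i)) \<notin> k" using t unfolding transcendental_monomials_def by blast
  define a where "a = y [^] j \<otimes> inv (x [^] i)"
  have n: "x [^] i \<in> carrier L" "x [^] i \<noteq> \<zero>" "y [^] j \<in> carrier L" "y [^] j \<noteq> \<zero>" using ij c by auto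
  have a: "a \<in> carrier L" "a \<noteq> \<zero>" "v a = 0"
    unfolding a_def using n ij(5) by (auto simp: v_mult v_inv integral_iff)
  then have aV: "a \<in> V" using V_iff by simp
  have "a \<otimes> (x [^] i \<otimes> inv (y [^] j)) = (inv (x [^] i) \<otimes> x [^] i) \<otimes> (y [^] j \<otimes> inv (y [^] j))"
    unfolding a_def using n inv_closed'[OF n(1,2)] inv_closed'[OF n(3,4)] by (simp add: m_ac del: l_inv' r_inv')
  then have "x [^] i \<otimes> inv (y [^] j) = inv a" using inv_unique'[OF a(1)] n by simp
  then have "\<rho> (x [^] i \<otimes> inv (y [^] j)) = inv\<^bsub>F\<^esub> \<rho> a" using res_inv[OF aV a(2,3)] by simp
  moreover have "inv\<^bsub>F\<^esub> \<rho> a \<notin> k" using K.inv_notin res_closed[OF aV] ij(6) unfolding a_def by blast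
  ultimately show ?thesis unfolding transcendental_monomials_def using ij by metis
qed

lemma weighted_chartI:
  assumes "local_at R x y" "\<rho> ` R \<subseteq> k" "K\<^sub>0 \<subseteq> \<rho> ` R" "x \<noteq> \<zero>" "y \<noteq> \<zero>"
  shows "weighted_chart L F V \<rho> v k K\<^sub>0 R x y (nat (v x)) (nat (v y))"
proof -
  have "ge 1 x" "ge 1 y" using assms unfolding local_at_def by auto
  then show ?thesis using assms unfolding ge_def by unfold_locales auto
qed

lemma transcendental_chartI:
  assumes R: "local_at R x y" "\<rho> ` R \<subseteq> k" "K\<^sub>0 \<subseteq> \<rho> ` R" and t: "transcendental_monomials x y"
  shows "transcendental_chart L F V \<rho> v k K\<^sub>0 R x y (nat (v x)) (nat (v y))"
proof -
  obtain i j :: nat where ij: "x \<noteq> \<zero>" "y \<noteq> \<zero>" "0 < i" "0 < j" "v (x [^] i) = v (y [^] j)"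
    "\<rho> (y [^] j \<otimes> inv (x [^] i)) \<notin> k" using t unfolding transcendental_monomials_def by blast
  interpret W: weighted_chart L F V \<rho> v k K\<^sub>0 R x y "nat (v x)" "nat (v y)"
    by (rule weighted_chartI[OF R ij(1,2)])
  show ?thesis
  proof
    have "int (W.wt (i, 0)) = int (W.wt (0, j))"
      using ij(5) W.v_mon[of "(i, 0)"] W.v_mon[of "(0, j)"] W.xc W.yc unfolding W.mon_def by simp
    then have "W.mon (0, j) \<otimes> inv (W.mon (i, 0)) = W.s [^] W.s_exponent (i, 0) (0, j)"
      by (intro W.monomial_ratio(2)) auto
    then have eq: "y [^] j \<otimes> inv (x [^] i) = W.s [^] W.s_exponent (i, 0) (0, j)"
      unfolding W.mon_def using W.xc W.yc by simp
    show "\<rho> W.s \<notin> k"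
    proof
      assume s: "\<rho> W.s \<in> k"
      have "\<rho> W.s [^]\<^bsub>F\<^esub> n \<in> k" for n :: nat
        by (induct n) (auto intro: K.k_closed s)
      then show False using ij(6) unfolding eq using res_pow[OF W.s_props(4)] by simp
    qed
  qed
qed

lemma relation_over:
  assumes "\<tau> \<in> k" "K\<^sub>0 \<subseteq> \<rho> ` R"
  shows "\<exists>n. \<exists>a \<in> F.poly_values (\<rho> ` R) \<tau> n. a \<oplus>\<^bsub>F\<^esub> \<tau> [^]\<^bsub>F\<^esub> n = \<zero>\<^bsub>F\<^esub>"
proof -
  have "F.poly_values K\<^sub>0 \<tau> n \<subseteq> F.poly_values (\<rho> ` R) \<tau> n" for n
  proof (induct n)
    case (Suc n) then show ?case using assms(2) by (simp, blast)
  qed simp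
  then show ?thesis using algebraic[OF assms(1)] by blast
qed

text \<open>
  With \<open>u = y/x\<close>, the denominator \<open>x^a y^b\<close> is \<open>x^(a+b) u^b\<close>, and one factor \<open>x\<close> cancels against
  the numerator. If \<open>u\<close> is not a unit, the new parameters are \<open>x\<close> and \<open>u\<close>, and a monomial quotient of
  these is one of \<open>x\<close> and \<open>y\<close>, so the valuation remains non-monomial. If \<open>u\<close> is a unit, its power is
  moved to the numerator and the second exponent becomes zero. In both cases the last hypothesis of
  \<open>polynomial_residue_descent\<close> is inherited.
\<close>

lemma descent_step:
  assumes R: "local_at R x y" "\<rho> ` R \<subseteq> k" "K\<^sub>0 \<subseteq> \<rho> ` R"
    and x0: "x \<noteq> \<zero>" and xy: "ge (v x) y" and nt: "\<not> transcendental_monomials x y"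
    and z: "z \<in> V" and zR: "z \<otimes> (x [^] (a::nat) \<otimes> y [^] (b::nat)) \<in> R" and b: "b = 0 \<or> y \<noteq> \<zero>" and ab: "0 < a + b"
  shows "\<exists>R' h a' b'. local_at R' x h \<and> R \<subseteq> R' \<and> \<rho> ` R' \<subseteq> k \<and> z \<otimes> (x [^] (a'::nat) \<otimes> h [^] (b'::nat)) \<in> R' \<and>
    (b' = 0 \<or> h \<noteq> \<zero>) \<and> (transcendental_monomials x h \<longrightarrow> a' = 0 \<or> b' = 0) \<and>
    v (x [^] a' \<otimes> h [^] b') < v (x [^] a \<otimes> y [^] b)"
proof -
  have xyR: "x \<in> R" "y \<in> R" "ge 1 x" "ge 1 y" "R \<subseteq> V" "subring R L" using R unfolding local_at_def by auto
  have xc: "x \<in> carrier L" and yc: "y \<in> carrier L" and zc: "z \<in> carrier L" using xyR V_carrier z by auto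
  have vx: "0 < v x" using xyR(3) x0 unfolding ge_def by simp
  define u where "u = y \<otimes> inv x"
  have u: "u \<in> V" unfolding u_def using ge_iff_quotient xy xc yc x0 by blast
  have uc: "u \<in> carrier L" using u V_carrier by blast
  have ux: "u \<otimes> x = y" unfolding u_def using mult_inv_cancel xc yc x0 by simp
  have y0: "y \<noteq> \<zero> \<longleftrightarrow> u \<noteq> \<zero>" unfolding ux[symmetric] using uc xc x0 by (simp add: integral_iff)
  have vy: "v y = v u + v x" if "u \<noteq> \<zero>" unfolding ux[symmetric] using v_mult that uc xc x0 by blast
  have uk: "\<rho> u \<in> k"
  proof (rule ccontr)
    assume n: "\<rho> u \<notin> k"
    then have "u \<noteq> \<zero>" "v u = 0" using res_nonzero[OF u] K.k_closed(2) by auto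
    then have "transcendental_monomials x y" unfolding transcendental_monomials_def
      using n x0 y0 vy xc yc unfolding u_def by (intro conjI exI[of _ 1]) auto
    then show False using nt by blast
  qed
  obtain R' h where R': "local_at R' x h" "R \<subseteq> R'" "u \<in> R'" "\<rho> ` R' \<subseteq> k" "ge 1 u \<longrightarrow> h = u"
    "\<forall>r\<in>R. ge 1 r \<longrightarrow> r \<otimes> inv x \<in> R'"
    using quadratic_transform[OF R(1) x0 u ux relation_over[OF uk R(3)] K.k R(2) uk] by blast
  have R'p: "subring R' L" "\<And>r. r \<in> R' \<Longrightarrow> \<not> ge 1 r \<Longrightarrow> inv r \<in> R'" using R'(1) unfolding local_at_def by auto
  \<comment> \<open>one factor \<open>x\<close> of the denominator will be cancelled\<close>
  define n where "n = a + b - 1"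
  have n: "a + b = Suc n" unfolding n_def using ab by simp
  have yb: "y [^] b = u [^] b \<otimes> x [^] b" unfolding ux[symmetric] using uc xc by (simp add: nat_pow_distrib)
  have xn: "x [^] a \<otimes> x [^] b = x [^] n \<otimes> x" using nat_pow_mult[OF xc, of a b] n by simp
  have M: "x [^] a \<otimes> y [^] b = (x [^] n \<otimes> u [^] b) \<otimes> x"
  proof -
    have "x [^] a \<otimes> y [^] b = (x [^] a \<otimes> x [^] b) \<otimes> u [^] b" unfolding yb using uc xc by (simp add: m_ac)
    then show ?thesis unfolding xn using uc xc by (simp add: m_ac)
  qed
  define f where "f = z \<otimes> (x [^] a \<otimes> y [^] b)"
  have f: "f = (z \<otimes> (x [^] n \<otimes> u [^] b)) \<otimes> x" unfolding f_def M using zc xc uc by (simp add: m_assoc)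
  have "z \<otimes> (x [^] n \<otimes> u [^] b) \<in> V" using z u xyR by (intro V_mult V_pow) auto
  then have f1: "ge 1 f" unfolding f using ge_mult_V[OF xyR(3)] by blast
  have "f \<otimes> inv x = z \<otimes> (x [^] n \<otimes> u [^] b)" unfolding f using zc xc uc x0 by (simp add: m_assoc)
  then have g: "z \<otimes> (x [^] n \<otimes> u [^] b) \<in> R'" using R'(6) f1 zR unfolding f_def by metis
  have ub: "u [^] b \<noteq> \<zero>" using b y0 uc by (cases "b = 0") auto
  have vM: "v (x [^] a \<otimes> y [^] b) = v (x [^] n \<otimes> u [^] b) + v x"
    unfolding M using xc x0 uc ub by (intro v_mult) (auto simp: integral_iff)
  show ?thesis
  proof (cases "ge 1 u")
    case True
    have "\<not> transcendental_monomials x u"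
    proof
      assume "transcendental_monomials x u"
      then obtain i j :: nat where ij: "u \<noteq> \<zero>" "0 < i" "0 < j" "v (x [^] i) = v (u [^] j)"
        "\<rho> (u [^] j \<otimes> inv (x [^] i)) \<notin> k" unfolding transcendental_monomials_def by blast
      have p: "x [^] i \<in> carrier L" "x [^] i \<noteq> \<zero>" "x [^] j \<in> carrier L" "x [^] j \<noteq> \<zero>" "u [^] j \<in> carrier L" "u [^] j \<noteq> \<zero>"
        using xc x0 uc ij by auto
      have xij: "x [^] (i + j) = x [^] i \<otimes> x [^] j" using nat_pow_mult[OF xc, of i j] by simp
      have yj: "y [^] j = u [^] j \<otimes> x [^] j" unfolding ux[symmetric] using uc xc by (simp add: nat_pow_distrib)
      have vv: "v (x [^] (i + j)) = v (y [^] j)" unfolding xij yj using p ij(4) by (simp add: v_mult)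
      have "(u [^] j \<otimes> inv (x [^] i)) \<otimes> x [^] (i + j) = u [^] j \<otimes> ((inv (x [^] i) \<otimes> x [^] i) \<otimes> x [^] j)"
        unfolding xij using p inv_closed'[OF p(1,2)] by (simp add: m_assoc del: l_inv')
      then have yx: "y [^] j = (u [^] j \<otimes> inv (x [^] i)) \<otimes> x [^] (i + j)" unfolding yj using p by simp
      have "y [^] j \<otimes> inv (x [^] (i + j)) = u [^] j \<otimes> inv (x [^] i)"
        unfolding yx using p xc x0 by (simp add: m_assoc)
      then have "transcendental_monomials x y" unfolding transcendental_monomials_def
        using x0 y0 ij vv by (intro conjI exI[of _ "i + j"] exI[of _ j]) auto
      then show False using nt by blast
    qed
    then show ?thesis using R' True g b y0 vM vx by (intro exI[of _ R'] exI[of _ u] exI[of _ n] exI[of _ b]) auto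
  next
    case False
    then have u0: "u \<noteq> \<zero>" "v u = 0" using not_ge1[OF u] by auto
    have iu: "inv u \<in> R'" using R'p(2)[OF R'(3) False] .
    have "(inv u) [^] b \<in> R'" by (induct b) (use iu subringE(3,6)[OF R'p(1)] in auto)
    then have "(z \<otimes> (x [^] n \<otimes> u [^] b)) \<otimes> (inv u) [^] b \<in> R'" using subringE(6)[OF R'p(1)] g by blast
    moreover have "u [^] b \<otimes> (inv u) [^] b = \<one>" using uc u0 by (simp flip: nat_pow_distrib)
    then have "(z \<otimes> (x [^] n \<otimes> u [^] b)) \<otimes> (inv u) [^] b = z \<otimes> x [^] n"
      using zc xc uc u0 by (simp add: m_assoc)
    ultimately have g': "z \<otimes> (x [^] n \<otimes> h [^] (0::nat)) \<in> R'" using zc xc by simp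
    have "v (x [^] n \<otimes> u [^] b) = v (x [^] n)" using xc x0 uc u0 by (simp add: v_mult v_pow)
    then have "v (x [^] n \<otimes> h [^] (0::nat)) < v (x [^] a \<otimes> y [^] b)" using vM vx xc by simp
    then show ?thesis using R' g' by (intro exI[of _ R'] exI[of _ h] exI[of _ n] exI[of _ "0::nat"]) auto
  qed
qed

text \<open>
  Induction on the value of the denominator. In the monomial case the vanishing of one exponent puts
  the denominator on one side of all leading terms. Otherwise \<open>descent_step\<close> applies to \<open>x\<close> and \<open>y\<close>
  in a suitable order; the exponents do not both vanish, as \<open>z\<close> would then lie in \<open>R\<close> and its residue
  in \<open>k\<close>.
\<close>

theorem polynomial_residue_descent:
  assumes "local_at R x y" "\<rho> ` R \<subseteq> k" "K\<^sub>0 \<subseteq> \<rho> ` R"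
    and "\<And>w. w \<in> carrier L \<Longrightarrow> \<exists>a\<in>R. \<exists>b\<in>R - {\<zero>}. w = a \<otimes> inv b"
    and "z \<in> V" "\<rho> z \<notin> k" and "z \<otimes> (x [^] (a::nat) \<otimes> y [^] (b::nat)) \<in> R"
    and "a = 0 \<or> x \<noteq> \<zero>" "b = 0 \<or> y \<noteq> \<zero>"
    and "transcendental_monomials x y \<longrightarrow> a = 0 \<or> b = 0"
  shows "polynomial_residue (\<rho> z)"
  using assms
proof (induction "nat (v (x [^] a \<otimes> y [^] b))" arbitrary: R x y a b rule: less_induct)
  case less
  note R = less.prems(1-3) and Q = less.prems(4) and z = less.prems(5,6) and zR = less.prems(7)
    and a = less.prems(8) and b = less.prems(9) and T = less.prems(10)
  have xyR: "x \<in> R" "y \<in> R" "ge 1 x" "ge 1 y" "R \<subseteq> V" using R unfolding local_at_def by auto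
  have xc: "x \<in> carrier L" and yc: "y \<in> carrier L" and zc: "z \<in> carrier L" using xyR V_carrier z by auto
  show ?case
  proof (cases "transcendental_monomials x y")
    case True
    interpret C: transcendental_chart L F V \<rho> v k K\<^sub>0 R x y "nat (v x)" "nat (v y)"
      by (rule transcendental_chartI[OF R True])
    define f where "f = z \<otimes> C.mon (a, b)"
    have fR: "f \<in> R" unfolding f_def C.mon_def using zR by simp
    have z0: "z \<noteq> \<zero>" "v z = 0" using res_nonzero[OF z(1)] z(2) K.k_closed(2) by auto
    have "v f = int (C.wt (a, b))" unfolding f_def using v_mult[OF zc z0(1) C.mon_carrier C.mon_nonzero] z0(2) C.v_mon by simp
    then obtain c where c: "C.expansion (C.wt (a, b)) f c"
      using C.ge_expandable[OF fR] ge_self[of f] C.R_carrier[OF fR] unfolding C.expandable_def by auto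
    have "(\<forall>p\<in>C.lead (C.wt (a, b)) c. snd (a, b) \<le> snd p) \<or> (\<forall>p\<in>C.lead (C.wt (a, b)) c. snd p \<le> snd (a, b))"
    proof (cases "b = 0")
      case False
      then have "a = 0" using T True by blast
      then have "snd p \<le> b" if "p \<in> C.lead (C.wt (a, b)) c" for p
        using C.lead_coeff(3)[OF c that] C.\<beta>_pos unfolding C.wt_def
        by (metis add_0 fst_conv le_add2 mult_0 mult_le_cancel2 snd_conv)
      then show ?thesis by simp
    qed simp
    then show ?thesis using C.polynomial_residue_one_sided[OF Q z f_def c] by blast
  next
    case False
    have ab: "0 < a + b"
    proof (rule ccontr)
      assume "\<not> 0 < a + b"
      then have "z \<in> R" using zR zc by simp
      then show False using z(2) R(2) by blast
    qed
    have IH: "polynomial_residue (\<rho> z)" if "local_at R' x' h" "R \<subseteq> R'" "\<rho> ` R' \<subseteq> k" "z \<otimes> (x' [^] (a'::nat) \<otimes> h [^] (b'::nat)) \<in> R'"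
      "b' = 0 \<or> h \<noteq> \<zero>" "transcendental_monomials x' h \<longrightarrow> a' = 0 \<or> b' = 0"
      "v (x' [^] a' \<otimes> h [^] b') < v (x [^] a \<otimes> y [^] b)" "x' \<noteq> \<zero>" for R' x' h a' b'
    proof -
      have "x' \<in> V" "h \<in> V" using that(1) unfolding local_at_def by auto
      then have hV: "x' [^] a' \<otimes> h [^] b' \<in> V" by (intro V_mult V_pow)
      have "x' \<in> carrier L" "h \<in> carrier L" using \<open>x' \<in> V\<close> \<open>h \<in> V\<close> V_carrier by auto
      then have "x' [^] a' \<otimes> h [^] b' \<noteq> \<zero>" using that(5,8) by (cases "b' = 0") (auto simp: integral_iff)
      then have "0 \<le> v (x' [^] a' \<otimes> h [^] b')" using V_iff V_carrier hV by blast
      then have "nat (v (x' [^] a' \<otimes> h [^] b')) < nat (v (x [^] a \<otimes> y [^] b))" using that(7) by simp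
      moreover have "\<exists>a\<in>R'. \<exists>b\<in>R' - {\<zero>}. w = a \<otimes> inv b" if "w \<in> carrier L" for w
        using Q[OF that] \<open>R \<subseteq> R'\<close> by blast
      moreover have "K\<^sub>0 \<subseteq> \<rho> ` R'" using R(3) that(2) by blast
      ultimately show ?thesis using less.hyps[of x' a' h b' R'] that z by blast
    qed
    have "(x \<noteq> \<zero> \<and> ge (v x) y) \<or> (y \<noteq> \<zero> \<and> ge (v y) x)"
      using ab a b xc yc unfolding ge_def by auto
    then show ?thesis
    proof
      assume x: "x \<noteq> \<zero> \<and> ge (v x) y"
      obtain R' h a' b' where d: "local_at R' x h" "R \<subseteq> R'" "\<rho> ` R' \<subseteq> k" "z \<otimes> (x [^] (a'::nat) \<otimes> h [^] (b'::nat)) \<in> R'"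
        "b' = 0 \<or> h \<noteq> \<zero>" "transcendental_monomials x h \<longrightarrow> a' = 0 \<or> b' = 0"
        "v (x [^] a' \<otimes> h [^] b') < v (x [^] a \<otimes> y [^] b)"
        using descent_step[OF R x[THEN conjunct1] x[THEN conjunct2] False z(1) zR b ab] by blast
      show ?thesis using IH[OF d] x by blast
    next
      assume y: "y \<noteq> \<zero> \<and> ge (v y) x"
      have F': "\<not> transcendental_monomials y x" using False transcendental_monomials_swap yc xc by blast
      have sw: "x [^] a \<otimes> y [^] b = y [^] b \<otimes> x [^] a" using xc yc by (simp add: m_comm)
      have zR': "z \<otimes> (y [^] b \<otimes> x [^] a) \<in> R" using zR sw by simp
      have ab': "0 < b + a" using ab by linarith
      obtain R' h a' b' where d: "local_at R' y h" "R \<subseteq> R'" "\<rho> ` R' \<subseteq> k" "z \<otimes> (y [^] (a'::nat) \<otimes> h [^] (b'::nat)) \<in> R'"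
        "b' = 0 \<or> h \<noteq> \<zero>" "transcendental_monomials y h \<longrightarrow> a' = 0 \<or> b' = 0"
        "v (y [^] a' \<otimes> h [^] b') < v (y [^] b \<otimes> x [^] a)"
        using descent_step[OF local_at_swap[OF R(1)] R(2,3) y[THEN conjunct1] y[THEN conjunct2] F' z(1) zR' a ab'] by blast
      show ?thesis using IH[OF d(1-6)] d(7) sw y by simp
    qed
  qed
qed

text \<open>
  If one parameter were zero, the maximal ideal of \<open>R\<close> would be generated by the other one. Common
  factors could then be cancelled from numerator and denominator of \<open>z\<close> until \<open>z \<in> R\<close>, and the
  residue of \<open>z\<close> would be algebraic.
\<close>

lemma parameter_nonzero:
  assumes R: "local_at R x y" "\<rho> ` R \<subseteq> k" and Q: "\<And>w. w \<in> carrier L \<Longrightarrow> \<exists>a\<in>R. \<exists>b\<in>R - {\<zero>}. w = a \<otimes> inv b"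
    and z: "z \<in> V" "\<rho> z \<notin> k"
  shows "y \<noteq> \<zero>"
proof
  assume y: "y = \<zero>"
  have R': "subring R L" "R \<subseteq> V" "x \<in> R" "ge 1 x" "\<And>r. r \<in> R \<Longrightarrow> \<not> ge 1 r \<Longrightarrow> inv r \<in> R"
    using R unfolding local_at_def by auto
  have Rc: "r \<in> carrier L" if "r \<in> R" for r using R' V_carrier that by blast
  have gen: "\<exists>p\<in>R. r = p \<otimes> x" if r: "r \<in> R" "ge 1 r" for r
  proof -
    obtain p q where pq: "p \<in> R" "q \<in> R" "r = p \<otimes> x \<oplus> q \<otimes> y" using R r unfolding local_at_def by blast
    then have "r = p \<otimes> x" using y Rc R'(3) by simp
    then show ?thesis using pq by blast
  qed
  have zc: "z \<in> carrier L" using z V_carrier by blast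
  have z0: "z \<noteq> \<zero>" "v z = 0" using res_nonzero[OF z(1)] z(2) K.k_closed(2) by auto
  have key: False if "g \<in> R" "g \<noteq> \<zero>" "z \<otimes> g \<in> R" for g
    using that
  proof (induction "nat (v g)" arbitrary: g rule: less_induct)
    case less
    have gc: "g \<in> carrier L" using less Rc by blast
    show False
    proof (cases "ge 1 g")
      case False
      then have ig: "inv g \<in> R" using R'(5) less by blast
      have "z = (z \<otimes> g) \<otimes> inv g" using gc less zc by (simp add: m_assoc)
      then have "z \<in> R" using subringE(6)[OF R'(1) less.prems(3) ig] by simp
      then show False using z(2) R(2) by blast
    next
      case True
      have "ge 1 (z \<otimes> g)" using ge_mult_V[OF True z(1)] .
      then obtain p' p where p: "p' \<in> R" "z \<otimes> g = p' \<otimes> x" "p \<in> R" "g = p \<otimes> x"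
        using gen less True by metis
      have cc: "p' \<in> carrier L" "p \<in> carrier L" "x \<in> carrier L" using p Rc R' by auto
      have x0: "x \<noteq> \<zero>" "p \<noteq> \<zero>" using less.prems(2) p cc by auto
      have "(z \<otimes> p) \<otimes> x = p' \<otimes> x" using p cc zc by (simp add: m_assoc)
      then have zp: "z \<otimes> p = p'" using cancel_r cc zc x0 by simp
      have "v g = v p + v x" unfolding p(4) using v_mult cc x0 by blast
      moreover have "0 \<le> v p" using V_iff cc x0 p R'(2) by blast
      moreover have "0 < v x" using R'(4) x0 unfolding ge_def by simp
      ultimately show False using less.hyps[of p] zp p x0 by simp
    qed
  qed
  obtain f g where fg: "f \<in> R" "g \<in> R" "g \<noteq> \<zero>" "z = f \<otimes> inv g" using Q[OF zc] by blast
  have "z \<otimes> g = f" unfolding fg(4) using mult_inv_cancel fg Rc by simp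
  then show False using key[OF fg(2,3)] fg(1) by simp
qed

end

section \<open>Noetherian local rings\<close>

text \<open>
  Closure under negation comes for free, from multiplication by \<open>\<ominus> \<one>\<close>.
\<close>

lemma (in cring) ideal_closedI:
  assumes "I \<subseteq> carrier R" "\<zero> \<in> I" "\<And>a b. a \<in> I \<Longrightarrow> b \<in> I \<Longrightarrow> a \<oplus> b \<in> I"
    and mult: "\<And>a r. a \<in> I \<Longrightarrow> r \<in> carrier R \<Longrightarrow> r \<otimes> a \<in> I"
  shows "ideal I R"
proof (rule idealI[OF ring_axioms])
  show "subgroup I (add_monoid R)"
  proof (rule add.subgroupI)
    fix a assume a: "a \<in> I"
    then have "\<ominus> a = (\<ominus> \<one>) \<otimes> a" using assms(1) by (auto simp: l_minus subset_iff)
    then show "\<ominus> a \<in> I" using mult[OF a, of "\<ominus> \<one>"] by simp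
  qed (use assms in auto)
  fix a r assume a: "a \<in> I" "r \<in> carrier R"
  then show "r \<otimes> a \<in> I" using mult by blast
  then show "a \<otimes> r \<in> I" using a assms(1) by (metis m_comm subsetD)
qed

lemma (in cring) idl_pair:
  assumes "x \<in> carrier R" "y \<in> carrier R" "r \<in> Idl {x, y}"
  shows "\<exists>p\<in>carrier R. \<exists>q\<in>carrier R. r = p \<otimes> x \<oplus> q \<otimes> y"
proof -
  define I where "I = {p \<otimes> x \<oplus> q \<otimes> y | p q. p \<in> carrier R \<and> q \<in> carrier R}"
  have "ideal I R"
  proof (rule ideal_closedI)
    show "I \<subseteq> carrier R" unfolding I_def using assms by auto
    show "\<zero> \<in> I" unfolding I_def using assms by (auto intro!: exI[of _ \<zero>])
    fix a assume "a \<in> I"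
    then obtain p q where a: "p \<in> carrier R" "q \<in> carrier R" "a = p \<otimes> x \<oplus> q \<otimes> y" unfolding I_def by blast
    {
      fix b assume "b \<in> I"
      then obtain p' q' where b: "p' \<in> carrier R" "q' \<in> carrier R" "b = p' \<otimes> x \<oplus> q' \<otimes> y" unfolding I_def by blast
      have "a \<oplus> b = (p \<oplus> p') \<otimes> x \<oplus> (q \<oplus> q') \<otimes> y" unfolding a(3) b(3) using a(1,2) b(1,2) assms by algebra
      then show "a \<oplus> b \<in> I" unfolding I_def using a b by blast
    next
      fix r assume r: "r \<in> carrier R"
      have "r \<otimes> a = (r \<otimes> p) \<otimes> x \<oplus> (r \<otimes> q) \<otimes> y" unfolding a(3) using a(1,2) r assms by algebra
      then show "r \<otimes> a \<in> I" unfolding I_def using a r by blast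
    }
  qed
  moreover have "x \<in> I" unfolding I_def using assms by (intro CollectI exI[of _ \<one>] exI[of _ \<zero>]) simp
  moreover have "y \<in> I" unfolding I_def using assms by (intro CollectI exI[of _ \<zero>] exI[of _ \<one>]) simp
  ultimately have "r \<in> I" using genideal_minimal[of I "{x, y}"] assms(3) by blast
  then show ?thesis unfolding I_def by blast
qed

text \<open>
  Zorn's lemma for the ideals that contain \<open>a\<close> but not \<open>\<one>\<close>; in a noetherian ring the union of a
  nonempty chain of ideals is a member of the chain.
\<close>

lemma nonunit_in_maximal_ideal:
  fixes R (structure)
  assumes "noetherian_ring R" "cring R" and a: "a \<in> carrier R" "a \<notin> Units R"
  shows "\<exists>M. maximalideal M R \<and> a \<in> M"
proof -
  interpret noetherian_ring R by fact
  interpret cring R by fact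
  define S where "S = {I. ideal I R \<and> a \<in> I \<and> \<one> \<notin> I}"
  have "\<one> \<notin> PIdl a"
  proof
    assume "\<one> \<in> PIdl a"
    then obtain b where b: "b \<in> carrier R" "\<one> = b \<otimes> a" unfolding cgenideal_def by auto
    then show False using a m_comm[of a b] unfolding Units_def by auto
  qed
  then have "PIdl a \<in> S" unfolding S_def using cgenideal_ideal[OF a(1)] cgenideal_self[OF a(1)] by blast
  moreover have "\<Union>C \<in> S" if C: "C \<noteq> {}" "subset.chain S C" for C
  proof -
    have "subset.chain {I. ideal I R} C" using C(2) unfolding pred_on.chain_def S_def by blast
    then have "\<Union>C \<in> C" using ideal_chain_is_trivial C(1) by blast
    then show ?thesis using C(2) unfolding pred_on.chain_def by blast
  qed
  ultimately obtain M where M: "M \<in> S" "\<And>I. I \<in> S \<Longrightarrow> M \<subseteq> I \<Longrightarrow> I = M"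
    using subset_Zorn_nonempty[of S] by blast
  have "maximalideal M R"
  proof (rule maximalidealI)
    show "ideal M R" "carrier R \<noteq> M" using M(1) unfolding S_def by auto
    fix J assume J: "ideal J R" "M \<subseteq> J" "J \<subseteq> carrier R"
    show "J = M \<or> J = carrier R"
    proof (cases "\<one> \<in> J")
      case True then show ?thesis using ideal.one_imp_carrier[OF J(1)] by blast
    next
      case False
      then have "J \<in> S" using J M(1) unfolding S_def by blast
      then show ?thesis using M(2) J(2) by blast
    qed
  qed
  then show ?thesis using M(1) unfolding S_def by blast
qed

lemma local_ring_max_ideal:
  fixes R (structure)
  assumes "noetherian_ring R" "local_ring R"
  shows "maximalideal (max_ideal R) R" "max_ideal R = carrier R - Units R"
proof -
  have c: "cring R" and u: "\<exists>!m. maximalideal m R" using assms(2) unfolding local_ring_def by auto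
  interpret cring R by fact
  show m: "maximalideal (max_ideal R) R" unfolding max_ideal_def using u by (rule theI')
  interpret M: maximalideal "max_ideal R" R by fact
  show "max_ideal R = carrier R - Units R"
  proof
    show "max_ideal R \<subseteq> carrier R - Units R"
    proof
      fix a assume a: "a \<in> max_ideal R"
      have "a \<notin> Units R"
      proof
        assume "a \<in> Units R"
        then have "inv a \<in> carrier R" "inv a \<otimes> a = \<one>" by auto
        then have "\<one> \<in> max_ideal R" using M.I_l_closed[OF a] by metis
        then show False using M.one_imp_carrier M.I_notcarr by blast
      qed
      then show "a \<in> carrier R - Units R" using a M.Icarr by blast
    qed
    show "carrier R - Units R \<subseteq> max_ideal R"
      using nonunit_in_maximal_ideal[OF assms(1) c] u m by blast
  qed
qed

lemma noetherian_of_principal_domain: "principal_domain R \<Longrightarrow> noetherian_ring R"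
proof -
  assume "principal_domain R"
  then interpret principal_domain R .
  show "noetherian_ring R" by unfold_locales
qed

section \<open>The valuation of a discrete valuation ring\<close>

lemma (in field) int_pow_mult_of:
  assumes "x \<in> carrier R" "x \<noteq> \<zero>"
  shows "x [^]\<^bsub>Multiplicative_Group.mult_of R\<^esub> (n::int) = x [^] n"
proof -
  have "x [^] m \<in> carrier (Multiplicative_Group.mult_of R)" for m :: nat using assms by auto
  then have "inv\<^bsub>Multiplicative_Group.mult_of R\<^esub> (x [^] m) = inv (x [^] m)" for m :: nat
    by (rule m_inv_mult_of)
  then show ?thesis unfolding int_pow_def2 Multiplicative_Group.nat_pow_mult_of by (rule if_cong[OF refl _ refl])
qed

lemma (in field) int_pow_rules:
  assumes "x \<in> carrier R" "x \<noteq> \<zero>"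
  shows "x [^] (n::int) \<in> carrier R" "x [^] (n::int) \<noteq> \<zero>" "x [^] (n + m::int) = x [^] n \<otimes> x [^] m"
    "x [^] (1::int) = x"
proof -
  interpret G: group "Multiplicative_Group.mult_of R" by (rule field_mult_group)
  have x: "x \<in> carrier (Multiplicative_Group.mult_of R)" using assms by simp
  note [simp] = int_pow_mult_of[OF assms]
  show "x [^] n \<in> carrier R" "x [^] n \<noteq> \<zero>" using G.int_pow_closed[OF x, of n] by auto
  show "x [^] (n + m) = x [^] n \<otimes> x [^] m" using G.int_pow_mult[OF x, of n m] by simp
  show "x [^] (1::int) = x" using G.int_pow_1[OF x] by simp
qed

locale dvr_in_field = field L for L :: "('a, 'b) ring_scheme" (structure) +
  fixes V
  assumes qf: "quotient_field_of L V" and dvr: "discrete_valuation_ring (L\<lparr>carrier := V\<rparr>)"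
begin

abbreviation "VR \<equiv> L\<lparr>carrier := V\<rparr>"
abbreviation "M \<equiv> max_ideal VR"

lemma V_sub: "subring V L" using qf unfolding quotient_field_of_def by blast
lemma V_carr: "a \<in> V \<Longrightarrow> a \<in> carrier L" using subringE(1)[OF V_sub] by blast
lemma V_closed: "\<one> \<in> V" "\<zero> \<in> V" "a \<in> V \<Longrightarrow> b \<in> V \<Longrightarrow> a \<otimes> b \<in> V" "a \<in> V \<Longrightarrow> b \<in> V \<Longrightarrow> a \<oplus> b \<in> V" "a \<in> V \<Longrightarrow> \<ominus> a \<in> V"
  using subringE[OF V_sub] by auto

lemma V_pd: "principal_domain VR" and V_local: "local_ring VR" and V_nf: "\<not> field VR"
  using dvr unfolding discrete_valuation_ring_def by auto

lemma V_noeth: "noetherian_ring VR"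
  using noetherian_of_principal_domain[OF V_pd] .

lemma M_max: "maximalideal M VR" and M_eq: "M = V - Units VR"
  using local_ring_max_ideal[OF V_noeth V_local] by auto

lemma M_ideal: "ideal M VR" using M_max maximalideal.axioms(1) by blast

lemma Units_V: "u \<in> Units VR \<longleftrightarrow> u \<in> V \<and> u \<noteq> \<zero> \<and> inv u \<in> V"
proof
  assume "u \<in> Units VR"
  then obtain b where b: "u \<in> V" "b \<in> V" "u \<otimes> b = \<one>" unfolding Units_def by auto
  then have "b = inv u" using inv_unique' V_carr by blast
  moreover have "u \<noteq> \<zero>" using b V_carr by auto
  ultimately show "u \<in> V \<and> u \<noteq> \<zero> \<and> inv u \<in> V" using b by blast
next
  assume "u \<in> V \<and> u \<noteq> \<zero> \<and> inv u \<in> V"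
  then show "u \<in> Units VR" unfolding Units_def using V_carr by (auto intro!: bexI[of _ "inv u"])
qed

lemma Units_one: "\<one> \<in> Units VR"
  unfolding Units_V using V_closed(1) inv_unique'[of \<one> \<one>] by simp

lemma Units_mult: "u \<in> Units VR \<Longrightarrow> w \<in> Units VR \<Longrightarrow> u \<otimes> w \<in> Units VR"
  and Units_inv: "u \<in> Units VR \<Longrightarrow> inv u \<in> Units VR"
proof -
  assume u: "u \<in> Units VR"
  then have u': "u \<in> V" "u \<noteq> \<zero>" "inv u \<in> V" "u \<in> carrier L" using Units_V V_carr by auto
  have "inv (inv u) = u" using inv_unique'[of "inv u" u] u' by simp
  then show "inv u \<in> Units VR" unfolding Units_V using u' by simp
  assume "w \<in> Units VR"
  then have w': "w \<in> V" "w \<noteq> \<zero>" "inv w \<in> V" "w \<in> carrier L" using Units_V V_carr by auto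
  have "(u \<otimes> w) \<otimes> (inv u \<otimes> inv w) = (u \<otimes> inv u) \<otimes> (w \<otimes> inv w)"
    using u' w' V_carr by (simp add: m_ac del: r_inv')
  then have "inv (u \<otimes> w) = inv u \<otimes> inv w" using inv_unique'[of "u \<otimes> w" "inv u \<otimes> inv w"] u' w' V_carr by simp
  then show "u \<otimes> w \<in> Units VR" unfolding Units_V using u' w' V_closed by (simp add: integral_iff)
qed

definition uniformizer :: "'a \<Rightarrow> bool" where
  "uniformizer p \<longleftrightarrow> p \<in> V \<and> M = PIdl\<^bsub>VR\<^esub> p"

lemma uniformizer_exists: "\<exists>p. uniformizer p"
  unfolding uniformizer_def using principal_domain.exists_gen[OF V_pd M_ideal] by auto

lemma uniformizer_props:
  assumes "uniformizer p"
  shows "p \<in> V" "p \<in> carrier L" "p \<noteq> \<zero>" "w \<in> M \<longleftrightarrow> (\<exists>b\<in>V. w = b \<otimes> p)" "p \<in> M"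
proof -
  show pV: "p \<in> V" and "p \<in> carrier L" using assms V_carr unfolding uniformizer_def by auto
  show M: "w \<in> M \<longleftrightarrow> (\<exists>b\<in>V. w = b \<otimes> p)" for w
    using assms unfolding uniformizer_def cgenideal_def by auto
  then show "p \<in> M" using V_closed(1) V_carr[OF pV] by (metis l_one)
  show "p \<noteq> \<zero>"
  proof
    assume "p = \<zero>"
    then have "M = {\<zero>\<^bsub>VR\<^esub>}" using M V_closed V_carr by auto
    then have "field VR"
      using cring.zeromaximalideal_fieldI[of VR] M_max V_local unfolding local_ring_def by simp
    then show False using V_nf by blast
  qed
qed

lemma pow_V: "p \<in> V \<Longrightarrow> p [^] (n::nat) \<in> V"
  by (induct n) (auto intro: V_closed)

text \<open>
  The elements divisible by all powers of \<open>p\<close> form an ideal \<open>J\<close>, with generator \<open>j\<close> say. Then \<open>j / p\<close>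
  lies in \<open>J\<close> as well, so \<open>j = r p j\<close> for some \<open>r\<close>, which forces \<open>j = \<zero>\<close> because \<open>p\<close> is not a
  unit.
\<close>

lemma divisible_by_all_powers:
  assumes p: "uniformizer p" and a: "a \<in> V" "\<And>n::nat. \<exists>b\<in>V. a = b \<otimes> p [^] n"
  shows "a = \<zero>"
proof -
  note up = uniformizer_props[OF p]
  define J where "J = {a \<in> V. \<forall>n::nat. \<exists>b\<in>V. a = b \<otimes> p [^] n}"
  have VR: "cring VR" using V_local unfolding local_ring_def by blast
  have pc: "p [^] (n::nat) \<in> carrier L" for n using up by simp
  have "ideal J VR"
  proof (rule cring.ideal_closedI[OF VR])
    show "J \<subseteq> carrier VR" unfolding J_def by auto
    have "\<exists>b\<in>V. \<zero> = b \<otimes> p [^] (n::nat)" for n using V_closed(2) pc[of n] by (metis l_null)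
    then show "\<zero>\<^bsub>VR\<^esub> \<in> J" unfolding J_def using V_closed by simp
    fix a assume a: "a \<in> J"
    show "a \<oplus>\<^bsub>VR\<^esub> b \<in> J" if bJ: "b \<in> J" for b
    proof -
      have "\<exists>d\<in>V. a \<oplus> b = d \<otimes> p [^] n" for n :: nat
      proof -
        obtain a' where a': "a' \<in> V" "a = a' \<otimes> p [^] n" using a unfolding J_def by blast
        obtain b' where b': "b' \<in> V" "b = b' \<otimes> p [^] n" using bJ unfolding J_def by blast
        have "a \<oplus> b = (a' \<oplus> b') \<otimes> p [^] n" unfolding a'(2) b'(2) using a' b' V_carr pc by (simp add: l_distr)
        then show ?thesis using V_closed(4) a' b' by blast
      qed
      then show ?thesis using a bJ V_closed(4) unfolding J_def by simp
    qed
    show "r \<otimes>\<^bsub>VR\<^esub> a \<in> J" if "r \<in> carrier VR" for r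
    proof -
      have r: "r \<in> V" using that by simp
      have "\<exists>d\<in>V. r \<otimes> a = d \<otimes> p [^] n" for n :: nat
      proof -
        obtain a' where a': "a' \<in> V" "a = a' \<otimes> p [^] n" using a unfolding J_def by blast
        have "r \<otimes> a = (r \<otimes> a') \<otimes> p [^] n" unfolding a'(2) using a' r V_carr pc by (simp add: m_assoc)
        then show ?thesis using V_closed(3) a' r by blast
      qed
      then show ?thesis using a r V_closed(3) unfolding J_def by simp
    qed
  qed
  then obtain j where j: "j \<in> V" "J = PIdl\<^bsub>VR\<^esub> j" using principal_domain.exists_gen[OF V_pd] by auto
  have jc: "j \<in> carrier L" using j V_carr by blast
  have jJ: "j \<in> J" unfolding j(2) cgenideal_def using V_closed(1) jc by force
  have "\<exists>b\<in>V. j = b \<otimes> p [^] (1::nat)" using jJ unfolding J_def by blast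
  then obtain j' where j': "j' \<in> V" "j = j' \<otimes> p" using up by auto
  have "\<exists>b\<in>V. j' = b \<otimes> p [^] n" for n :: nat
  proof -
    obtain b where b: "b \<in> V" "j = b \<otimes> p [^] Suc n" using jJ unfolding J_def by blast
    have "j' \<otimes> p = (b \<otimes> p [^] n) \<otimes> p" using j'(2) b V_carr pc[of n] up by (simp add: m_assoc)
    then have "j' = b \<otimes> p [^] n" using cancel_r[of j' "b \<otimes> p [^] n" p] j'(1) b(1) V_carr pc[of n] up by simp
    then show ?thesis using b by blast
  qed
  then have "j' \<in> J" unfolding J_def using j' by blast
  then obtain r where r: "r \<in> V" "j' = r \<otimes> j" unfolding j(2) cgenideal_def by auto
  have "j = \<zero>"
  proof (rule ccontr)
    assume j0: "j \<noteq> \<zero>"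
    have "j = (r \<otimes> p) \<otimes> j" using j'(2) unfolding r(2) using r(1) V_carr up jc by (simp add: m_ac)
    then have "\<one> \<otimes> j = (r \<otimes> p) \<otimes> j" using jc by simp
    then have "\<one> = r \<otimes> p" using cancel_r[of \<one> "r \<otimes> p" j] r V_carr up jc j0 by simp
    then have "\<one> \<in> M" using up(4) r by blast
    then show False unfolding M_eq using Units_one by simp
  qed
  then have "J \<subseteq> {\<zero>}" unfolding j(2) cgenideal_def using V_carr by auto
  moreover have "a \<in> J" unfolding J_def using a by blast
  ultimately show ?thesis by blast
qed

lemma nat_factorization:
  assumes p: "uniformizer p" and a: "a \<in> V" "a \<noteq> \<zero>"
  shows "\<exists>n::nat. \<exists>u\<in>Units VR. a = u \<otimes> p [^] n"
proof -
  note up = uniformizer_props[OF p]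
  define D where "D n = (\<exists>b\<in>V. a = b \<otimes> p [^] (n::nat))" for n
  have "\<exists>n. \<not> D n" using divisible_by_all_powers[OF p a(1)] a(2) unfolding D_def by blast
  define N where "N = (LEAST n. \<not> D n)"
  have N: "\<not> D N" unfolding N_def using \<open>\<exists>n. \<not> D n\<close> by (rule LeastI_ex)
  have "D 0" unfolding D_def using a V_carr by (auto intro!: bexI[of _ a])
  then obtain n where n: "N = Suc n" using N by (cases N) auto
  have "D n" using not_less_Least[of n "\<lambda>n. \<not> D n"] n unfolding N_def by simp
  then obtain b where b: "b \<in> V" "a = b \<otimes> p [^] n" unfolding D_def by blast
  have "b \<notin> M"
  proof
    assume "b \<in> M"
    then obtain d where d: "d \<in> V" "b = d \<otimes> p" using up(4) by blast
    have "a = d \<otimes> p [^] Suc n" unfolding b(2) d(2) using d V_carr up by (simp add: m_ac)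
    then show False using N d unfolding n D_def by blast
  qed
  then show ?thesis using b unfolding M_eq by blast
qed

lemma int_factorization:
  assumes p: "uniformizer p" and a: "a \<in> carrier L" "a \<noteq> \<zero>"
  shows "\<exists>n::int. \<exists>u\<in>Units VR. a = u \<otimes> p [^] n"
proof -
  note up = uniformizer_props[OF p]
  obtain f g where fg: "f \<in> V" "g \<in> V" "g \<noteq> \<zero>" "a = f \<otimes> inv g"
    using qf a unfolding quotient_field_of_def by blast
  have cc: "f \<in> carrier L" "g \<in> carrier L" using fg V_carr by auto
  have ag: "a \<otimes> g = f" unfolding fg(4) using mult_inv_cancel cc fg by simp
  have f0: "f \<noteq> \<zero>" unfolding ag[symmetric] using a cc fg by (simp add: integral_iff)
  obtain n u m w where 1: "u \<in> Units VR" "f = u \<otimes> p [^] (n::nat)" "w \<in> Units VR" "g = w \<otimes> p [^] (m::nat)"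
    using nat_factorization[OF p fg(1) f0] nat_factorization[OF p fg(2,3)] by blast
  have uw: "u \<otimes> inv w \<in> Units VR" using 1 Units_mult Units_inv by blast
  have c: "u \<in> carrier L" "w \<in> carrier L" "w \<noteq> \<zero>" "inv w \<in> carrier L" using 1 Units_V V_carr by auto
  note ip = int_pow_rules[OF up(2,3)]
  define e where "e = p [^] (int n - int m)"
  have e: "e \<in> carrier L" unfolding e_def using ip by blast
  have "p [^] n = e \<otimes> p [^] m" unfolding e_def
    using ip(3)[of "int n - int m" "int m"] by (simp add: int_pow_int)
  then have pn: "f = u \<otimes> (e \<otimes> p [^] m)" using 1(2) by simp
  have "(u \<otimes> inv w \<otimes> e) \<otimes> g = u \<otimes> ((inv w \<otimes> w) \<otimes> (e \<otimes> p [^] m))"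
    unfolding 1(4) using c e up by (simp add: m_ac del: l_inv' r_inv')
  then have "a \<otimes> g = (u \<otimes> inv w \<otimes> e) \<otimes> g" unfolding ag pn using c e up by simp
  moreover have "u \<otimes> inv w \<otimes> e \<in> carrier L" using c e by simp
  ultimately have "a = u \<otimes> inv w \<otimes> e" using cancel_r[OF a(1) _ cc(2) fg(3)] by blast
  then show ?thesis using uw unfolding e_def by blast
qed

text \<open>
  Two uniformizers differ by a unit \<open>d\<close> of \<open>V\<close>. If \<open>m < n\<close>, cancelling the power \<open>m\<close> would exhibit
  the unit \<open>u'\<close> as a multiple of \<open>p\<close>.
\<close>

lemma exponent_le:
  assumes p: "uniformizer p" "uniformizer p'" and u: "u \<in> Units VR" "u' \<in> Units VR"
    and eq: "u \<otimes> p [^] (n::int) = u' \<otimes> p' [^] (m::int)"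
  shows "n \<le> m"
proof (rule ccontr)
  assume "\<not> n \<le> m"
  then have "m < n" by simp
  note up = uniformizer_props[OF p(1)] and up' = uniformizer_props[OF p(2)]
  note ip = int_pow_rules[OF up(2,3)] and ip' = int_pow_rules[OF up'(2,3)]
  obtain d where d: "d \<in> V" "p = d \<otimes> p'" using up(5) up'(4) by blast
  obtain d' where d': "d' \<in> V" "p' = d' \<otimes> p" using up'(5) up(4) by blast
  have "(d \<otimes> d') \<otimes> p = \<one> \<otimes> p" using d d' V_carr up by (metis l_one m_assoc)
  then have dd: "d \<otimes> d' = \<one>" using cancel_r[OF m_closed[OF V_carr[OF d(1)] V_carr[OF d'(1)]] one_closed up(2,3)] by blast
  have d0: "d \<noteq> \<zero>" using dd V_carr[OF d'(1)] by auto
  have dU: "d \<in> Units VR" unfolding Units_V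
    using inv_unique'[OF V_carr[OF d(1)] V_carr[OF d'(1)] dd] d(1) d'(1) d0 by simp
  have dc: "d \<in> carrier L" "d \<noteq> \<zero>" using dU Units_V V_carr by auto
  note id = int_pow_rules[OF dc]
  interpret G: group "Multiplicative_Group.mult_of L" by (rule field_mult_group)
  have pow_d: "p [^] m = d [^] m \<otimes> p' [^] m"
  proof -
    have *: "d \<otimes>\<^bsub>Multiplicative_Group.mult_of L\<^esub> p' = p' \<otimes>\<^bsub>Multiplicative_Group.mult_of L\<^esub> d" using dc up' by (simp add: m_comm)
    have "d \<in> carrier (Multiplicative_Group.mult_of L)" "p' \<in> carrier (Multiplicative_Group.mult_of L)" using dc up' by auto
    from G.int_pow_mult_distrib[OF * this, of m] show ?thesis
      using int_pow_mult_of[OF dc] int_pow_mult_of[OF up'(2,3)] int_pow_mult_of[OF up(2,3)] d(2) by simp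
  qed
  have dpow: "d [^] (i::int) \<in> Units VR" for i
  proof -
    have n: "d [^] (j::nat) \<in> Units VR" for j
      by (induct j) (use dU Units_mult Units_one in auto)
    show ?thesis unfolding int_pow_def2 by (split if_split) (blast intro: n Units_inv)
  qed
  have c: "u \<in> carrier L" "u' \<in> carrier L" "u \<noteq> \<zero>" "u' \<noteq> \<zero>" using u Units_V V_carr by auto
  define k where "k = nat (n - m)"
  have k: "n = int k + m" "0 < k" unfolding k_def using \<open>m < n\<close> by auto
  have pn: "p [^] n = p [^] k \<otimes> (d [^] m \<otimes> p' [^] m)" unfolding k(1) using ip(3)[of "int k" m] pow_d by (simp add: int_pow_int)
  have "(u \<otimes> d [^] m \<otimes> p [^] k) \<otimes> p' [^] m = u' \<otimes> p' [^] m"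
    using eq unfolding pn using c up id(1)[of m] ip'(1)[of m] by (simp add: m_ac)
  then have "u \<otimes> d [^] m \<otimes> p [^] k = u'"
    using cancel_r[OF _ c(2) ip'(1)[of m] ip'(2)[of m]] c up id(1)[of m] by simp
  moreover have "u \<otimes> d [^] m \<in> V" using Units_mult[OF u(1) dpow[of m]] Units_V by blast
  then have "(u \<otimes> d [^] m \<otimes> p [^] (k - 1)) \<otimes> p \<in> M" using up(1,4) pow_V V_closed(3) by blast
  moreover have "u \<otimes> d [^] m \<otimes> p [^] k = (u \<otimes> d [^] m \<otimes> p [^] (k - 1)) \<otimes> p"
    using k(2) nat_pow_Suc[of p "k - 1"] c id(1)[of m] up by (simp add: m_assoc)
  ultimately have "u' \<in> M" by simp
  then show False using u unfolding M_eq by blast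
qed

text \<open>
  By \<open>exponent_le\<close> the exponent does not depend on the factorization, which makes the definite
  description in the definition of the valuation meaningful.
\<close>

lemma valuation_factorization:
  assumes p: "uniformizer p" and u: "u \<in> Units VR"
  shows "valuation L V (u \<otimes> p [^] (n::int)) = Fin n"
proof -
  note up = uniformizer_props[OF p]
  have c: "u \<in> carrier L" "u \<noteq> \<zero>" using u Units_V V_carr by auto
  have nz: "u \<otimes> p [^] n \<noteq> \<zero>" using c int_pow_rules[OF up(2,3)] by (simp add: integral_iff)
  have "(THE m::int. \<exists>p'\<in>V. \<exists>u'\<in>Units VR. M = PIdl\<^bsub>VR\<^esub> p' \<and> u \<otimes> p [^] n = u' \<otimes> p' [^] m) = n"
  proof (rule the_equality)
    show "\<exists>p'\<in>V. \<exists>u'\<in>Units VR. M = PIdl\<^bsub>VR\<^esub> p' \<and> u \<otimes> p [^] n = u' \<otimes> p' [^] n"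
      using p u unfolding uniformizer_def by blast
    fix m :: int assume "\<exists>p'\<in>V. \<exists>u'\<in>Units VR. M = PIdl\<^bsub>VR\<^esub> p' \<and> u \<otimes> p [^] n = u' \<otimes> p' [^] m"
    then obtain p' u' where *: "uniformizer p'" "u' \<in> Units VR" "u \<otimes> p [^] n = u' \<otimes> p' [^] m"
      unfolding uniformizer_def by blast
    show "m = n" using exponent_le[OF p *(1) u *(2,3)] exponent_le[OF *(1) p *(2) u *(3)[symmetric]] by simp
  qed
  then show ?thesis unfolding valuation_def using nz by simp
qed

definition v where "v w = (case valuation L V w of Fin n \<Rightarrow> n | _ \<Rightarrow> 0)"

lemma v_factorization: "uniformizer p \<Longrightarrow> u \<in> Units VR \<Longrightarrow> v (u \<otimes> p [^] (n::int)) = n"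
  unfolding v_def using valuation_factorization by simp

lemma valuation_v: "w \<in> carrier L \<Longrightarrow> w \<noteq> \<zero> \<Longrightarrow> valuation L V w = Fin (v w)"
  using uniformizer_exists int_factorization valuation_factorization v_factorization by metis

lemma valuation_zero: "valuation L V \<zero> = Pinf" unfolding valuation_def by simp

lemma v_mult:
  assumes "a \<in> carrier L" "a \<noteq> \<zero>" "b \<in> carrier L" "b \<noteq> \<zero>"
  shows "v (a \<otimes> b) = v a + v b"
proof -
  obtain p where p: "uniformizer p" using uniformizer_exists by blast
  note up = uniformizer_props[OF p]
  obtain n u m w where 1: "u \<in> Units VR" "a = u \<otimes> p [^] (n::int)" "w \<in> Units VR" "b = w \<otimes> p [^] (m::int)"
    using int_factorization[OF p assms(1,2)] int_factorization[OF p assms(3,4)] by blast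
  note ip = int_pow_rules[OF up(2,3)]
  have c: "u \<in> carrier L" "w \<in> carrier L" using 1 Units_V V_carr by auto
  have "a \<otimes> b = (u \<otimes> w) \<otimes> p [^] (n + m)" unfolding 1(2,4) ip(3) using c ip(1) by (simp add: m_ac)
  then show ?thesis using v_factorization[OF p] Units_mult[OF 1(1,3)] 1 by simp
qed

lemma V_iff_v: assumes "a \<in> carrier L" "a \<noteq> \<zero>" shows "a \<in> V \<longleftrightarrow> 0 \<le> v a"
  and M_iff_v: "a \<in> V \<Longrightarrow> a \<in> M \<longleftrightarrow> 0 < v a"
proof -
  obtain p where p: "uniformizer p" using uniformizer_exists by blast
  note up = uniformizer_props[OF p]
  note ip = int_pow_rules[OF up(2,3)]
  have V: "0 \<le> v b" if b: "b \<in> V" "b \<noteq> \<zero>" for b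
  proof -
    obtain n u where "u \<in> Units VR" "b = u \<otimes> p [^] (n::nat)" using nat_factorization[OF p b] by blast
    then have "v b = int n" using v_factorization[OF p, of u "int n"] by (simp add: int_pow_int)
    then show ?thesis by simp
  qed
  obtain n u where nu: "u \<in> Units VR" "a = u \<otimes> p [^] (n::int)" using int_factorization[OF p assms] by blast
  have va: "v a = n" using v_factorization[OF p nu(1)] nu(2) by simp
  have uV: "u \<in> V" "u \<in> carrier L" using nu Units_V V_carr by auto
  show "a \<in> V \<longleftrightarrow> 0 \<le> v a"
  proof
    assume "0 \<le> v a"
    then have "a = u \<otimes> p [^] (nat n)" using nu va int_pow_int[of L p "nat n"] by simp
    then show "a \<in> V" using uV V_closed(3) pow_V up by blast
  qed (use V assms in blast)
  assume aV: "a \<in> V"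
  then have n0: "0 \<le> n" using V assms va by auto
  show "a \<in> M \<longleftrightarrow> 0 < v a"
  proof
    assume "a \<in> M"
    then obtain b where b: "b \<in> V" "a = b \<otimes> p" using up(4) by blast
    have b0: "b \<noteq> \<zero>" using assms b up by auto
    have "v p = 1" using v_factorization[OF p Units_one, of 1] ip(4) up by simp
    then show "0 < v a" using v_mult[OF V_carr[OF b(1)] b0 up(2,3)] b(2) V[OF b(1) b0] by simp
  next
    assume "0 < v a"
    show "a \<in> M"
    proof (rule ccontr)
      assume "a \<notin> M"
      then have "a \<in> Units VR" using aV unfolding M_eq by blast
      then have "v a = 0" using v_factorization[OF p, of a 0] assms by simp
      then show False using \<open>0 < v a\<close> by simp
    qed
  qed
qed

lemma residue_field_field: "field (residue_field L V)"
  unfolding residue_field_def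
  using maximalideal.quotient_is_field[OF M_max] V_local unfolding local_ring_def by blast

lemma residue_valuation: "residue_valuation L (residue_field L V) V (Res L V) v"
proof -
  have VR: "ring VR" using subring_is_ring[OF V_sub] .
  have hom: "Res L V \<in> ring_hom VR (residue_field L V)"
    using ideal.rcos_ring_hom[OF M_ideal] unfolding residue_field_def Res_def[abs_def] .
  have surj: "Res L V ` V = carrier (residue_field L V)"
    unfolding residue_field_def FactRing_def A_RCOSETS_def' Res_def[abs_def] by auto
  have ker: "Res L V a = \<zero>\<^bsub>residue_field L V\<^esub> \<longleftrightarrow> a = \<zero> \<or> 0 < v a" if a: "a \<in> V" for a
  proof -
    have "Res L V a = \<zero>\<^bsub>residue_field L V\<^esub> \<longleftrightarrow> Res L V a = M"
      unfolding residue_field_def FactRing_def by simp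
    also have "\<dots> \<longleftrightarrow> a \<in> M"
      unfolding Res_def using ideal.rcos_const_imp_mem[OF M_ideal, of a] ring.a_rcos_zero[OF VR M_ideal, of a] a by auto
    also have "\<dots> \<longleftrightarrow> a = \<zero> \<or> 0 < v a"
    proof (cases "a = \<zero>")
      case True
      then show ?thesis using additive_subgroup.zero_closed[OF ideal.axioms(1)[OF M_ideal]] by simp
    next
      case False then show ?thesis using M_iff_v[OF V_carr[OF a] False a] by simp
    qed
    finally show ?thesis .
  qed
  show ?thesis
  proof (intro residue_valuation.intro residue_valuation_axioms.intro)
    show "field L" by (rule field_axioms)
    show "field (residue_field L V)" by (rule residue_field_field)
  qed (fact V_sub v_mult V_iff_v hom surj ker)+
qed

end

section \<open>Dicritical divisors\<close>

text \<open>
  The hypotheses of the theorem, with the residue data of the preceding sections attached to \<open>V\<close>.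
\<close>

locale dicritical_setup = field L for L :: "('a, 'b) ring_scheme" (structure) +
  fixes R V z x y f and a\<^sub>0 b\<^sub>0 :: nat
  assumes qfR: "quotient_field_of L R"
    and reg: "regular_local_ring 2 (L\<lparr>carrier := R\<rparr>)"
    and dic: "dicritical_divisor L R z V"
    and par: "regular_parameters (L\<lparr>carrier := R\<rparr>) x y"
    and f_def: "f = z \<otimes> (x [^] a\<^sub>0) \<otimes> (y [^] b\<^sub>0)" and fR: "f \<in> R"
begin

abbreviation "RR \<equiv> L\<lparr>carrier := R\<rparr>"
abbreviation "F \<equiv> residue_field L V"
abbreviation "K \<equiv> base_field L R V"
abbreviation "K' \<equiv> rel_alg_closure F K"

lemma prime: "prime_divisor L R V" and zV: "z \<in> V" and z_tr: "ring.transcendental F K (Res L V z)"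
  using dic unfolding dicritical_divisor_def by auto

lemma dominating: "R \<subseteq> V" "max_ideal (L\<lparr>carrier := V\<rparr>) \<inter> R = max_ideal RR"
  using prime unfolding prime_divisor_def dominates_def by auto

sublocale D: dvr_in_field L V
  by unfold_locales (use prime in \<open>auto simp: prime_divisor_def\<close>)

sublocale RV: residue_valuation L F V "Res L V" D.v
  by (rule D.residue_valuation)

lemma R_sub: "subring R L" using qfR unfolding quotient_field_of_def by blast

lemma max_ideal_nonunits: "max_ideal RR = R - Units RR"
  using local_ring_max_ideal[of RR] reg unfolding regular_local_ring_def by auto

lemma max_ideal_iff: "r \<in> R \<Longrightarrow> r \<in> max_ideal RR \<longleftrightarrow> RV.ge 1 r"
proof -
  assume r: "r \<in> R"
  then have rV: "r \<in> V" using dominating by blast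
  have "r \<in> max_ideal RR \<longleftrightarrow> r \<in> D.M" using dominating r by blast
  also have "\<dots> \<longleftrightarrow> RV.ge 1 r"
  proof (cases "r = \<zero>")
    case True
    then show ?thesis using additive_subgroup.zero_closed[OF ideal.axioms(1)[OF D.M_ideal]] by simp
  next
    case False
    then show ?thesis using D.M_iff_v[OF _ False rV] RV.V_carrier[OF rV] unfolding RV.ge_def by auto
  qed
  finally show ?thesis .
qed

lemma R_inverse: assumes r: "r \<in> R" "\<not> RV.ge 1 r" shows "inv r \<in> R"
proof -
  have "r \<in> Units RR" using max_ideal_nonunits max_ideal_iff r by blast
  then obtain b where b: "b \<in> R" "r \<otimes> b = \<one>" unfolding Units_def by auto
  then have "b = inv r" using inv_unique' r subringE(1)[OF R_sub] by blast
  then show ?thesis using b by simp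
qed

lemma local_at: "RV.local_at R x y"
  unfolding RV.local_at_def
proof (intro conjI ballI impI)
  have cr: "cring RR" using reg unfolding regular_local_ring_def local_ring_def by blast
  have xy: "x \<in> R" "y \<in> R" "max_ideal RR = Idl\<^bsub>RR\<^esub> {x, y}" using par unfolding regular_parameters_def by auto
  show "subring R L" "R \<subseteq> V" "x \<in> R" "y \<in> R" using R_sub dominating xy by auto
  have "{x, y} \<subseteq> max_ideal RR" unfolding xy(3)
    using ring.genideal_self[OF subring_is_ring[OF R_sub], of "{x, y}"] xy by auto
  then show "RV.ge 1 x" "RV.ge 1 y" using max_ideal_iff xy by auto
  fix r assume r: "r \<in> R"
  show "\<exists>p\<in>R. \<exists>q\<in>R. r = p \<otimes> x \<oplus> q \<otimes> y" if "RV.ge 1 r"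
    using cring.idl_pair[OF cr, of x y r] xy max_ideal_iff[OF r] that by auto
  show "inv r \<in> R" if "\<not> RV.ge 1 r" using R_inverse r that by blast
qed

lemma quotient: "w \<in> carrier L \<Longrightarrow> \<exists>a\<in>R. \<exists>b\<in>R - {\<zero>}. w = a \<otimes> inv b"
  using qfR unfolding quotient_field_of_def by blast

lemma K_carrier: "K \<subseteq> carrier F"
  unfolding base_field_def using RV.res_closed dominating by blast

lemma K_subfield: "subfield K F"
proof (rule RV.F.subfieldI'[OF RV.F.subringI])
  show "K \<subseteq> carrier F" by (rule K_carrier)
  show "\<one>\<^bsub>F\<^esub> \<in> K" unfolding base_field_def using RV.res_one subringE(3)[OF R_sub] by (metis imageI)
  fix h assume "h \<in> K"
  then obtain r where r: "r \<in> R" "h = Res L V r" unfolding base_field_def by blast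
  have rV: "r \<in> V" using r dominating by blast
  show "\<ominus>\<^bsub>F\<^esub> h \<in> K" unfolding base_field_def r(2)
    using RV.res_uminus[OF rV] subringE(5)[OF R_sub r(1)] by (metis imageI)
  fix h' assume "h' \<in> K"
  then obtain r' where r': "r' \<in> R" "h' = Res L V r'" unfolding base_field_def by blast
  have rV': "r' \<in> V" using r' dominating by blast
  show "h \<otimes>\<^bsub>F\<^esub> h' \<in> K" unfolding base_field_def r(2) r'(2)
    using RV.res_mult[OF rV rV'] subringE(6)[OF R_sub r(1) r'(1)] by (metis imageI)
  show "h \<oplus>\<^bsub>F\<^esub> h' \<in> K" unfolding base_field_def r(2) r'(2)
    using RV.res_add[OF rV rV'] subringE(7)[OF R_sub r(1) r'(1)] by (metis imageI)
next
  fix h assume h: "h \<in> K - {\<zero>\<^bsub>F\<^esub>}"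
  then obtain r where r: "r \<in> R" "h = Res L V r" unfolding base_field_def by blast
  have rV: "r \<in> V" using r dominating by blast
  have "r \<noteq> \<zero>" "D.v r = 0" using RV.res_nonzero[OF rV] h r by auto
  then have "inv\<^bsub>F\<^esub> h = Res L V (inv r)" "\<not> RV.ge 1 r"
    using RV.res_inv[OF rV] RV.not_ge1[OF rV] r by auto
  then show "inv\<^bsub>F\<^esub> h \<in> K" unfolding base_field_def using R_inverse[OF r(1)] by blast
qed

lemma K'_eq: "K' = {u \<in> carrier F. \<not> ring.transcendental F K u}"
  unfolding rel_alg_closure_def ..

lemma K'_subfield: "subfield K' F"
  using RV.F.subfield_of_algebraics[OF K_subfield] unfolding K'_eq over_def .

lemma closed_subfield: "relatively_closed_subfield F K'"
proof (intro relatively_closed_subfield.intro relatively_closed_subfield_axioms.intro)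
  show "field F" by (rule D.residue_field_field)
  show "subfield K' F" by (rule K'_subfield)
  fix u n a c assume u: "u \<in> carrier F" "u \<notin> K'" and rel: "a \<in> RV.F.poly_values K' u n" "c \<in> K'"
    "a \<oplus>\<^bsub>F\<^esub> c \<otimes>\<^bsub>F\<^esub> u [^]\<^bsub>F\<^esub> n = \<zero>\<^bsub>F\<^esub>"
  have "RV.F.transcendental K' u"
    using RV.F.algebraic_trans[OF K_subfield u(1) K'_eq subfieldE(1)[OF K'_subfield]] u unfolding K'_eq by blast
  then show "c = \<zero>\<^bsub>F\<^esub>"
    using RV.F.transcendental_no_relation[OF subfieldE(1)[OF K'_subfield] u(1) _ rel] by blast
qed

sublocale RC: residue_closure L F V "Res L V" D.v K' K
proof (intro residue_closure.intro residue_closure_axioms.intro)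
  show "residue_valuation L F V (Res L V) D.v" by (rule D.residue_valuation)
  show "relatively_closed_subfield F K'" by (rule closed_subfield)
  fix \<tau> assume "\<tau> \<in> K'"
  then have "\<tau> \<in> carrier F" "\<not> RV.F.transcendental K \<tau>" unfolding K'_eq by auto
  then show "\<exists>n. \<exists>a\<in>RV.F.poly_values K \<tau> n. a \<oplus>\<^bsub>F\<^esub> \<tau> [^]\<^bsub>F\<^esub> n = \<zero>\<^bsub>F\<^esub>"
    using RV.F.algebraic_monic_relation[OF K_subfield] by blast
qed

lemma res_R: "Res L V ` R \<subseteq> K'" "K \<subseteq> Res L V ` R"
proof -
  show "K \<subseteq> Res L V ` R" unfolding base_field_def ..
  have "K \<subseteq> K'"
  proof
    fix h assume h: "h \<in> K"
    have "\<not> RV.F.transcendental K h"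
      using RV.F.algebraic_self[OF subfieldE(1)[OF K_subfield] h] unfolding over_def .
    then show "h \<in> K'" unfolding K'_eq using h K_carrier by blast
  qed
  then show "Res L V ` R \<subseteq> K'" unfolding base_field_def .
qed

lemma res_z: "Res L V z \<notin> K'" using z_tr unfolding K'_eq by simp

lemma residue_polynomial_iff: "residue_polynomial L R V z \<longleftrightarrow> RC.polynomial_residue (Res L V z)"
proof -
  have "(\<exists>p\<in>carrier (univ_poly F K'). Res L V z = ring.eval F p t) \<longleftrightarrow> Res L V z \<in> RV.F.simple_extension K' t"
    if "t \<in> carrier F" for t
    unfolding RV.F.simple_extension_as_eval_img[OF subfieldE(3)[OF K'_subfield] that] by blast
  moreover have "ring.transcendental F K t \<longleftrightarrow> t \<notin> K'" if "t \<in> carrier F" for t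
    using that unfolding K'_eq by blast
  ultimately show ?thesis
    unfolding residue_polynomial_def Let_def RC.polynomial_residue_def by (metis (no_types, lifting))
qed

lemma y0: "y \<noteq> \<zero>"
  using RC.parameter_nonzero[OF local_at res_R(1) quotient zV res_z] .

lemma x0: "x \<noteq> \<zero>"
  using RC.parameter_nonzero[OF RV.local_at_swap[OF local_at] res_R(1) quotient zV res_z] .

sublocale W: weighted_chart L F V "Res L V" D.v K' K R x y "nat (D.v x)" "nat (D.v y)"
  by (rule RC.weighted_chartI[OF local_at res_R x0 y0])

lemma val_xy: "valuation L V x = Fin (int (nat (D.v x)))" "valuation L V y = Fin (int (nat (D.v y)))"
  using D.valuation_v[OF W.xc x0] D.valuation_v[OF W.yc y0] W.vx W.vy by simp_all

lemma f_mon: "f = z \<otimes> W.mon (a\<^sub>0, b\<^sub>0)"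
  unfolding f_def W.mon_def using RV.V_carrier[OF zV] W.xc W.yc by (simp add: m_assoc)

lemma xy_sum_carrier: "finite (xy_support L c) \<Longrightarrow> (\<And>p. c p \<in> R) \<Longrightarrow> xy_sum L x y c \<in> carrier L"
  using W.xy_sum_superset[of "xy_support L c" c] W.R_carrier W.mon_carrier by (auto intro!: finsum_closed)

text \<open>
  The bridge between monomiality as defined by expansions and the transcendence of the residue
  of \<open>s\<close>.
\<close>

lemma monomial_iff: "monomial_valuation L R V x y \<longleftrightarrow> Res L V W.s \<notin> K'"
proof
  assume "monomial_valuation L R V x y"
  then obtain \<alpha> \<beta> where m: "valuation L V x = Fin \<alpha>" "valuation L V y = Fin \<beta>"
    "\<And>c. finite (xy_support L c) \<and> xy_support L c \<noteq> {} \<and>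
            (\<forall>p. c p = \<zero> \<or> c p \<in> R - max_ideal RR) \<Longrightarrow>
          valuation L V (xy_sum L x y c) = Fin (Min ((\<lambda>(a, b). int a * \<alpha> + int b * \<beta>) ` xy_support L c))"
    unfolding monomial_valuation_def by (elim exE conjE) simp
  have ab: "\<alpha> = int (nat (D.v x))" "\<beta> = int (nat (D.v y))" using m(1,2) val_xy by auto
  show "Res L V W.s \<notin> K'"
  proof (rule W.monomial_imp_transcendental)
    fix c assume c: "finite (xy_support L c)" "xy_support L c \<noteq> {}" "\<And>p. c p = \<zero> \<or> c p \<in> R \<and> \<not> RV.ge 1 (c p)"
    have e: "(\<lambda>(a, b). int a * \<alpha> + int b * \<beta>) = (\<lambda>p. int (W.wt p))"
      unfolding W.wt_def ab by (auto simp: fun_eq_iff)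
    have c': "\<forall>p. c p = \<zero> \<or> c p \<in> R - max_ideal RR" using c(3) max_ideal_iff by blast
    have val: "valuation L V (xy_sum L x y c) = Fin (Min ((\<lambda>p. int (W.wt p)) ` xy_support L c))"
      using m(3)[of c] c(1,2) c' unfolding e by simp
    have n0: "xy_sum L x y c \<noteq> \<zero>" using val D.valuation_zero by auto
    have cR: "c p \<in> R" for p using c(3)[of p] W.R_closed(2) by auto
    show "xy_sum L x y c \<noteq> \<zero> \<and> D.v (xy_sum L x y c) = Min ((\<lambda>p. int (W.wt p)) ` xy_support L c)"
      using val n0 D.valuation_v[OF xy_sum_carrier[OF c(1) cR] n0] by simp
  qed
next
  assume s: "Res L V W.s \<notin> K'"
  interpret T: transcendental_chart L F V "Res L V" D.v K' K R x y "nat (D.v x)" "nat (D.v y)"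
    by unfold_locales (rule s)
  show "monomial_valuation L R V x y"
    unfolding monomial_valuation_def
  proof (intro exI conjI allI impI)
    show "valuation L V x = Fin (int (nat (D.v x)))" "valuation L V y = Fin (int (nat (D.v y)))" by (fact val_xy)+
    fix c assume "finite (xy_support L c) \<and> xy_support L c \<noteq> {} \<and> (\<forall>p. c p = \<zero> \<or> c p \<in> R - max_ideal RR)"
    then have c: "finite (xy_support L c)" "xy_support L c \<noteq> {}" "\<And>p. c p = \<zero> \<or> c p \<in> R \<and> \<not> RV.ge 1 (c p)"
      using max_ideal_iff by blast+
    have e: "(\<lambda>(a, b). int a * int (nat (D.v x)) + int b * int (nat (D.v y))) = (\<lambda>p. int (W.wt p))"
      unfolding W.wt_def by (auto simp: fun_eq_iff)
    have cR: "c p \<in> R" for p using c(3)[of p] W.R_closed(2) by auto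
    show "valuation L V (xy_sum L x y c) =
        Fin (Min ((\<lambda>(a, b). int a * int (nat (D.v x)) + int b * int (nat (D.v y))) ` xy_support L c))"
      unfolding e using T.transcendental_imp_monomial[OF c] D.valuation_v[OF xy_sum_carrier[OF c(1) cR]] by simp
  qed
qed

lemma B_set_lead:
  assumes "W.expansion \<gamma> f c"
  shows "B_set L R (nat (D.v x)) (nat (D.v y)) \<gamma> c = snd ` W.lead \<gamma> c"
proof -
  have cR: "c p \<in> R" for p using assms unfolding weighted_expansion_def by blast
  have "c p \<in> R - max_ideal RR \<longleftrightarrow> \<not> RV.ge 1 (c p)" for p using max_ideal_iff[OF cR] cR by blast
  then show ?thesis unfolding B_set_def W.lead_def W.wt_def by (force simp: image_iff)
qed

theorem not_monomial_case: "\<not> monomial_valuation L R V x y \<Longrightarrow> residue_polynomial L R V z"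
proof -
  assume "\<not> monomial_valuation L R V x y"
  then have s: "Res L V W.s \<in> K'" using monomial_iff by blast
  have "\<not> RC.transcendental_monomials x y"
  proof
    assume "RC.transcendental_monomials x y"
    then have "Res L V W.s \<notin> K'"
      using transcendental_chart.s_notin[OF RC.transcendental_chartI[OF local_at res_R]] by blast
    then show False using s by blast
  qed
  moreover have "z \<otimes> (x [^] a\<^sub>0 \<otimes> y [^] b\<^sub>0) \<in> R" using fR f_mon unfolding W.mon_def by simp
  ultimately show ?thesis unfolding residue_polynomial_iff
    using RC.polynomial_residue_descent[OF local_at res_R quotient zV res_z] x0 y0 by blast
qed

text \<open>
  The leading terms of an expansion correspond to the elements of \<open>B\<close> by their exponent of \<open>y\<close>, so the
  position of \<open>b\<^sub>0\<close> relative to \<open>B\<close> decides between the one-sided and the two-sided case.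
\<close>

theorem monomial_case:
  fixes \<alpha> \<beta> \<gamma> :: nat
  defines "\<alpha> \<equiv> nat (D.v x)" and "\<beta> \<equiv> nat (D.v y)" and "\<gamma> \<equiv> a\<^sub>0 * nat (D.v x) + b\<^sub>0 * nat (D.v y)"
  assumes mon: "monomial_valuation L R V x y"
  shows "0 < \<alpha>" "0 < \<beta>" "valuation L V x = Fin (int \<alpha>)" "valuation L V y = Fin (int \<beta>)"
    "\<gamma> = a\<^sub>0 * \<alpha> + b\<^sub>0 * \<beta>" "valuation L V f = Fin (int \<gamma>)"
    "\<exists>c. weighted_expansion L R x y \<alpha> \<beta> \<gamma> f c"
    "weighted_expansion L R x y \<alpha> \<beta> \<gamma> f c \<Longrightarrow> B_set L R \<alpha> \<beta> \<gamma> c \<noteq> {}"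
    "weighted_expansion L R x y \<alpha> \<beta> \<gamma> f c \<Longrightarrow> residue_polynomial L R V z \<longleftrightarrow>
        b\<^sub>0 \<le> Min (B_set L R \<alpha> \<beta> \<gamma> c) \<or> b\<^sub>0 \<ge> Max (B_set L R \<alpha> \<beta> \<gamma> c)"
    "weighted_expansion L R x y \<alpha> \<beta> \<gamma> f c \<Longrightarrow> B_set L R \<alpha> \<beta> \<gamma> c = {b\<^sub>1} \<Longrightarrow>
        b\<^sub>0 \<noteq> b\<^sub>1 \<and> residue_polynomial L R V z"
proof -
  interpret T: transcendental_chart L F V "Res L V" D.v K' K R x y "nat (D.v x)" "nat (D.v y)"
    by unfold_locales (use mon monomial_iff in blast)
  let ?q = "(a\<^sub>0, b\<^sub>0)"
  have \<gamma>: "\<gamma> = W.wt ?q" unfolding \<gamma>_def W.wt_def by simp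
  have z0: "z \<in> carrier L" "z \<noteq> \<zero>" "D.v z = 0"
    using RV.V_carrier[OF zV] RV.res_nonzero[OF zV] res_z RC.K.k_closed(2) by auto
  have f0: "f \<noteq> \<zero>" "f \<in> carrier L" "D.v f = int \<gamma>"
    unfolding f_mon \<gamma> using z0 W.mon_carrier[of ?q] W.mon_nonzero[of ?q] W.v_mon[of ?q] by (auto simp: D.v_mult integral_iff)
  show "0 < \<alpha>" "0 < \<beta>" unfolding \<alpha>_def \<beta>_def by (fact W.\<alpha>_pos W.\<beta>_pos)+
  show "valuation L V x = Fin (int \<alpha>)" "valuation L V y = Fin (int \<beta>)" unfolding \<alpha>_def \<beta>_def by (fact val_xy)+
  show "\<gamma> = a\<^sub>0 * \<alpha> + b\<^sub>0 * \<beta>" unfolding \<alpha>_def \<beta>_def \<gamma>_def ..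
  show "valuation L V f = Fin (int \<gamma>)" using D.valuation_v[OF f0(2,1)] f0(3) by simp
  show "\<exists>c. weighted_expansion L R x y \<alpha> \<beta> \<gamma> f c"
    using T.ge_expandable[OF fR, of \<gamma>] RV.ge_self[OF f0(2)] f0(3) unfolding W.expandable_def \<alpha>_def \<beta>_def by simp
  assume c0: "weighted_expansion L R x y \<alpha> \<beta> \<gamma> f c"
  have c: "W.expansion (W.wt ?q) f c" using c0 unfolding \<alpha>_def \<beta>_def \<gamma> .
  let ?l = "W.lead (W.wt ?q) c"
  have Bl: "B_set L R \<alpha> \<beta> \<gamma> c = snd ` ?l" using B_set_lead[OF c] unfolding \<alpha>_def \<beta>_def \<gamma> .
  have fin: "finite (snd ` ?l)" using W.lead_finite[OF c] by blast
  have ne: "snd ` ?l \<noteq> {}" using T.lead_ne[OF quotient zV res_z f_mon c] by blast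
  then show "B_set L R \<alpha> \<beta> \<gamma> c \<noteq> {}" unfolding Bl .
  show "residue_polynomial L R V z \<longleftrightarrow>
      b\<^sub>0 \<le> Min (B_set L R \<alpha> \<beta> \<gamma> c) \<or> b\<^sub>0 \<ge> Max (B_set L R \<alpha> \<beta> \<gamma> c)"
    unfolding Bl
  proof
    assume "b\<^sub>0 \<le> Min (snd ` ?l) \<or> b\<^sub>0 \<ge> Max (snd ` ?l)"
    then have "(\<forall>p\<in>?l. snd ?q \<le> snd p) \<or> (\<forall>p\<in>?l. snd p \<le> snd ?q)"
    proof (rule disj_forward)
      assume le: "b\<^sub>0 \<le> Min (snd ` ?l)"
      show "\<forall>p\<in>?l. snd ?q \<le> snd p"
      proof
        fix p assume "p \<in> ?l"
        then show "snd ?q \<le> snd p" using le_trans[OF le Min_le[OF fin imageI]] by simp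
      qed
    next
      assume le: "b\<^sub>0 \<ge> Max (snd ` ?l)"
      show "\<forall>p\<in>?l. snd p \<le> snd ?q"
      proof
        fix p assume "p \<in> ?l"
        then show "snd p \<le> snd ?q" using le_trans[OF Max_ge[OF fin imageI] le] by simp
      qed
    qed
    then show "residue_polynomial L R V z" unfolding residue_polynomial_iff
      using T.polynomial_residue_one_sided[OF quotient zV res_z f_mon c] by blast
  next
    assume rp: "residue_polynomial L R V z"
    show "b\<^sub>0 \<le> Min (snd ` ?l) \<or> b\<^sub>0 \<ge> Max (snd ` ?l)"
    proof (rule ccontr)
      assume n: "\<not> (b\<^sub>0 \<le> Min (snd ` ?l) \<or> b\<^sub>0 \<ge> Max (snd ` ?l))"
      obtain p where p: "p \<in> ?l" "snd p = Min (snd ` ?l)"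
      proof -
        from Min_in[OF fin ne] show thesis by (rule imageE) (rule that, simp_all)
      qed
      obtain p' where p': "p' \<in> ?l" "snd p' = Max (snd ` ?l)"
      proof -
        from Max_in[OF fin ne] show thesis by (rule imageE) (rule that, simp_all)
      qed
      have ext: "snd p \<le> snd r" "snd r \<le> snd p'" if "r \<in> ?l" for r
        unfolding p(2) p'(2) using Min_le[OF fin] Max_ge[OF fin] that by auto
      have strict: "snd p < snd ?q" "snd ?q < snd p'" unfolding p(2) p'(2) using n by auto
      have "\<not> RC.polynomial_residue (Res L V z)"
        using T.not_polynomial_residue_two_sided[OF quotient zV res_z f_mon c p(1) ext(1) strict(1) p'(1) ext(2) strict(2)]
        by blast
      then show False using rp unfolding residue_polynomial_iff by blast
    qed
  qed
  assume "B_set L R \<alpha> \<beta> \<gamma> c = {b\<^sub>1}"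
  then have b1: "snd ` ?l = {b\<^sub>1}" unfolding Bl .
  have "b\<^sub>1 \<in> snd ` ?l" unfolding b1 by simp
  then obtain p where p: "p \<in> ?l" "snd p = b\<^sub>1" by blast
  have "?l = {p}" using W.lead_snd_inj[THEN inj_onD, OF _ _ p(1)] b1 p by blast
  then show "b\<^sub>0 \<noteq> b\<^sub>1 \<and> residue_polynomial L R V z" unfolding residue_polynomial_iff
    using T.lead_singleton[OF quotient zV res_z f_mon c] p(2) by auto
qed

end

theorem theorem3p2:
  fixes L :: "('a, 'b) ring_scheme" (structure)
    and R V :: "'a set" and z x y f :: 'a and a\<^sub>0 b\<^sub>0 :: nat
  assumes "quotient_field_of L R"
    and "regular_local_ring 2 (L\<lparr>carrier := R\<rparr>)"
    and "z \<in> carrier L" and "z \<noteq> \<zero>"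
    and "dicritical_divisor L R z V"
    and "regular_parameters (L\<lparr>carrier := R\<rparr>) x y"
    and "f = z \<otimes> (x [^] a\<^sub>0) \<otimes> (y [^] b\<^sub>0)" and "f \<in> R"
  shows
    "(\<not> monomial_valuation L R V x y \<longrightarrow> residue_polynomial L R V z) \<and>
     (monomial_valuation L R V x y \<longrightarrow>
       (\<exists>\<alpha> \<beta> \<gamma> :: nat. \<alpha> > 0 \<and> \<beta> > 0 \<and>
          valuation L V x = Fin (int \<alpha>) \<and> valuation L V y = Fin (int \<beta>) \<and>
          \<gamma> = a\<^sub>0 * \<alpha> + b\<^sub>0 * \<beta> \<and> valuation L V f = Fin (int \<gamma>) \<and>
          (\<exists>c. weighted_expansion L R x y \<alpha> \<beta> \<gamma> f c) \<and>
          (\<forall>c. weighted_expansion L R x y \<alpha> \<beta> \<gamma> f c \<longrightarrow>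
             B_set L R \<alpha> \<beta> \<gamma> c \<noteq> {} \<and>
             (card (B_set L R \<alpha> \<beta> \<gamma> c) \<ge> 2 \<longrightarrow>
                (residue_polynomial L R V z \<longleftrightarrow>
                   b\<^sub>0 \<le> Min (B_set L R \<alpha> \<beta> \<gamma> c) \<or> b\<^sub>0 \<ge> Max (B_set L R \<alpha> \<beta> \<gamma> c))) \<and>
             (\<forall>b\<^sub>1. B_set L R \<alpha> \<beta> \<gamma> c = {b\<^sub>1} \<longrightarrow>
                b\<^sub>0 \<noteq> b\<^sub>1 \<and> residue_polynomial L R V z))))"
proof -
  interpret field L using assms(1) unfolding quotient_field_of_def by blast
  interpret dicritical_setup L R V z x y f a\<^sub>0 b\<^sub>0
    by unfold_locales (fact assms)+
  show ?thesis
  proof (intro conjI[OF impI impI], erule not_monomial_case)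
    assume "monomial_valuation L R V x y"
    note mc = monomial_case[OF this]
    show "\<exists>\<alpha> \<beta> \<gamma> :: nat. \<alpha> > 0 \<and> \<beta> > 0 \<and>
          valuation L V x = Fin (int \<alpha>) \<and> valuation L V y = Fin (int \<beta>) \<and>
          \<gamma> = a\<^sub>0 * \<alpha> + b\<^sub>0 * \<beta> \<and> valuation L V f = Fin (int \<gamma>) \<and>
          (\<exists>c. weighted_expansion L R x y \<alpha> \<beta> \<gamma> f c) \<and>
          (\<forall>c. weighted_expansion L R x y \<alpha> \<beta> \<gamma> f c \<longrightarrow>
             B_set L R \<alpha> \<beta> \<gamma> c \<noteq> {} \<and>
             (card (B_set L R \<alpha> \<beta> \<gamma> c) \<ge> 2 \<longrightarrow>
                (residue_polynomial L R V z \<longleftrightarrow>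
                   b\<^sub>0 \<le> Min (B_set L R \<alpha> \<beta> \<gamma> c) \<or> b\<^sub>0 \<ge> Max (B_set L R \<alpha> \<beta> \<gamma> c))) \<and>
             (\<forall>b\<^sub>1. B_set L R \<alpha> \<beta> \<gamma> c = {b\<^sub>1} \<longrightarrow>
                b\<^sub>0 \<noteq> b\<^sub>1 \<and> residue_polynomial L R V z))"
      by (rule exI[of _ "nat (D.v x)"], rule exI[of _ "nat (D.v y)"],
          rule exI[of _ "a\<^sub>0 * nat (D.v x) + b\<^sub>0 * nat (D.v y)"])
        (intro conjI[OF mc(1)] conjI[OF mc(2)] conjI[OF mc(3)] conjI[OF mc(4)] conjI[OF mc(5)]
          conjI[OF mc(6)] conjI[OF mc(7)] allI impI, intro conjI impI allI mc(8-10))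
  qed
qed

end
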